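(* Assume that the standing assumptions (A1)-(A12) listed in the context hold. Then there exists a unique solution $(\theta,\varphi)$ (in the sense defined in the context) of the problem $$ \begin{cases} \dfrac{d\theta}{dt}+\eta\dfrac{d\varphi}{dt}+A_{1}\theta=0 & \text{in }(0,T),\\[2mm] L\dfrac{d^2\varphi}{dt^2}+B_{1}\dfrac{d\varphi}{dt}+A_{2}\varphi+\Phi\varphi+\mathcal{L}\varphi=B_{2}\theta & \text{in }(0,T),\\[2mm] \theta(0)=\theta_{0},\ \varphi(0)=\varphi_{0},\ \dfrac{d\varphi}{dt}(0)=v_{0}. \end{cases} $$
   Context: Setting. $T>0$ and $\eta>0$ are real constants. $(\cdot,\cdot)_H$ is the inner product of $H$, $\langle\cdot,\cdot\rangle_{V^*,V}$ the duality pairing, $I$ the identity. Standing assumptions. (A1) $V$ and $H$ are real Hilbert spaces, $V\subset H$ with dense, continuous and compact embedding; $V\subset H\subset V^{*}$ by identifying $H$ with its dual, where $V^*$ is the dual of $V$. (A2) $L:H\to H$ is a bounded linear operator with $(Lw,z)_H=(w,Lz)_H$ for all $w,z\in H$ and $(Lw,w)_H\ge c_L\|w\|_H^2$ for all $w\in H$, where $c_L>0$ is a constant. (A3) $A_j:D(A_j)\subset H\to H$ ($j=1,2$) are linear maximal monotone selfadjoint operators, $D(A_j)$ being linear subspaces of $H$ with $D(A_j)\subset V$. There exist bounded linear monotone operators $A_j^*:V\to V^*$ ($j=1,2$) such that $\langle A_j^*w,z\rangle_{V^*,V}=\langle A_j^*z,w\rangle_{V^*,V}$ for all $w,z\in V$,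 and $A_j^*w=A_jw$ for all $w\in D(A_j)$. Moreover, for all $\alpha>0$ and $j=1,2$ there exists $\omega_{j,\alpha}>0$ such that $\langle A_j^*w,w\rangle_{V^*,V}+\alpha\|w\|_H^2\ge\omega_{j,\alpha}\|w\|_V^2$ for all $w\in V$. (A4) $B_j:D(B_j)\subset H\to H$ ($j=1,2$) are linear maximal monotone selfadjoint operators, $D(B_j)$ being linear subspaces of $H$, with $D(A_1)\subset D(B_2)$, $D(B_1)\cap D(A_2)\ne\emptyset$, $(B_1w,A_2w)_H\ge0$ for all $w\in D(B_1)\cap D(A_2)$, $(B_2w,A_1w)_H\ge0$ for all $w\in D(A_1)$, and $(B_1w,A_2z)_H=(B_1z,A_2w)_H$ for all $w,z\in D(B_1)\cap D(A_2)$. Moreover $D(A_2)\subset V$. (A5) There is a constant $C_{A_1,B_2}>0$ with $\|B_2\theta\|_H\le C_{A_1,B_2}(\|A_1\theta\|_H+\|\theta\|_H)$ for all $\theta\in D(A_1)$. (A6) $\Phi:D(\Phi)\subset H\to H$ is a (single-valued) maximal monotone operator with $\Phi(0)=0$ and $V\subset D(\Phi)$; there exist constants $p,q,C_\Phi>0$ with $\|\Phi w-\Phi z\|_H\le C_\Phi(1+\|w\|_V^p+\|z\|_V^q)\|w-z\|_V$ for all $w,z\in V$. (A7) There is a lower semicontinuous convex function $i:V\to\{x\in\mathbb{R}\mid x\ge0\}$ with $(\Phi w,w-z)_H\ge i(w)-i(z)$ for all $w,z\in V$. (A8) For $\lambda>0$ let $\Phi_\lambda:H\to H$ be the Yosida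 approximation of $\Phi$. Then $\Phi_\lambda(0)=0$, $(\Phi_\lambda w,B_1w)_H\ge0$ for all $w\in D(B_1)$, and $(\Phi_\lambda w,A_2w)_H\ge0$ for all $w\in D(A_2)$. (A9) $B_j^*:V\to V^*$ ($j=1,2$) are bounded linear monotone operators with $\langle B_j^*w,z\rangle_{V^*,V}=\langle B_j^*z,w\rangle_{V^*,V}$ for all $w,z\in V$ and $B_j^*w=B_jw$ for all $w\in D(B_j)\cap V$. (A10) For all $g\in H$, $a,b,c,d,d'>0$, $\lambda>0$, $h>0$: if $\varphi_\lambda\in V$ satisfies $L\varphi_\lambda+aB_1^*\varphi_\lambda+bA_2^*\varphi_\lambda+c\Phi_\lambda\varphi_\lambda+d\mathcal{L}\varphi_\lambda+d'B_2(I+hA_1)^{-1}\varphi_\lambda=g$ in $V^*$, then $\varphi_\lambda\in D(B_1)\cap D(A_2)$ and $L\varphi_\lambda+aB_1\varphi_\lambda+bA_2\varphi_\lambda+c\Phi_\lambda\varphi_\lambda+d\mathcal{L}\varphi_\lambda+d'B_2(I+hA_1)^{-1}\varphi_\lambda=g$ in $H$. (A11) $\mathcal{L}:H\to H$ is Lipschitz continuous with Lipschitz constant $C_{\mathcal{L}}>0$. (A12) $\theta_0\in D(A_1)$, $A_1\theta_0\in V$, $\varphi_0\in D(B_1)\cap D(A_2)$, $v_0\in D(B_1)\cap V$. Definition of solution. A pair $(\theta,\varphi)$ with $\theta\in H^1(0,T;V)\cap L^\infty(0,T;V)\cap L^\infty(0,T;D(A_1))$, $\varphi\in W^{2,\infty}(0,T;H)\cap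 W^{1,\infty}(0,T;V)\cap L^2(0,T;D(A_2))$, $\frac{d\varphi}{dt}\in L^2(0,T;D(B_1))$, $\Phi\varphi\in L^\infty(0,T;H)$ is called a solution of the problem if $\frac{d\theta}{dt}+\eta\frac{d\varphi}{dt}+A_1\theta=0$ in $H$ a.e. on $(0,T)$, $L\frac{d^2\varphi}{dt^2}+B_1\frac{d\varphi}{dt}+A_2\varphi+\Phi\varphi+\mathcal{L}\varphi=B_2\theta$ in $H$ a.e. on $(0,T)$, and $\theta(0)=\theta_0$, $\varphi(0)=\varphi_0$, $\frac{d\varphi}{dt}(0)=v_0$ in $H$. *)

theory Defs
  imports "HOL-Analysis.Analysis"
begin

(* Conventions.
   - H and V are Hilbert spaces given as types 'h, 'v of sort {real_inner, banach}.
     The inclusion of V in H is an injective bounded linear map \<iota>, the dual of V is the type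
     'v \<Rightarrow>\<^sub>L real, and "D is contained in V" reads D \<subseteq> range \<iota>.
   - The sort second_countable_topology is required by the library's Bochner integral.  It
     excludes nothing: if \<iota> is injective and compact with dense range, then H is separable,
     being the closure of the union of the relatively compact images of the balls of V; and the
     adjoint of \<iota> maps H onto a dense subspace of V (as \<iota> is injective), so V is separable.
   - A (partially defined, single-valued) operator in H is a domain D :: 'h set together with
     a function A :: 'h \<Rightarrow> 'h whose values outside D are irrelevant. *)

section \<open>Operators in a Hilbert space\<close>

definition op_graph :: "'a set \<Rightarrow> ('a \<Rightarrow> 'a) \<Rightarrow> ('a \<times> 'a) set" where
  "op_graph D A = {(x, A x) | x. x \<in> D}"

definition monotone_graph :: "('a::real_inner \<times> 'a) set \<Rightarrow> bool" where
  "monotone_graph G \<longleftrightarrow> (\<forall>(x, y) \<in> G. \<forall>(x', y') \<in> G. 0 \<le> (y - y') \<bullet> (x - x'))"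

definition maximal_monotone :: "'a::real_inner set \<Rightarrow> ('a \<Rightarrow> 'a) \<Rightarrow> bool" where
  "maximal_monotone D A \<longleftrightarrow>
     monotone_graph (op_graph D A) \<and>
     (\<forall>G. monotone_graph G \<and> op_graph D A \<subseteq> G \<longrightarrow> G = op_graph D A)"

definition linear_operator :: "'a::real_vector set \<Rightarrow> ('a \<Rightarrow> 'a) \<Rightarrow> bool" where
  "linear_operator D A \<longleftrightarrow>
     subspace D \<and>
     (\<forall>x\<in>D. \<forall>y\<in>D. A (x + y) = A x + A y) \<and>
     (\<forall>c. \<forall>x\<in>D. A (c *\<^sub>R x) = c *\<^sub>R A x)"

(* The graph of the Hilbert space adjoint (a function graph when D is dense). *)
definition adjoint_graph :: "'a::real_inner set \<Rightarrow> ('a \<Rightarrow> 'a) \<Rightarrow> ('a \<times> 'a) set" where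
  "adjoint_graph D A = {(y, z). \<forall>x\<in>D. A x \<bullet> y = x \<bullet> z}"

definition selfadjoint_operator :: "'a::real_inner set \<Rightarrow> ('a \<Rightarrow> 'a) \<Rightarrow> bool" where
  "selfadjoint_operator D A \<longleftrightarrow> closure D = UNIV \<and> adjoint_graph D A = op_graph D A"

definition resolvent :: "'a::real_vector set \<Rightarrow> ('a \<Rightarrow> 'a) \<Rightarrow> real \<Rightarrow> 'a \<Rightarrow> 'a" where
  "resolvent D A \<mu> = inv_into D (\<lambda>y. y + \<mu> *\<^sub>R A y)"

definition yosida :: "'a::real_vector set \<Rightarrow> ('a \<Rightarrow> 'a) \<Rightarrow> real \<Rightarrow> 'a \<Rightarrow> 'a" where
  "yosida D A \<mu> x = (1 / \<mu>) *\<^sub>R (x - resolvent D A \<mu> x)"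

definition lower_semicontinuous :: "('a::topological_space \<Rightarrow> real) \<Rightarrow> bool" where
  "lower_semicontinuous f \<longleftrightarrow> (\<forall>x. \<forall>c < f x. \<forall>\<^sub>F y in nhds x. c < f y)"

section \<open>The Gelfand triple\<close>

definition dense_compact_embedding ::
    "('v::real_normed_vector \<Rightarrow>\<^sub>L 'h::real_normed_vector) \<Rightarrow> bool" where
  "dense_compact_embedding \<iota> \<longleftrightarrow>
     inj (blinfun_apply \<iota>) \<and>
     closure (range (blinfun_apply \<iota>)) = UNIV \<and>
     (\<forall>S. bounded S \<longrightarrow> compact (closure (blinfun_apply \<iota> ` S)))"

(* H as a subspace of the dual of V: the functional z \<mapsto> (x, z)_H. *)
definition to_dual ::
    "('v::real_normed_vector \<Rightarrow>\<^sub>L 'h::real_inner) \<Rightarrow> 'h \<Rightarrow> ('v \<Rightarrow>\<^sub>L real)" where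
  "to_dual \<iota> x = blinfun_inner_right x o\<^sub>L \<iota>"

(* As is a monotone symmetric operator from V to its dual that agrees with A on D \<inter> V. *)
definition dual_extension ::
    "('v::real_normed_vector \<Rightarrow>\<^sub>L 'h::real_inner) \<Rightarrow> 'h set \<Rightarrow> ('h \<Rightarrow> 'h)
       \<Rightarrow> ('v \<Rightarrow>\<^sub>L ('v \<Rightarrow>\<^sub>L real)) \<Rightarrow> bool" where
  "dual_extension \<iota> D A As \<longleftrightarrow>
     (\<forall>w z. 0 \<le> blinfun_apply (As w - As z) (w - z)) \<and>
     (\<forall>w z. blinfun_apply (As w) z = blinfun_apply (As z) w) \<and>
     (\<forall>w. \<iota> w \<in> D \<longrightarrow> As w = to_dual \<iota> (A (\<iota> w)))"

section \<open>Spaces of vector-valued functions on (0,T)\<close>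

definition L2_space :: "real \<Rightarrow> (real \<Rightarrow> 'b::{banach, second_countable_topology}) set" where
  "L2_space T = {u \<in> borel_measurable (lebesgue_on {0<..<T}).
                   integrable (lebesgue_on {0<..<T}) (\<lambda>t. (norm (u t))\<^sup>2)}"

definition Linf_space :: "real \<Rightarrow> (real \<Rightarrow> 'b::{banach, second_countable_topology}) set" where
  "Linf_space T = {u \<in> borel_measurable (lebesgue_on {0<..<T}).
                     \<exists>C. AE t in lebesgue_on {0<..<T}. norm (u t) \<le> C}"

(* For X the space L^p(0,T;H), this is L^p(0,T;D(A)), where D(A) carries the graph norm. *)
definition domain_valued :: "real \<Rightarrow> (real \<Rightarrow> 'h) set \<Rightarrow> 'h set \<Rightarrow> ('h \<Rightarrow> 'h) \<Rightarrow> (real \<Rightarrow> 'h) set" where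
  "domain_valued T X D A =
     {u \<in> X. (AE t in lebesgue_on {0<..<T}. u t \<in> D) \<and> (\<lambda>t. A (u t)) \<in> X}"

(* u is the continuous representative on [0,T] of an element of W^{1,1}(0,T) with derivative g.
   Elements of Sobolev spaces are always given by this representative (so that values at 0 make
   sense), while g is determined only almost everywhere. *)
definition has_time_derivative ::
    "real \<Rightarrow> (real \<Rightarrow> 'b::{banach, second_countable_topology}) \<Rightarrow> (real \<Rightarrow> 'b) \<Rightarrow> bool" where
  "has_time_derivative T u g \<longleftrightarrow>
     integrable (lebesgue_on {0<..<T}) g \<and>
     (\<forall>t\<in>{0..T}. u t = u 0 + integral\<^sup>L (lebesgue_on {0<..<t}) g)"

definition H1_space :: "real \<Rightarrow> (real \<Rightarrow> 'b::{banach, second_countable_topology}) set" where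
  "H1_space T = {u \<in> L2_space T. \<exists>g \<in> L2_space T. has_time_derivative T u g}"

definition W1inf_space :: "real \<Rightarrow> (real \<Rightarrow> 'b::{banach, second_countable_topology}) set" where
  "W1inf_space T = {u \<in> Linf_space T. \<exists>g \<in> Linf_space T. has_time_derivative T u g}"

definition W2inf_space :: "real \<Rightarrow> (real \<Rightarrow> 'b::{banach, second_countable_topology}) set" where
  "W2inf_space T = {u \<in> Linf_space T. \<exists>g \<in> W1inf_space T. has_time_derivative T u g}"

section \<open>Solutions\<close>

(* \<theta> and \<phi> are V-valued; \<theta>' is the derivative of \<theta> in V, and \<phi>', \<phi>'' are the first and second
   derivatives of \<phi> in H, \<phi>' being the continuous representative. *)
definition is_solution ::
    "real \<Rightarrow> real \<Rightarrow>
     ('v::{real_inner, banach, second_countable_topology}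
        \<Rightarrow>\<^sub>L 'h::{real_inner, banach, second_countable_topology}) \<Rightarrow>
     ('h \<Rightarrow>\<^sub>L 'h) \<Rightarrow>
     'h set \<Rightarrow> ('h \<Rightarrow> 'h) \<Rightarrow> 'h set \<Rightarrow> ('h \<Rightarrow> 'h) \<Rightarrow>
     'h set \<Rightarrow> ('h \<Rightarrow> 'h) \<Rightarrow> ('h \<Rightarrow> 'h) \<Rightarrow>
     ('h \<Rightarrow> 'h) \<Rightarrow> ('h \<Rightarrow> 'h) \<Rightarrow>
     'h \<Rightarrow> 'h \<Rightarrow> 'h \<Rightarrow>
     (real \<Rightarrow> 'v) \<Rightarrow> (real \<Rightarrow> 'v) \<Rightarrow> bool" where
  "is_solution T \<eta> \<iota> L DA1 A1 DA2 A2 DB1 B1 B2 \<Phi> \<L> \<theta>0 \<phi>0 v0 \<theta> \<phi> \<longleftrightarrow>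
     \<theta> \<in> H1_space T \<and> \<theta> \<in> Linf_space T \<and>
     (\<lambda>t. \<iota> (\<theta> t)) \<in> domain_valued T (Linf_space T) DA1 A1 \<and>
     (\<lambda>t. \<iota> (\<phi> t)) \<in> W2inf_space T \<and> \<phi> \<in> W1inf_space T \<and>
     (\<lambda>t. \<iota> (\<phi> t)) \<in> domain_valued T (L2_space T) DA2 A2 \<and>
     (\<lambda>t. \<Phi> (\<iota> (\<phi> t))) \<in> Linf_space T \<and>
     (\<exists>\<theta>' \<phi>' \<phi>''.
        has_time_derivative T \<theta> \<theta>' \<and>
        has_time_derivative T (\<lambda>t. \<iota> (\<phi> t)) \<phi>' \<and>
        has_time_derivative T \<phi>' \<phi>'' \<and>
        \<phi>' \<in> domain_valued T (L2_space T) DB1 B1 \<and>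
        (AE t in lebesgue_on {0<..<T}.
           \<iota> (\<theta>' t) + \<eta> *\<^sub>R \<phi>' t + A1 (\<iota> (\<theta> t)) = 0) \<and>
        (AE t in lebesgue_on {0<..<T}.
           L (\<phi>'' t) + B1 (\<phi>' t) + A2 (\<iota> (\<phi> t)) + \<Phi> (\<iota> (\<phi> t)) + \<L> (\<iota> (\<phi> t))
             = B2 (\<iota> (\<theta> t))) \<and>
        \<iota> (\<theta> 0) = \<theta>0 \<and> \<iota> (\<phi> 0) = \<phi>0 \<and> \<phi>' 0 = v0)"

end

theory Submission
  imports Defs
begin

text \<open>
  On \<open>X = V \<times> V \<times> H\<close> with state \<open>(\<theta>, \<phi>, \<phi>')\<close> the linear part of the system is, up to a multiple of
  the identity, a maximal monotone operator for the inner product built from \<open>A1\<close>, \<open>A2\<close> and \<open>L\<close>: the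
  coupling \<open>B2 \<theta>\<close> is absorbed by \<open>\<parallel>A1 \<theta>\<parallel>\<^sup>2\<close>, and the range condition is a Lax-Milgram problem in \<open>V\<close>.
  After \<open>\<Phi>\<close> is truncated to a ball of \<open>V\<close> the remaining terms are a Lipschitz perturbation, and the
  Euler scheme with implicit linear and explicit nonlinear part converges, uniformly in time and without
  any compactness, to a Lipschitz solution with values in the domain.  The potential \<open>i\<close> gives an energy
  bound that does not depend on the truncation radius, so the truncation is invisible for a large radius.
  The domain only controls the sum \<open>B1 \<phi>' + A2 \<phi>\<close>; (A10) splits it at each Euler step, testing the scheme
  with \<open>B1 \<phi>'\<close> bounds the discrete \<open>L\<^sup>2\<close> norm of \<open>B1 \<phi>'\<close>, and the Yosida approximations of \<open>B1\<close> carry the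
  bound to the limit.  Uniqueness is the same energy estimate for a difference of two solutions.
\<close>

section \<open>Projection, Riesz representation and Lax-Milgram\<close>

text \<open>(A12) says that the initial state belongs to the domain of the generator. Increments of
  the Euler scheme are therefore of order h, the generator stays bounded along the scheme, and
  limits are taken through Yosida approximations: these are bounded operators whose norms increase
  to that of the operator, so that a uniform bound yields strong convergence and membership in the
  domain where one would otherwise argue by weak compactness. (A10) enters through its linear core.
  Apart from those with B1* and A2*, all its terms have values in H, and since the datum g is an
  arbitrary element of H they can be moved to the right hand side. Truncation is forced by (A6),
  which makes \<Phi> Lipschitz from V to H only on balls of V. The a priori bound that removes the
  truncation reads (A7) at the later of two times: \<Phi> is a subgradient of i, and the term it
  produces cancels against the work of \<Phi> in the equation, so no Lipschitz constant of \<Phi>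
  survives.\<close>

lemma parallelogram_identity:
  fixes x y :: "'a::real_inner"
  shows "(norm (x - y))\<^sup>2 = 2 * (norm x)\<^sup>2 + 2 * (norm y)\<^sup>2 - 4 * (norm ((1/2) *\<^sub>R (x + y)))\<^sup>2"
  by (simp add: power2_norm_eq_inner inner_diff inner_add inner_commute algebra_simps)

text \<open>Midpoints of \<open>C\<close> stay in \<open>C\<close>, so their norms are at least the
  infimum \<open>d\<close>; the parallelogram identity then makes a minimising sequence
  Cauchy.\<close>

lemma min_norm_point:
  fixes C :: "'a::{real_inner, banach} set"
  assumes "closed C" "convex C" "C \<noteq> {}"
  obtains x where "x \<in> C" "\<And>y. y \<in> C \<Longrightarrow> norm x \<le> norm y"
proof -
  define d where "d = Inf (norm ` C)"
  have bdd: "bdd_below (norm ` C)" by (meson bdd_belowI2 norm_ge_zero)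
  have dle: "d \<le> norm y" if "y \<in> C" for y
    unfolding d_def using that bdd by (simp add: cInf_lower)
  have d0: "0 \<le> d" unfolding d_def using assms(3) by (intro cInf_greatest) auto
  have "\<exists>x\<in>C. norm x < d + 1 / real (Suc n)" for n
  proof -
    have "Inf (norm ` C) < d + 1 / real (Suc n)" unfolding d_def by simp
    then show ?thesis using assms(3) bdd by (simp add: cInf_less_iff)
  qed
  then obtain x where x: "\<And>n. x n \<in> C" "\<And>n. norm (x n) < d + 1 / real (Suc n)" by metis
  have key: "(norm (x m - x n))\<^sup>2 \<le> (8 * d + 4) / real (Suc N)" if "N \<le> m" "N \<le> n" for m n N
  proof -
    define e where "e = 1 / real (Suc N)"
    have e: "0 \<le> e" "e \<le> 1" unfolding e_def by (auto simp: divide_simps)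
    have *: "(norm (x k))\<^sup>2 \<le> (d + e)\<^sup>2" if "N \<le> k" for k
    proof -
      have "1 / real (Suc k) \<le> e" unfolding e_def using that by (simp add: frac_le)
      then show ?thesis using x(2)[of k] by (intro power_mono) auto
    qed
    have "(1/2) *\<^sub>R (x m + x n) \<in> C"
      using convexD[OF assms(2) x(1)[of m] x(1)[of n], of "1/2" "1/2"] by (simp add: scaleR_add_right)
    then have "d\<^sup>2 \<le> (norm ((1/2) *\<^sub>R (x m + x n)))\<^sup>2" using dle d0 by (intro power_mono) blast+
    then have "(norm (x m - x n))\<^sup>2 \<le> 4 * (d + e)\<^sup>2 - 4 * d\<^sup>2"
      using parallelogram_identity[of "x m" "x n"] *[OF that(1)] *[OF that(2)] by linarith
    also have "\<dots> = 8 * d * e + 4 * e * e" by (simp add: power2_eq_square algebra_simps)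
    also have "\<dots> \<le> 8 * d * e + 4 * e * 1" using e by (intro add_left_mono mult_left_mono) auto
    also have "\<dots> = (8 * d + 4) * e" by (simp add: algebra_simps)
    finally show ?thesis unfolding e_def by simp
  qed
  have "Cauchy x"
  proof (rule metric_CauchyI)
    fix e :: real assume e: "0 < e"
    obtain N where N: "(8 * d + 4) / e\<^sup>2 < real (Suc N)" by (metis lessI reals_Archimedean2 less_trans of_nat_less_iff)
    have "dist (x m) (x n) < e" if "N \<le> m" "N \<le> n" for m n
    proof -
      have "(8 * d + 4) / real (Suc N) < e\<^sup>2" using N e by (simp add: divide_simps mult.commute)
      then have "(norm (x m - x n))\<^sup>2 < e\<^sup>2" using key[OF that] by linarith
      then show ?thesis using e by (simp add: dist_norm power2_less_imp_less)
    qed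
    then show "\<exists>M. \<forall>m\<ge>M. \<forall>n\<ge>M. dist (x m) (x n) < e" by blast
  qed
  then obtain l where l: "x \<longlonglongrightarrow> l" using Cauchy_convergent_iff convergent_def by blast
  have "l \<in> C" using assms(1) x(1) l closed_sequential_limits by blast
  moreover have "norm l \<le> d"
  proof (rule LIMSEQ_le[OF tendsto_norm[OF l]])
    show "(\<lambda>n. d + 1 / real (Suc n)) \<longlonglongrightarrow> d"
      using tendsto_add[OF tendsto_const LIMSEQ_inverse_real_of_nat, of d] by (simp add: inverse_eq_divide)
    show "\<exists>N. \<forall>n\<ge>N. norm (x n) \<le> d + 1 / real (Suc n)" using x(2) less_imp_le by blast
  qed
  ultimately show thesis using that dle by force
qed

lemma orthogonal_if_min_norm:
  fixes u z :: "'a::real_inner"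
  assumes "\<And>t. norm u \<le> norm (u + t *\<^sub>R z)"
  shows "u \<bullet> z = 0"
proof (cases "z = 0")
  case False
  \<comment> \<open>The minimiser of the quadratic polynomial t \<mapsto> |u + t z|^2.\<close>
  define t where "t = - (u \<bullet> z) / (z \<bullet> z)"
  have zz: "z \<bullet> z > 0" using False by simp
  have "(norm u)\<^sup>2 \<le> (norm (u + t *\<^sub>R z))\<^sup>2" using assms by (intro power_mono) auto
  also have "\<dots> = (norm u)\<^sup>2 + 2 * t * (u \<bullet> z) + t * t * (z \<bullet> z)"
    by (simp add: power2_norm_eq_inner inner_add inner_commute algebra_simps)
  also have "\<dots> = (norm u)\<^sup>2 - (u \<bullet> z)\<^sup>2 / (z \<bullet> z)"
    using zz by (simp add: t_def field_simps power2_eq_square)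
  finally have "(u \<bullet> z)\<^sup>2 / (z \<bullet> z) \<le> 0" by simp
  then have "(u \<bullet> z)\<^sup>2 \<le> 0" using zz by (simp add: divide_le_0_iff)
  then show ?thesis by simp
qed simp

lemma orthogonal_projection:
  fixes S :: "'a::{real_inner, banach} set"
  assumes "subspace S" "closed S"
  obtains p where "p \<in> S" "\<And>z. z \<in> S \<Longrightarrow> (x - p) \<bullet> z = 0"
proof -
  let ?C = "(\<lambda>s. x - s) ` S"
  \<comment> \<open>As a translate of \<open>S\<close>, the set inherits closedness and convexity
    from \<open>S\<close>.\<close>
  have eq: "?C = (\<lambda>s. x + s) ` S"
  proof (intro set_eqI iffI)
    show "u \<in> (\<lambda>s. x + s) ` S" if "u \<in> ?C" for u
    proof -
      from that obtain s where "s \<in> S" "u = x + (- s)" by auto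
      then show ?thesis using subspace_neg[OF assms(1)] by blast
    qed
    show "u \<in> ?C" if "u \<in> (\<lambda>s. x + s) ` S" for u
    proof -
      from that obtain s where "s \<in> S" "u = x - (- s)" by auto
      then show ?thesis using subspace_neg[OF assms(1)] by blast
    qed
  qed
  have "closed ?C" using closed_translation[OF assms(2), of x] eq by simp
  moreover have "convex ?C" using eq subspace_imp_convex[OF assms(1)] convex_translation by metis
  moreover have "?C \<noteq> {}" using subspace_0[OF assms(1)] by blast
  ultimately obtain u where u: "u \<in> ?C" "\<And>y. y \<in> ?C \<Longrightarrow> norm u \<le> norm y" using min_norm_point by metis
  then obtain p where p: "p \<in> S" "u = x - p" by blast
  have "u \<bullet> z = 0" if "z \<in> S" for z
  proof (rule orthogonal_if_min_norm)
    fix t :: real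
    have "p - t *\<^sub>R z \<in> S" using p that assms(1) by (simp add: subspace_diff subspace_mul)
    then have "x - (p - t *\<^sub>R z) \<in> ?C" by blast
    then show "norm u \<le> norm (u + t *\<^sub>R z)" using u(2)[of "x - (p - t *\<^sub>R z)"] p(2)
      by (simp add: diff_diff_eq2 add.commute diff_add_eq)
  qed
  then show thesis using that p by blast
qed

lemma riesz_representation:
  fixes f :: "'a::{real_inner, banach} \<Rightarrow> real"
  assumes "bounded_linear f"
  obtains x where "\<And>z. f z = x \<bullet> z"
proof (cases "\<forall>z. f z = 0")
  case True
  then show thesis using that[of 0] by simp
next
  case False
  then obtain x0 where x0: "f x0 \<noteq> 0" by blast
  interpret f: bounded_linear f by fact
  let ?S = "{z. f z = 0}"
  have "subspace ?S" by (auto simp: subspace_def f.add f.scaleR f.zero)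
  moreover have "closed ?S" by (intro closed_Collect_eq continuous_intros f.continuous_on continuous_on_id)
  ultimately obtain p where p: "p \<in> ?S" "\<And>z. z \<in> ?S \<Longrightarrow> (x0 - p) \<bullet> z = 0"
    using orthogonal_projection by metis
  define u where "u = x0 - p"
  have fu: "f u \<noteq> 0" unfolding u_def using p(1) x0 by (simp add: f.diff)
  have u0: "u \<noteq> 0" using fu f.zero by auto
  have "f z = ((f u / (u \<bullet> u)) *\<^sub>R u) \<bullet> z" for z
  proof -
    have "f (z - (f z / f u) *\<^sub>R u) = 0" using fu by (simp add: f.diff f.scaleR)
    then have "u \<bullet> (z - (f z / f u) *\<^sub>R u) = 0" using p(2) u_def by blast
    then have "u \<bullet> z = (f z / f u) * (u \<bullet> u)" by (simp add: inner_diff)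
    then show ?thesis using fu u0 by simp
  qed
  then show thesis using that by blast
qed

text \<open>Coercivity makes the representing operator \<open>M\<close> bounded below, so its range
  is closed, and a vector orthogonal to the range vanishes when tested with itself. The form may be
  non-symmetric: that of the implicit step contains \<open>B2\<close> after a resolvent of
  \<open>A1\<close>.\<close>

lemma lax_milgram:
  fixes a :: "'a::{real_inner, banach} \<Rightarrow> 'a \<Rightarrow> real"
  assumes "bounded_bilinear a" "c > 0" and coercive: "\<And>x. c * (norm x)\<^sup>2 \<le> a x x"
    and "bounded_linear f"
  obtains u where "\<And>z. a u z = f z"
proof -
  interpret a: bounded_bilinear a by fact
  have "\<exists>m. \<forall>z. a u z = m \<bullet> z" for u
    using riesz_representation[OF a.bounded_linear_right] by metis
  then obtain M where M: "\<And>u z. a u z = M u \<bullet> z" by metis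
  obtain K where K: "\<And>x y. norm (a x y) \<le> norm x * norm y * K" "K \<ge> 0" using a.nonneg_bounded by blast
  have ext: "x = y" if "\<And>z. x \<bullet> z = y \<bullet> z" for x y :: 'a
    using that[of "x - y"] by (metis eq_iff_diff_eq_0 inner_diff_left inner_eq_zero_iff)
  have lin: "linear M"
    by (rule linearI; rule ext) (simp_all add: M[symmetric] inner_add_left a.add_left a.scaleR_left)
  have "norm (M x) \<le> norm x * K" for x
  proof -
    have "(norm (M x))\<^sup>2 = a x (M x)" by (simp add: M power2_norm_eq_inner)
    also have "\<dots> \<le> norm x * norm (M x) * K" using K(1)[of x "M x"] by simp
    finally show ?thesis by (cases "M x = 0") (use K in \<open>auto simp: power2_eq_square mult.commute mult.assoc\<close>)
  qed
  with lin have bl: "bounded_linear M" by (intro bounded_linear.intro) (auto simp: bounded_linear_axioms_def)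
  have lb: "c * norm x \<le> norm (M x)" for x
  proof (cases "x = 0")
    case False
    have "c * (norm x)\<^sup>2 \<le> M x \<bullet> x" using coercive M by metis
    also have "\<dots> \<le> norm (M x) * norm x" by (rule norm_cauchy_schwarz)
    finally show ?thesis using False by (simp add: power2_eq_square)
  qed simp
  have "complete (M ` UNIV)"
    by (rule complete_isometric_image[OF assms(2) subspace_UNIV bl])
      (use lb complete_UNIV in \<open>auto simp: mult.commute\<close>)
  then have "closed (range M)" by (rule complete_imp_closed)
  moreover have "subspace (range M)" using lin by (simp add: linear_subspace_image)
  moreover obtain F where F: "\<And>z. f z = F \<bullet> z" using riesz_representation assms(4) by blast
  ultimately obtain p where p: "p \<in> range M" "\<And>z. z \<in> range M \<Longrightarrow> (F - p) \<bullet> z = 0"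
    using orthogonal_projection by metis
  have "a (F - p) (F - p) = 0" unfolding M using p(2)[of "M (F - p)"] by (simp add: inner_commute)
  then have "c * (norm (F - p))\<^sup>2 \<le> 0" using coercive[of "F - p"] by simp
  then have "F = p" using assms(2) by (simp add: mult_le_0_iff)
  then obtain u where u: "F = M u" using p(1) by blast
  show thesis by (rule that[of u]) (simp add: M F u)
qed

text \<open>Containment of the adjoint in the operator, read as a membership test for
  \<open>D\<close>.\<close>

lemma selfadjoint_adjointD:
  assumes "selfadjoint_operator D A" "\<And>w. w \<in> D \<Longrightarrow> A w \<bullet> x = w \<bullet> z"
  shows "x \<in> D" "A x = z"
proof -
  have "(x, z) \<in> adjoint_graph D A" using assms(2) by (simp add: adjoint_graph_def)
  then show "x \<in> D" "A x = z" using assms(1) by (auto simp: selfadjoint_operator_def op_graph_def)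
qed

text \<open>The range is a closed subspace, and a vector u orthogonal to it belongs to
  \<open>D\<close> with A u = - u / lam, which monotonicity allows only for u = 0. This is Minty's
  range condition.\<close>

lemma selfadjoint_range:
  fixes A :: "'a::{real_inner, banach} \<Rightarrow> 'a"
  assumes lin: "linear_operator D A" and sa: "selfadjoint_operator D A"
    and mono: "\<And>x. x \<in> D \<Longrightarrow> 0 \<le> A x \<bullet> x" and lam: "lam > 0"
  obtains x where "x \<in> D" "x + lam *\<^sub>R A x = y"
proof -
  let ?S = "(\<lambda>x. x + lam *\<^sub>R A x) ` D"
  have D: "subspace D" and Aadd: "\<And>x y. \<lbrakk>x \<in> D; y \<in> D\<rbrakk> \<Longrightarrow> A (x + y) = A x + A y"
    and Asc: "\<And>c x. x \<in> D \<Longrightarrow> A (c *\<^sub>R x) = c *\<^sub>R A x"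
    using lin by (auto simp: linear_operator_def)
  have A0: "A 0 = 0" using Asc[OF subspace_0[OF D], of 0] by simp
  have sym: "A w \<bullet> x = w \<bullet> A x" if "w \<in> D" "x \<in> D" for w x
  proof -
    have "(x, A x) \<in> adjoint_graph D A" using sa that by (auto simp: selfadjoint_operator_def op_graph_def)
    then show ?thesis using that by (auto simp: adjoint_graph_def)
  qed
  have sub: "subspace ?S"
  proof (rule subspaceI)
    show "0 \<in> ?S" using A0 subspace_0[OF D] by (force simp: image_iff)
    show "u + v \<in> ?S" if "u \<in> ?S" "v \<in> ?S" for u v
    proof -
      from that obtain x z where xz: "x \<in> D" "u = x + lam *\<^sub>R A x" "z \<in> D" "v = z + lam *\<^sub>R A z" by blast
      then have "u + v = (x + z) + lam *\<^sub>R A (x + z)" by (simp add: Aadd algebra_simps)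
      then show ?thesis using xz subspace_add[OF D] by blast
    qed
    show "c *\<^sub>R u \<in> ?S" if "u \<in> ?S" for u c
    proof -
      from that obtain x where xz: "x \<in> D" "u = x + lam *\<^sub>R A x" by blast
      then have "c *\<^sub>R u = (c *\<^sub>R x) + lam *\<^sub>R A (c *\<^sub>R x)" by (simp add: Asc algebra_simps)
      then show ?thesis using xz subspace_mul[OF D] by blast
    qed
  qed
  have lb: "norm x \<le> norm (x + lam *\<^sub>R A x)" if "x \<in> D" for x
  proof (cases "x = 0")
    case False
    have "(norm x)\<^sup>2 \<le> (x + lam *\<^sub>R A x) \<bullet> x"
      using mono[OF that] lam by (simp add: power2_norm_eq_inner inner_add)
    also have "\<dots> \<le> norm (x + lam *\<^sub>R A x) * norm x" by (rule norm_cauchy_schwarz)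
    finally show ?thesis using False by (simp add: power2_eq_square)
  qed simp
  have clo: "closed ?S"
    unfolding closed_sequential_limits
  proof (intro allI impI)
    fix f l assume "(\<forall>n. f n \<in> ?S) \<and> f \<longlonglongrightarrow> l"
    then have f: "\<And>n. f n \<in> ?S" and l: "f \<longlonglongrightarrow> l" by auto
    have "\<forall>n. \<exists>x. x \<in> D \<and> f n = x + lam *\<^sub>R A x" using f by blast
    then obtain x where x: "\<And>n. x n \<in> D" "\<And>n. f n = x n + lam *\<^sub>R A (x n)" by metis
    have le: "norm (x m - x n) \<le> norm (f m - f n)" for m n
    proof -
      have "x m - x n \<in> D" using x(1) D by (simp add: subspace_diff)
      moreover have "A (x m - x n) = A (x m) - A (x n)"
        using Aadd[of "x m" "(-1) *\<^sub>R x n"] Asc[of "x n" "-1"] x(1) D by (simp add: subspace_neg)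
      then have "f m - f n = (x m - x n) + lam *\<^sub>R A (x m - x n)"
        by (simp add: x(2) scaleR_diff_right)
      ultimately show ?thesis using lb[of "x m - x n"] by simp
    qed
    have "Cauchy f" using l by (rule LIMSEQ_imp_Cauchy)
    then have "Cauchy x" unfolding Cauchy_iff using le by (meson le_less_trans)
    then obtain u where u: "x \<longlonglongrightarrow> u" using Cauchy_convergent_iff convergent_def by blast
    have Ax: "(\<lambda>n. A (x n)) \<longlonglongrightarrow> (1/lam) *\<^sub>R (l - u)"
    proof -
      have "A (x n) = (1/lam) *\<^sub>R (f n - x n)" for n using lam by (simp add: x(2))
      then show ?thesis by (simp add: tendsto_intros l u)
    qed
    have "A w \<bullet> u = w \<bullet> ((1/lam) *\<^sub>R (l - u))" if "w \<in> D" for w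
    proof -
      have "(\<lambda>n. A w \<bullet> x n) \<longlonglongrightarrow> A w \<bullet> u" by (intro tendsto_intros u)
      moreover have "(\<lambda>n. w \<bullet> A (x n)) \<longlonglongrightarrow> w \<bullet> ((1/lam) *\<^sub>R (l - u))" by (intro tendsto_intros Ax)
      ultimately show ?thesis using sym[OF that x(1)] LIMSEQ_unique by simp
    qed
    then have "u \<in> D" "A u = (1/lam) *\<^sub>R (l - u)" using selfadjoint_adjointD[OF sa] by blast+
    then have "l = u + lam *\<^sub>R A u" using lam by simp
    then show "l \<in> ?S" using \<open>u \<in> D\<close> by blast
  qed
  obtain p where p: "p \<in> ?S" "\<And>z. z \<in> ?S \<Longrightarrow> (y - p) \<bullet> z = 0"
    using orthogonal_projection[OF sub clo] by metis
  define u where "u = y - p"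
  have "A w \<bullet> u = w \<bullet> ((- 1/lam) *\<^sub>R u)" if "w \<in> D" for w
  proof -
    have "u \<bullet> (w + lam *\<^sub>R A w) = 0" using p(2) that u_def by blast
    then have "lam * (A w \<bullet> u) = - (w \<bullet> u)" by (simp add: inner_add inner_commute)
    then show ?thesis using lam by (simp add: field_simps)
  qed
  then have u: "u \<in> D" "A u = (- 1/lam) *\<^sub>R u" using selfadjoint_adjointD[OF sa] by blast+
  then have "0 \<le> (- 1/lam) * (u \<bullet> u)" using mono[OF u(1)] by simp
  then have "u \<bullet> u \<le> 0" using lam by (simp add: divide_le_0_iff zero_le_divide_iff)
  then have "u = 0" using inner_gt_zero_iff[of u] by (meson linorder_not_less)
  then show thesis using p(1) that u_def by auto
qed

section \<open>Linear accretive operators\<close>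

text \<open>\<open>Q\<close> is an equivalent inner product instead of the one of the type, because
  the energy product in which the generator of the coupled system is monotone differs from the inner
  product of the product type.\<close>

locale accretive_operator =
  fixes Q :: "'a::{real_inner, banach} \<Rightarrow> 'a \<Rightarrow> real" and c :: real
    and D :: "'a set" and A :: "'a \<Rightarrow> 'a"
  assumes Q: "bounded_bilinear Q" and Q_sym: "Q x y = Q y x"
    and c: "c > 0" and Q_coercive: "c * (norm x)\<^sup>2 \<le> Q x x"
    and lin: "linear_operator D A"
    and mono: "x \<in> D \<Longrightarrow> 0 \<le> Q (A x) x"
    and range: "lam > 0 \<Longrightarrow> \<exists>x\<in>D. x + lam *\<^sub>R A x = y"
begin

sublocale Q: bounded_bilinear Q by (rule Q)

definition N :: "'a \<Rightarrow> real" where "N x = sqrt (Q x x)"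

lemma D_subspace: "subspace D" and A_add: "\<lbrakk>x \<in> D; y \<in> D\<rbrakk> \<Longrightarrow> A (x + y) = A x + A y"
  and A_scale: "x \<in> D \<Longrightarrow> A (r *\<^sub>R x) = r *\<^sub>R A x"
  using lin by (auto simp: linear_operator_def)

lemma A_diff: "\<lbrakk>x \<in> D; y \<in> D\<rbrakk> \<Longrightarrow> A (x - y) = A x - A y"
  using A_add[of x "(-1) *\<^sub>R y"] A_scale[of y "-1"] D_subspace by (simp add: subspace_neg)

lemma D_diff: "\<lbrakk>x \<in> D; y \<in> D\<rbrakk> \<Longrightarrow> x - y \<in> D"
  using D_subspace by (simp add: subspace_diff)

lemma Q_pos: "0 \<le> Q x x"
  using Q_coercive[of x] c by (meson mult_nonneg_nonneg less_imp_le order_trans zero_le_power2)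

lemma Q_zero_imp: "Q x x \<le> 0 \<Longrightarrow> x = 0"
  using Q_coercive[of x] c by (smt (verit) mult_pos_pos zero_less_norm_iff zero_less_power)

lemma N_nonneg [simp]: "0 \<le> N x" by (simp add: N_def Q_pos)

lemma N_sq: "(N x)\<^sup>2 = Q x x" by (simp add: N_def Q_pos)

lemma Q_square_add: "Q (x + y) (x + y) = Q x x + 2 * Q x y + Q y y"
  by (simp add: Q.add_left Q.add_right Q_sym[of y x])

lemma N_scale: "N (r *\<^sub>R x) = \<bar>r\<bar> * N x"
  by (simp add: N_def Q.scaleR_left Q.scaleR_right real_sqrt_mult flip: power2_eq_square mult.assoc)

lemma N_minus: "N (x - y) = N (y - x)"
  using N_scale[of "-1" "y - x"] by simp

lemma N_zero [simp]: "N 0 = 0" by (simp add: N_def Q.zero_left)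

lemma cauchy_schwarz: "Q x y \<le> N x * N y"
proof (cases "N x = 0 \<or> N y = 0")
  case True
  then have "x = 0 \<or> y = 0" using Q_zero_imp N_sq by (metis order_refl power_zero_numeral)
  then show ?thesis by (auto simp: Q.zero_left Q.zero_right)
next
  case False
  then have p: "N x > 0" "N y > 0" using N_nonneg by (metis less_eq_real_def)+
  have "0 \<le> Q ((- 1 / N x) *\<^sub>R x + (1 / N y) *\<^sub>R y) ((- 1 / N x) *\<^sub>R x + (1 / N y) *\<^sub>R y)" by (rule Q_pos)
  also have "\<dots> = 2 - 2 * (Q x y / (N x * N y))"
    unfolding Q_square_add Q.scaleR_left Q.scaleR_right using p
    by (simp add: N_sq[symmetric] power2_eq_square)
  finally have "Q x y / (N x * N y) \<le> 1" by simp
  then show ?thesis using p by (simp add: pos_divide_le_eq)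
qed

lemma cauchy_schwarz_abs: "\<bar>Q x y\<bar> \<le> N x * N y"
  using cauchy_schwarz[of x y] cauchy_schwarz[of "-x" y] N_scale[of "-1" x] by (simp add: Q.minus_left)

lemma N_triangle: "N (x + y) \<le> N x + N y"
proof (rule power2_le_imp_le)
  show "(N (x + y))\<^sup>2 \<le> (N x + N y)\<^sup>2"
    using cauchy_schwarz[of x y] by (simp add: N_sq Q_square_add power2_sum)
qed simp

lemma N_triangle_diff: "N (x - z) \<le> N (x - y) + N (y - z)"
  using N_triangle[of "x - y" "y - z"] by simp

lemma N_triangle_sub: "N x \<le> N y + N (x - y)"
  using N_triangle[of y "x - y"] by simp

lemma norm_le_N: "norm x \<le> N x / sqrt c"
proof -
  have "sqrt c * norm x \<le> N x"
    unfolding N_def using real_sqrt_le_mono[OF Q_coercive[of x]] by (simp add: real_sqrt_mult)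
  then show ?thesis using c by (simp add: field_simps)
qed

lemma N_le_norm: obtains K where "K > 0" "\<And>x. N x \<le> K * norm x"
proof -
  obtain B where B: "B > 0" "\<And>x y. norm (Q x y) \<le> norm x * norm y * B" using Q.pos_bounded by blast
  have "N x \<le> sqrt B * norm x" for x
  proof (rule power2_le_imp_le)
    show "(N x)\<^sup>2 \<le> (sqrt B * norm x)\<^sup>2"
      using B(2)[of x x] B(1) by (simp add: N_sq power_mult_distrib) (simp add: power2_eq_square mult.commute)
  qed (use B in simp)
  then show thesis using that[of "sqrt B"] B by simp
qed

lemma tendsto_N: "(f \<longlongrightarrow> l) F \<Longrightarrow> ((\<lambda>x. N (f x)) \<longlongrightarrow> N l) F"
  unfolding N_def by (intro tendsto_intros Q.tendsto)

lemma resolvent_unique: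
  assumes "x \<in> D" "y \<in> D" "lam > 0" "x + lam *\<^sub>R A x = y + lam *\<^sub>R A y"
  shows "x = y"
proof -
  have "(x - y) + lam *\<^sub>R A (x - y) = 0" using assms by (simp add: A_diff algebra_simps)
  then have "Q (x - y) (x - y) + lam * Q (A (x - y)) (x - y) = 0"
    by (metis Q.add_left Q.scaleR_left Q.zero_left real_scaleR_def)
  moreover have "0 \<le> lam * Q (A (x - y)) (x - y)" using mono[OF D_diff] assms by simp
  ultimately have "x - y = 0" by (intro Q_zero_imp) linarith
  then show ?thesis by simp
qed

text \<open>The resolvent (I + lam A)^-1: for \<open>lam > 0\<close> a suitable point exists by
  \<open>range\<close> and is unique by \<open>resolvent_unique\<close>.\<close>

definition J :: "real \<Rightarrow> 'a \<Rightarrow> 'a" where "J lam y = (SOME x. x \<in> D \<and> x + lam *\<^sub>R A x = y)"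

text \<open>The Yosida approximation; \<open>Y_eq\<close> gives its usual form as a difference
  quotient.\<close>

definition Y :: "real \<Rightarrow> 'a \<Rightarrow> 'a" where "Y lam y = A (J lam y)"

context
  fixes lam :: real
  assumes lam: "lam > 0"
begin

lemma J_props: "J lam y \<in> D \<and> J lam y + lam *\<^sub>R A (J lam y) = y"
  unfolding J_def using someI_ex[of "\<lambda>x. x \<in> D \<and> x + lam *\<^sub>R A x = y"] range[OF lam, of y] by blast

lemmas J_in = J_props[THEN conjunct1] and J_eq = J_props[THEN conjunct2]

lemma J_eqI: "x \<in> D \<Longrightarrow> x + lam *\<^sub>R A x = y \<Longrightarrow> J lam y = x"
  using resolvent_unique[OF J_in, of x lam] J_eq[of y] lam by simp

lemma J_linear: "linear (J lam)"
proof (rule linearI)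
  fix x y r
  show "J lam (x + y) = J lam x + J lam y"
    using J_in[of x] J_in[of y] J_eq[of x] J_eq[of y] D_subspace
    by (intro J_eqI) (auto simp: A_add subspace_add algebra_simps)
  show "J lam (r *\<^sub>R x) = r *\<^sub>R J lam x"
    using J_in[of x] arg_cong[OF J_eq[of x], of "scaleR r"] D_subspace
    by (intro J_eqI) (auto simp: A_scale subspace_mul algebra_simps)
qed

lemma Y_eq: "Y lam y = (1 / lam) *\<^sub>R (y - J lam y)"
proof -
  have "y - J lam y = lam *\<^sub>R A (J lam y)" using J_eq[of y] by (metis add_diff_cancel_left')
  then show ?thesis using lam by (simp add: Y_def)
qed

lemma J_contraction: "N (J lam y) \<le> N y"
proof (cases "N (J lam y) = 0")
  case False
  have "(N (J lam y))\<^sup>2 \<le> Q (J lam y + lam *\<^sub>R A (J lam y)) (J lam y)"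
    using mono[OF J_in] lam by (simp add: N_sq Q.add_left Q.scaleR_left)
  also have "\<dots> \<le> N y * N (J lam y)" unfolding J_eq by (rule cauchy_schwarz)
  finally show ?thesis using False N_nonneg[of "J lam y"] by (simp add: power2_eq_square less_le)
qed simp

lemma J_bounded_linear: "bounded_linear (J lam)"
proof -
  obtain K where K: "K > 0" "\<And>x. N x \<le> K * norm x" using N_le_norm by blast
  have "norm (J lam x) \<le> norm x * (K / sqrt c)" for x
  proof -
    have "norm (J lam x) \<le> N (J lam x) / sqrt c" by (rule norm_le_N)
    also have "\<dots> \<le> (K * norm x) / sqrt c"
      using J_contraction[of x] K(2)[of x] c by (intro divide_right_mono) auto
    finally show ?thesis by (simp add: mult.commute)
  qed
  then show ?thesis using J_linear by (intro bounded_linear.intro bounded_linear_axioms.intro) blast+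
qed

lemma Y_bounded_linear: "bounded_linear (Y lam)"
  unfolding Y_eq[abs_def] using J_bounded_linear
  by (intro bounded_linear_const_scaleR bounded_linear_sub bounded_linear_ident)

lemma J_commute: "x \<in> D \<Longrightarrow> J lam (A x) = Y lam x"
proof -
  assume x: "x \<in> D"
  have "Y lam x = (1 / lam) *\<^sub>R (x - J lam x)" by (rule Y_eq)
  moreover have "x - J lam x = J lam (lam *\<^sub>R A x)"
    using J_eqI[OF x refl] linear_diff[OF J_linear, of "x + lam *\<^sub>R A x" x] by simp
  ultimately show ?thesis using lam by (simp add: linear_scale[OF J_linear])
qed

lemma N_Y_le: "x \<in> D \<Longrightarrow> N (Y lam x) \<le> N (A x)"
  using J_contraction[of "A x"] J_commute by simp

lemma J_inj: assumes "J lam x = J lam y" shows "x = y"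
  using J_eq[of x] J_eq[of y] assms by metis

end

text \<open>On \<open>D\<close> one has x = J 1 (x + A x), and the resolvent is continuous, so this
  identity passes to the limit.\<close>

lemma A_closed:
  assumes "\<And>n. x n \<in> D" "x \<longlonglongrightarrow> l" "(\<lambda>n. A (x n)) \<longlonglongrightarrow> y"
  shows "l \<in> D" "A l = y"
proof -
  interpret J1: bounded_linear "J 1" by (rule J_bounded_linear) simp
  have "(\<lambda>n. J 1 (x n + A (x n))) \<longlonglongrightarrow> J 1 (l + y)" by (intro J1.tendsto tendsto_intros assms)
  moreover have "J 1 (x n + A (x n)) = x n" for n using assms(1) by (intro J_eqI) auto
  ultimately have "J 1 (l + y) = l" using assms(2) LIMSEQ_unique by simp
  then have "l \<in> D" "l + 1 *\<^sub>R A l = l + y" using J_in[of 1 "l + y"] J_eq[of 1 "l + y"] by auto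
  then show "l \<in> D" "A l = y" by auto
qed

text \<open>Monotonicity of \<open>A\<close> between the two resolvents of \<open>x\<close> yields
  \<open>0 \<le> Q (a - b) b\<close>, which expands to the claim. The norms thus grow as the
  parameter decreases, and their gain controls the distance.\<close>

lemma Y_monotone_in_lam:
  assumes "0 < lam" "lam < mu"
  shows "(N (Y lam x - Y mu x))\<^sup>2 \<le> (N (Y lam x))\<^sup>2 - (N (Y mu x))\<^sup>2"
proof -
  define a b where "a = Y lam x" and "b = Y mu x"
  have mu: "mu > 0" using assms by simp
  have "J lam x - J mu x = mu *\<^sub>R b - lam *\<^sub>R a"
  proof -
    have "J lam x = x - lam *\<^sub>R a" "J mu x = x - mu *\<^sub>R b"
      using J_eq[OF assms(1), of x] J_eq[OF mu, of x] by (simp_all add: a_def b_def Y_def eq_diff_eq)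
    then show ?thesis by simp
  qed
  moreover have "0 \<le> Q (a - b) (J lam x - J mu x)"
    unfolding a_def b_def Y_def using mono[OF D_diff[OF J_in[OF assms(1)] J_in[OF mu]]]
    by (simp add: A_diff J_in assms mu)
  ultimately have "0 \<le> Q (a - b) (mu *\<^sub>R b - lam *\<^sub>R a)" by simp
  also have "mu *\<^sub>R b - lam *\<^sub>R a = (mu - lam) *\<^sub>R b - lam *\<^sub>R (a - b)" by (simp add: algebra_simps)
  finally have "0 \<le> (mu - lam) * Q (a - b) b - lam * Q (a - b) (a - b)"
    by (simp add: Q.diff_right Q.scaleR_right)
  then have "0 \<le> (mu - lam) * Q (a - b) b" using Q_pos[of "a - b"] assms
    by (smt (verit) mult_nonneg_nonneg)
  then have "0 \<le> Q (a - b) b" using assms by (simp add: zero_le_mult_iff)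
  then show ?thesis unfolding a_def[symmetric] b_def[symmetric] N_sq
    by (simp add: Q.diff_left Q.diff_right Q_sym[of b a])
qed

text \<open>The squared norms increase and are bounded, hence converge;
  \<open>Y_monotone_in_lam\<close> turns this into strong convergence, and \<open>A_closed\<close>
  identifies the limit. As a criterion for membership in \<open>D\<close> it does the work of weak
  closedness of \<open>A\<close>.\<close>

lemma yosida_limit:
  assumes "\<And>n. N (Y (1 / real (Suc n)) x) \<le> M"
  shows "x \<in> D" "(\<lambda>n. Y (1 / real (Suc n)) x) \<longlonglongrightarrow> A x" "N (A x) \<le> M"
proof -
  define y where "y n = Y (1 / real (Suc n)) x" for n
  have step: "(N (y m - y n))\<^sup>2 \<le> (N (y m))\<^sup>2 - (N (y n))\<^sup>2" if "n \<le> m" for n m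
  proof (cases "n = m")
    case False
    then show ?thesis unfolding y_def using that by (intro Y_monotone_in_lam) (auto simp: divide_simps)
  qed simp
  have "incseq (\<lambda>n. (N (y n))\<^sup>2)"
    using step by (intro incseq_SucI) (smt (verit) le_SucI order_refl zero_le_power2)
  moreover have bnd: "(N (y n))\<^sup>2 \<le> M\<^sup>2" for n using assms by (intro power_mono) (auto simp: y_def)
  ultimately obtain L where L: "(\<lambda>n. (N (y n))\<^sup>2) \<longlonglongrightarrow> L" "\<forall>n. (N (y n))\<^sup>2 \<le> L"
    using incseq_convergent by blast
  have "Cauchy y"
    unfolding Cauchy_altdef2
  proof (intro allI impI)
    fix e :: real assume e: "0 < e"
    have "eventually (\<lambda>n. L - c * e\<^sup>2 < (N (y n))\<^sup>2) sequentially"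
      using L(1) c e by (intro order_tendstoD(1)) auto
    then obtain K where K: "L - c * e\<^sup>2 < (N (y K))\<^sup>2" unfolding eventually_sequentially by blast
    have "dist (y n) (y K) < e" if "K \<le> n" for n
    proof -
      have "c * (norm (y n - y K))\<^sup>2 \<le> (N (y n))\<^sup>2 - (N (y K))\<^sup>2"
        using step[OF that] Q_coercive[of "y n - y K"] by (simp add: N_sq)
      also have "\<dots> < c * e\<^sup>2" using K L(2) by (smt (verit))
      finally have "(norm (y n - y K))\<^sup>2 < e\<^sup>2" using c by simp
      then show ?thesis using e by (simp add: dist_norm power2_less_imp_less)
    qed
    then show "\<exists>N. \<forall>n\<ge>N. dist (y n) (y N) < e" by blast
  qed
  then obtain l where l: "y \<longlonglongrightarrow> l" using Cauchy_convergent_iff convergent_def by blast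
  have "(\<lambda>n. x - (1 / real (Suc n)) *\<^sub>R y n) \<longlonglongrightarrow> x - 0 *\<^sub>R l"
    using LIMSEQ_inverse_real_of_nat by (intro tendsto_intros l) (simp add: inverse_eq_divide)
  moreover have "x - (1 / real (Suc n)) *\<^sub>R y n = J (1 / real (Suc n)) x" for n
    using J_eq[of "1 / real (Suc n)" x] by (simp add: y_def Y_def diff_eq_eq)
  ultimately have Jx: "(\<lambda>n. J (1 / real (Suc n)) x) \<longlonglongrightarrow> x" by simp
  have "(\<lambda>n. A (J (1 / real (Suc n)) x)) \<longlonglongrightarrow> l" using l unfolding y_def Y_def .
  from A_closed[OF _ Jx this] have xl: "x \<in> D" "A x = l" by (auto simp: J_in)
  then show "x \<in> D" "(\<lambda>n. Y (1 / real (Suc n)) x) \<longlonglongrightarrow> A x"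
    using l unfolding y_def by auto
  show "N (A x) \<le> M"
    using LIMSEQ_le_const2[OF tendsto_N[OF l], of M] assms xl by (auto simp: y_def)
qed

lemma yosida_tendsto: "x \<in> D \<Longrightarrow> (\<lambda>n. Y (1 / real (Suc n)) x) \<longlonglongrightarrow> A x"
  by (rule yosida_limit(2)[where M = "N (A x)"]) (simp add: N_Y_le)

end

section \<open>The implicit Euler scheme\<close>

text \<open>The Cauchy problem U' + A U = F U with U 0 = U0, the datum lying in the domain.\<close>

locale evolution = accretive_operator Q c D A
  for Q :: "'a::{real_inner, banach, second_countable_topology} \<Rightarrow> 'a \<Rightarrow> real"
    and c D A +
  fixes F :: "'a \<Rightarrow> 'a" and K T :: real and U0 :: 'a
  assumes F_lip: "N (F x - F y) \<le> K * N (x - y)" and K: "K \<ge> 0" and T: "T > 0" and U0: "U0 \<in> D"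
begin

lemma Q_increment: "Q x x \<le> Q y y + 2 * Q (x - y) x"
  using Q_pos[of "x - y"] by (simp add: Q.diff_left Q.diff_right Q_sym[of y x])

primrec E :: "real \<Rightarrow> nat \<Rightarrow> 'a" where
  "E h 0 = U0"
| "E h (Suc n) = J h (E h n + h *\<^sub>R F (E h n))"

text \<open>Bound for the discrete speed: the initial speed \<open>N (F U0 - A U0)\<close> grows by
  at most the factor \<open>1 + h * K\<close> per step.\<close>

definition M :: real where "M = N (F U0 - A U0) * exp (K * T)"

text \<open>Bound for \<open>A\<close> along the scheme, where \<open>A\<close> is \<open>F\<close>
  minus a difference quotient: \<open>N (F U0) + K * (T * M)\<close> bounds \<open>F\<close>, the
  last \<open>M\<close> bounds the quotient, and \<open>N (A U0)\<close> covers the initial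
  value.\<close>

definition M1 :: real where "M1 = N (A U0) + N (F U0) + K * (T * M) + M"

lemma M_nonneg: "0 \<le> M" by (simp add: M_def)

lemma M1_nonneg: "0 \<le> M1" using K T by (simp add: M1_def M_nonneg)

lemma E_in: "h > 0 \<Longrightarrow> E h n \<in> D"
  by (cases n) (auto simp: U0 J_in)

lemma E_step: "h > 0 \<Longrightarrow> E h (Suc n) - E h n = h *\<^sub>R (F (E h n) - A (E h (Suc n)))"
  using J_eq[of h "E h n + h *\<^sub>R F (E h n)"] by (simp add: algebra_simps)

text \<open>As \<open>U0\<close> lies in \<open>D\<close>, it is the resolvent of U0 + h A U0, so
  the first increment is of order h. Later increments follow from the contraction property of
  \<open>J h\<close>.\<close>

lemma E_step_bound:
  assumes h: "h > 0"
  shows "N (E h (Suc n) - E h n) \<le> h * N (F U0 - A U0) * (1 + h * K) ^ n"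
proof (induction n)
  case 0
  have "E h (Suc 0) - E h 0 = J h (U0 + h *\<^sub>R F U0) - J h (U0 + h *\<^sub>R A U0)"
    using J_eqI[OF h U0 refl] by simp
  also have "\<dots> = J h (h *\<^sub>R (F U0 - A U0))"
    by (simp add: linear_diff[OF J_linear[OF h], symmetric] scaleR_diff_right)
  finally show ?case using J_contraction[OF h, of "h *\<^sub>R (F U0 - A U0)"] h by (simp add: N_scale)
next
  case (Suc n)
  let ?d = "E h (Suc n) - E h n" and ?f = "F (E h (Suc n)) - F (E h n)"
  have "E h (Suc (Suc n)) - E h (Suc n) = J h (?d + h *\<^sub>R ?f)"
    by (simp add: linear_diff[OF J_linear[OF h], symmetric] algebra_simps)
  then have "N (E h (Suc (Suc n)) - E h (Suc n)) \<le> N (?d + h *\<^sub>R ?f)"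
    using J_contraction[OF h] by metis
  also have "\<dots> \<le> N ?d + h * N ?f" using N_triangle[of ?d "h *\<^sub>R ?f"] h by (simp add: N_scale)
  also have "\<dots> \<le> N ?d + h * (K * N ?d)" using F_lip h by (intro add_left_mono mult_left_mono) auto
  also have "\<dots> = (1 + h * K) * N ?d" by (simp add: algebra_simps)
  also have "\<dots> \<le> (1 + h * K) * (h * N (F U0 - A U0) * (1 + h * K) ^ n)"
    using Suc h K by (intro mult_left_mono) auto
  finally show ?case by (simp add: algebra_simps)
qed

lemma power_le_exp:
  assumes "0 \<le> a" "0 \<le> h" "h * real n \<le> T"
  shows "(1 + h * a) ^ n \<le> exp (a * T)"
proof -
  have "(1 + h * a) ^ n \<le> exp (h * a) ^ n" using assms by (intro power_mono exp_ge_add_one_self) auto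
  also have "\<dots> = exp (a * (h * real n))" by (simp add: exp_of_nat_mult[symmetric] mult_ac)
  also have "\<dots> \<le> exp (a * T)" using assms by (simp add: mult_left_mono)
  finally show ?thesis .
qed

lemma E_step_bound':
  assumes h: "h > 0" and n: "h * real n \<le> T"
  shows "N (E h (Suc n) - E h n) \<le> h * M"
proof -
  have "h * N (F U0 - A U0) * (1 + h * K) ^ n \<le> h * N (F U0 - A U0) * exp (K * T)"
    using power_le_exp[OF K _ n] h by (intro mult_left_mono) auto
  then show ?thesis using E_step_bound[OF h, of n] by (simp add: M_def mult.assoc)
qed

lemma E_lip:
  assumes h: "h > 0" and n: "h * real (m + p) \<le> T"
  shows "N (E h (m + p) - E h m) \<le> h * real p * M"
  using n
proof (induction p)
  case (Suc p)
  have hp: "h * real (m + p) \<le> T" using Suc(2) h by (simp add: algebra_simps)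
  have "N (E h (m + Suc p) - E h m) \<le> N (E h (Suc (m + p)) - E h (m + p)) + N (E h (m + p) - E h m)"
    using N_triangle_diff[of "E h (Suc (m + p))" "E h m" "E h (m + p)"] by simp
  also have "\<dots> \<le> h * M + h * real p * M" using Suc(1)[OF hp] E_step_bound'[OF h hp] by linarith
  finally show ?case by (simp add: algebra_simps)
qed simp

lemma A_bound:
  assumes h: "h > 0" and n: "h * real n \<le> T"
  shows "N (A (E h n)) \<le> M1"
proof (cases n)
  case 0
  then show ?thesis using K T M_nonneg by (simp add: M1_def)
next
  case (Suc k)
  have hk: "h * real k \<le> T" using n h Suc by (simp add: algebra_simps)
  have "A (E h n) = F (E h k) - (1/h) *\<^sub>R (E h (Suc k) - E h k)"
    using E_step[OF h, of k] h Suc by simp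
  then have "N (A (E h n)) \<le> N (F (E h k)) + (1/h) * N (E h (Suc k) - E h k)"
    using N_triangle[of "F (E h k)" "- ((1/h) *\<^sub>R (E h (Suc k) - E h k))"]
      N_scale[of "- (1/h)" "E h (Suc k) - E h k"] h by simp
  also have "(1/h) * N (E h (Suc k) - E h k) \<le> (1/h) * (h * M)"
    using E_step_bound'[OF h hk] h by (intro mult_left_mono) auto
  also have "(1/h) * (h * M) = M" using h by simp
  finally have 1: "N (A (E h n)) \<le> N (F (E h k)) + M" by simp
  have "N (F (E h k)) \<le> N (F U0) + N (F (E h k) - F U0)" by (rule N_triangle_sub)
  also have "N (F (E h k) - F U0) \<le> K * N (E h k - U0)" by (rule F_lip)
  also have "N (E h k - U0) \<le> T * M"
  proof -
    have "N (E h k - U0) \<le> h * real k * M" using E_lip[OF h, of 0 k] hk by simp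
    also have "\<dots> \<le> T * M" using hk M_nonneg by (intro mult_right_mono)
    finally show ?thesis .
  qed
  finally have "N (F (E h k)) \<le> N (F U0) + K * (T * M)" using K by (simp add: mult_left_mono)
  then show ?thesis using 1 N_nonneg[of "A U0"] unfolding M1_def by linarith
qed

text \<open>The two sources of error in one step: the first summand comes from the explicit part,
  with one power of h traded for \<open>T\<close>, and \<open>M1 * M\<close> from the half step at
  which \<open>A\<close> is evaluated at another point.\<close>

definition C2 :: real where "C2 = 7 * K * M\<^sup>2 * T + M1 * M"

lemma C2_nonneg: "0 \<le> C2" using K T M_nonneg M1_nonneg by (simp add: C2_def)

text \<open>
  Both half steps of the fine scheme are compared with the same implicit value of the coarse one;
  the mismatch of one half step costs \<open>O(h)\<close> because \<open>A\<close> stays bounded along the scheme.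
\<close>

lemma halving_step:
  assumes h: "h > 0" and n: "h * real (Suc n) \<le> T"
  shows "(N (E h (Suc n) - E (h/2) (2 * Suc n)))\<^sup>2
           \<le> (1 + h * (5 * K)) * (N (E h n - E (h/2) (2 * n)))\<^sup>2 + C2 * h\<^sup>2"
proof -
  define u0 u1 w0 w1 w2 where defs: "u0 = E h n" "u1 = E h (Suc n)"
    "w0 = E (h/2) (2 * n)" "w1 = E (h/2) (Suc (2 * n))" "w2 = E (h/2) (Suc (Suc (2 * n)))"
  define d where "d = N (u0 - w0)"
  have d0: "0 \<le> d" by (simp add: d_def)
  have h2: "h/2 > 0" using h by simp
  have hT: "h \<le> T" using n mult_nonneg_nonneg[OF less_imp_le[OF h], of "real n"] by (simp add: distrib_left)
  have ns: "h * real n \<le> T" "h/2 * real (2 * n) \<le> T" "h/2 * real (Suc (2 * n)) \<le> T" "h/2 * real (Suc (Suc (2 * n))) \<le> T"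
    using n h by (simp_all add: algebra_simps)
  have inD: "u1 \<in> D" "w1 \<in> D" "w2 \<in> D" using E_in h h2 unfolding defs by blast+
  have b: "N (u1 - u0) \<le> h * M" "N (w1 - w0) \<le> h/2 * M" "N (w2 - w1) \<le> h/2 * M"
    using E_step_bound'[OF h ns(1)] E_step_bound'[OF h2 ns(2)] E_step_bound'[OF h2 ns(3)] unfolding defs by auto
  have Ab: "N (A u1) \<le> M1" "N (A w1) \<le> M1"
    using A_bound[OF h n] A_bound[OF h2 ns(3)] unfolding defs by auto
  let ?D = "u1 - w2"
  have ND: "N ?D \<le> d + 2 * h * M"
  proof -
    have "N ?D \<le> N (u1 - u0) + N (u0 - w2)" by (rule N_triangle_diff)
    also have "N (u0 - w2) \<le> N (u0 - w0) + N (w0 - w2)" by (rule N_triangle_diff)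
    also have "N (w0 - w2) \<le> N (w0 - w1) + N (w1 - w2)" by (rule N_triangle_diff)
    finally show ?thesis using b unfolding d_def N_minus[of w0 w1] N_minus[of w1 w2] by simp
  qed
  have diff: "?D - (u0 - w0) = (h/2) *\<^sub>R ((F u0 - F w0) + (F u0 - F w1) - (A u1 - A w1) - (A u1 - A w2))"
  proof -
    have "?D - (u0 - w0) = (u1 - u0) - (w1 - w0) - (w2 - w1)" by simp
    also have "\<dots> = h *\<^sub>R (F u0 - A u1) - (h/2) *\<^sub>R (F w0 - A w1) - (h/2) *\<^sub>R (F w1 - A w2)"
      using E_step[OF h, of n] E_step[OF h2, of "2 * n"] E_step[OF h2, of "Suc (2 * n)"] unfolding defs by presburger
    \<comment> \<open>The coarse increment is split in two, so that each half meets one fine half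
      step.\<close>
    also have "h *\<^sub>R (F u0 - A u1) = (h/2) *\<^sub>R (F u0 - A u1) + (h/2) *\<^sub>R (F u0 - A u1)"
      by (simp add: scaleR_add_left[symmetric])
    finally show ?thesis by (simp add: algebra_simps)
  qed
  have q1: "Q (F u0 - F w0) ?D \<le> K * d * (d + 2 * h * M)"
    using F_lip[of u0 w0] ND K d0 h M_nonneg unfolding d_def
    by (intro order_trans[OF cauchy_schwarz] mult_mono) auto
  have q2: "Q (F u0 - F w1) ?D \<le> K * (d + h * M) * (d + 2 * h * M)"
  proof -
    have "N (u0 - w1) \<le> d + N (w1 - w0)"
      unfolding d_def using N_triangle_diff[of u0 w1 w0] N_minus[of w0 w1] by simp
    also have "\<dots> \<le> d + h * M" using b(2) mult_nonneg_nonneg[OF less_imp_le[OF h] M_nonneg] by simp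
    finally have "N (F u0 - F w1) \<le> K * (d + h * M)" using F_lip[of u0 w1] K by (meson mult_left_mono order_trans)
    then show ?thesis using ND K d0 h M_nonneg
      by (intro order_trans[OF cauchy_schwarz] mult_mono) auto
  qed
  \<comment> \<open>The first half step evaluates \<open>A\<close> at \<open>w1\<close>, while
    \<open>?D\<close> ends in \<open>w2\<close>: the part along \<open>u1 - w1\<close> has a sign,
    and the rest is paired with \<open>w1 - w2\<close>, whose size is at most
    \<open>h/2 * M\<close>.\<close>
  have q3: "- Q (A u1 - A w1) ?D \<le> M1 * M * h"
  proof -
    have "?D = (u1 - w1) + (w1 - w2)" by simp
    then have "Q (A u1 - A w1) ?D = Q (A (u1 - w1)) (u1 - w1) + Q (A u1 - A w1) (w1 - w2)"
      using inD by (simp only: Q.add_right A_diff)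
    then have "- Q (A u1 - A w1) ?D \<le> \<bar>Q (A u1 - A w1) (w1 - w2)\<bar>"
      using mono[OF D_diff[OF inD(1,2)]] by linarith
    also have "\<dots> \<le> N (A u1 - A w1) * N (w1 - w2)" by (rule cauchy_schwarz_abs)
    also have "\<dots> \<le> (2 * M1) * (h/2 * M)"
      using b(3) Ab N_triangle[of "A u1" "- A w1"] N_scale[of "-1" "A w1"] M1_nonneg N_minus[of w1 w2]
      by (intro mult_mono) auto
    finally show ?thesis by (simp add: mult_ac)
  qed
  have q4: "- Q (A u1 - A w2) ?D \<le> 0" using mono[OF D_diff[OF inD(1,3)]] inD by (simp add: A_diff)
  have "Q ?D ?D \<le> Q (u0 - w0) (u0 - w0) + 2 * Q (?D - (u0 - w0)) ?D" by (rule Q_increment)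
  also have "2 * Q (?D - (u0 - w0)) ?D
      = h * (Q (F u0 - F w0) ?D + Q (F u0 - F w1) ?D + - Q (A u1 - A w1) ?D + - Q (A u1 - A w2) ?D)"
    unfolding diff by (simp add: Q.scaleR_left Q.add_left Q.diff_left algebra_simps)
  also have "\<dots> \<le> h * (K * d * (d + 2 * h * M) + K * (d + h * M) * (d + 2 * h * M) + M1 * M * h + 0)"
    using h by (intro mult_left_mono add_mono q1 q2 q3 q4) auto
  \<comment> \<open>Young's inequality for the mixed term leaves 9/2 in front of both squares; 5 and
    7 are rounded up.\<close>
  also have "\<dots> \<le> h * (5 * K * d\<^sup>2 + 7 * K * (h * M)\<^sup>2 + M1 * M * h)"
  proof -
    have "K * ((h * M) * d) * 2 \<le> K * (d\<^sup>2 + (h * M)\<^sup>2)"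
      using K sum_squares_bound[of "h * M" d] mult_left_mono[of "2 * (h * M) * d" "(h * M)\<^sup>2 + d\<^sup>2" K]
      by (simp add: algebra_simps)
    moreover have "K * d * (d + 2 * h * M) + K * (d + h * M) * (d + 2 * h * M)
        = 2 * (K * d\<^sup>2) + 5 * (K * ((h * M) * d)) + 2 * (K * (h * M)\<^sup>2)"
      by (simp add: algebra_simps power2_eq_square)
    moreover have "0 \<le> K * d\<^sup>2" "0 \<le> K * (h * M)\<^sup>2" using K by auto
    ultimately have "K * d * (d + 2 * h * M) + K * (d + h * M) * (d + 2 * h * M) \<le> 5 * K * d\<^sup>2 + 7 * K * (h * M)\<^sup>2"
      by (simp add: algebra_simps)
    then show ?thesis using h by (intro mult_left_mono) auto
  qed
  also have "\<dots> \<le> h * (5 * K * d\<^sup>2) + C2 * h\<^sup>2"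
  proof -
    have "(h * M)\<^sup>2 \<le> h * M\<^sup>2 * T"
      using hT h mult_right_mono[of h T "h * (M * M)"] by (simp add: power2_eq_square mult_ac)
    then have "7 * K * (h * M)\<^sup>2 \<le> 7 * K * (h * M\<^sup>2 * T)" using K by (intro mult_left_mono) auto
    then have "h * (7 * K * (h * M)\<^sup>2) \<le> h * (7 * K * (h * M\<^sup>2 * T))" using h by (simp only: mult_le_cancel_left_pos)
    then show ?thesis by (simp add: C2_def power2_eq_square algebra_simps)
  qed
  finally have "Q ?D ?D \<le> Q (u0 - w0) (u0 - w0) + (h * (5 * K * d\<^sup>2) + C2 * h\<^sup>2)" by simp
  then show ?thesis unfolding d_def defs[symmetric] N_sq[symmetric]
    by (simp add: defs algebra_simps)
qed

definition C3 :: real where "C3 = C2 * T * exp (5 * K * T)"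

lemma C3_nonneg: "0 \<le> C3" using C2_nonneg T by (simp add: C3_def)

text \<open>Local errors of order h^2 over at most T/h steps add up to order h for the squared
  distance. The resulting rate, the square root of h, is summable along dyadic step sizes.\<close>

lemma halving_bound:
  assumes h: "h > 0" and n: "h * real n \<le> T"
  shows "(N (E h n - E (h/2) (2 * n)))\<^sup>2 \<le> C3 * h"
proof -
  let ?r = "1 + h * (5 * K)"
  have r1: "1 \<le> ?r" using h K by simp
  have "(N (E h n - E (h/2) (2 * n)))\<^sup>2 \<le> C2 * h\<^sup>2 * (real n * ?r ^ n)"
    using n
  proof (induction n)
    case (Suc n)
    have hn: "h * real n \<le> T" using Suc(2) h by (simp add: algebra_simps)
    have "(N (E h (Suc n) - E (h/2) (2 * Suc n)))\<^sup>2 \<le> ?r * (N (E h n - E (h/2) (2 * n)))\<^sup>2 + C2 * h\<^sup>2 * 1"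
      using halving_step[OF h Suc(2)] by simp
    also have "\<dots> \<le> ?r * (C2 * h\<^sup>2 * (real n * ?r ^ n)) + C2 * h\<^sup>2 * (?r ^ Suc n)"
      using Suc(1)[OF hn] r1 C2_nonneg one_le_power[OF r1, of "Suc n"] by (intro add_mono mult_left_mono) auto
    also have "\<dots> = C2 * h\<^sup>2 * (real (Suc n) * ?r ^ Suc n)" by (simp add: algebra_simps)
    finally show ?case .
  qed simp
  also have "\<dots> = C2 * h * (h * real n) * ?r ^ n" by (simp add: power2_eq_square mult_ac)
  also have "\<dots> \<le> C2 * h * T * exp (5 * K * T)"
    using power_le_exp[of "5 * K" h n] n h K C2_nonneg T r1 by (intro mult_mono) auto
  finally show ?thesis by (simp add: C3_def mult_ac)
qed

end

lemma has_vector_derivative_if_quadratic: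
  fixes f :: "real \<Rightarrow> 'a::real_normed_vector"
  assumes "\<And>y. y \<in> S \<Longrightarrow> norm (f y - f x - (y - x) *\<^sub>R d) \<le> C * (y - x)\<^sup>2"
  shows "(f has_vector_derivative d) (at x within S)"
  unfolding has_vector_derivative_def has_derivative_within_alt
proof (intro conjI allI impI)
  show "bounded_linear (\<lambda>x. x *\<^sub>R d)" by (rule bounded_linear_scaleR_left)
  fix e :: real assume e: "0 < e"
  show "\<exists>da>0. \<forall>y\<in>S. norm (y - x) < da \<longrightarrow> norm (f y - f x - (y - x) *\<^sub>R d) \<le> e * norm (y - x)"
  \<comment> \<open>The summand 1 avoids a division by zero when \<open>C = 0\<close>.\<close>
  proof (intro exI[of _ "e / (\<bar>C\<bar> + 1)"] conjI ballI impI)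
    show "0 < e / (\<bar>C\<bar> + 1)" using e by simp
    fix y assume y: "y \<in> S" "norm (y - x) < e / (\<bar>C\<bar> + 1)"
    have "norm (f y - f x - (y - x) *\<^sub>R d) \<le> C * (y - x)\<^sup>2" using assms y by blast
    also have "\<dots> \<le> (\<bar>C\<bar> + 1) * (y - x)\<^sup>2" by (intro mult_right_mono) auto
    also have "\<dots> = ((\<bar>C\<bar> + 1) * \<bar>y - x\<bar>) * \<bar>y - x\<bar>" by (simp add: power2_eq_square)
    also have "\<dots> \<le> e * \<bar>y - x\<bar>"
    proof (rule mult_right_mono)
      have "\<bar>y - x\<bar> * (\<bar>C\<bar> + 1) < e" using y(2) by (simp add: pos_less_divide_eq)
      then show "(\<bar>C\<bar> + 1) * \<bar>y - x\<bar> \<le> e" by (simp add: mult.commute)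
    qed simp
    finally show "norm (f y - f x - (y - x) *\<^sub>R d) \<le> e * norm (y - x)" by simp
  qed
qed

section \<open>Convergence of the scheme along dyadic step sizes\<close>

context evolution
begin

definition h :: "nat \<Rightarrow> real" where "h m = T / 2 ^ m"

definition k :: "nat \<Rightarrow> real \<Rightarrow> nat" where "k m t = nat \<lfloor>t * 2 ^ m / T\<rfloor>"

text \<open>The piecewise constant interpolation that takes the value at the left end of each grid
  interval.\<close>

definition S :: "nat \<Rightarrow> real \<Rightarrow> 'a" where "S m t = E (h m) (k m t)"

lemma h_pos: "0 < h m" using T by (simp add: h_def)

lemma h_half: "h (Suc m) = h m / 2" by (simp add: h_def)

lemma k_bounds:
  assumes "0 \<le> t"
  shows "h m * real (k m t) \<le> t" "t < h m * (real (k m t) + 1)"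
proof -
  have "0 \<le> t * 2 ^ m / T" using assms T by simp
  then have "real (k m t) = of_int \<lfloor>t * 2 ^ m / T\<rfloor>" by (simp add: k_def)
  then have "real (k m t) \<le> t * 2 ^ m / T" "t * 2 ^ m / T < real (k m t) + 1" by linarith+
  moreover have "t = h m * (t * 2 ^ m / T)" using T by (simp add: h_def)
  ultimately show "h m * real (k m t) \<le> t" "t < h m * (real (k m t) + 1)"
    using h_pos[of m] by (metis less_imp_le mult_left_mono, metis mult_strict_left_mono)
qed

lemma k_Suc:
  assumes "0 \<le> t"
  shows "k (Suc m) t = 2 * k m t \<or> k (Suc m) t = Suc (2 * k m t)"
proof -
  define x where "x = t * 2 ^ m / T"
  have "0 \<le> x" using assms T by (simp add: x_def)
  moreover have "k (Suc m) t = nat \<lfloor>2 * x\<rfloor>" "k m t = nat \<lfloor>x\<rfloor>" by (simp_all add: k_def x_def mult_ac)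
  moreover have "\<lfloor>2 * x\<rfloor> = 2 * \<lfloor>x\<rfloor> \<or> \<lfloor>2 * x\<rfloor> = 2 * \<lfloor>x\<rfloor> + 1" by linarith
  ultimately show ?thesis by (auto simp: nat_mult_distrib nat_add_distrib)
qed

lemma k_mono: "\<lbrakk>0 \<le> s; s \<le> t\<rbrakk> \<Longrightarrow> k m s \<le> k m t"
  unfolding k_def using T by (intro nat_mono floor_mono divide_right_mono mult_right_mono) auto

lemma k_diff:
  assumes "0 \<le> s" "s \<le> t"
  shows "h m * real (k m t - k m s) \<le> t - s + h m"
  using k_bounds(1)[of t m] k_bounds(2)[of s m] k_mono[OF assms, of m] assms
  by (simp add: of_nat_diff algebra_simps)

text \<open>Halving the step halves the bound on the squared distance, hence this ratio for the
  distance itself.\<close>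

definition \<rho> :: real where "\<rho> = sqrt (1/2)"

lemma \<rho>: "0 < \<rho>" "\<rho> < 1" by (simp_all add: \<rho>_def)

text \<open>Sum of the geometric series of ratio \<open>\<rho>\<close> for the two contributions in
  \<open>S_step\<close>.\<close>

definition B :: real where "B = (sqrt (C3 * T) + T * M) / (1 - \<rho>)"

text \<open>Two contributions: the distance of the two schemes at the common grid point, and one
  further fine step when the fine index of \<open>t\<close> is odd. Both are multiples of
  \<open>\<rho> ^ m\<close> at most, and the bound is written as a difference so that it telescopes
  in \<open>S_cauchy\<close>.\<close>

lemma S_step:
  assumes t: "t \<in> {0..T}"
  shows "N (S (Suc m) t - S m t) \<le> B * (\<rho> ^ m - \<rho> ^ Suc m)"
proof -
  let ?n = "k m t"
  have n: "h m * real ?n \<le> T" "h m * real ?n \<le> t" using k_bounds(1)[of t m] t by auto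
  have hm: "h m / 2 > 0" using h_pos[of m] by simp
  have r2: "\<rho> ^ m = sqrt ((1/2) ^ m)" by (simp add: \<rho>_def real_sqrt_power)
  have "N (E (h m / 2) (2 * ?n) - E (h m) ?n) \<le> sqrt (C3 * h m)"
    using halving_bound[OF h_pos n(1)] N_minus by (intro real_le_rsqrt) metis
  also have "\<dots> = sqrt (C3 * T) * \<rho> ^ m"
    by (simp add: r2 h_def real_sqrt_mult[symmetric] power_one_over)
  finally have 1: "N (E (h m / 2) (2 * ?n) - E (h m) ?n) \<le> sqrt (C3 * T) * \<rho> ^ m" .
  have hr: "h m \<le> T * \<rho> ^ m"
  proof -
    have "(1/2::real) \<le> \<rho>" unfolding \<rho>_def by (rule real_le_rsqrt) (simp add: power2_eq_square)
    then have "(1/2::real) ^ m \<le> \<rho> ^ m" by (intro power_mono) auto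
    then show ?thesis using T by (simp add: h_def power_one_over field_simps)
  qed
  have 2: "N (S (Suc m) t - E (h m / 2) (2 * ?n)) \<le> h m * M"
    using k_Suc[of t m]
  proof
    assume *: "k (Suc m) t = Suc (2 * ?n)"
    have "h m / 2 * real (2 * ?n) \<le> T" using n by simp
    from E_step_bound'[OF hm this] have "N (S (Suc m) t - E (h m / 2) (2 * ?n)) \<le> h m / 2 * M"
      unfolding S_def * h_half .
    also have "\<dots> \<le> h m * M" using h_pos[of m] M_nonneg by (intro mult_right_mono) auto
    finally show ?thesis .
  qed (use t M_nonneg less_imp_le[OF h_pos[of m]] in \<open>simp_all add: S_def h_half\<close>)
  have "N (S (Suc m) t - S m t) \<le> N (S (Suc m) t - E (h m / 2) (2 * ?n)) + N (E (h m / 2) (2 * ?n) - S m t)"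
    by (rule N_triangle_diff)
  also have "\<dots> \<le> T * \<rho> ^ m * M + sqrt (C3 * T) * \<rho> ^ m"
    using 1 2 mult_right_mono[OF hr M_nonneg] by (simp add: S_def)
  also have "\<dots> = B * ((1 - \<rho>) * \<rho> ^ m)" using \<rho> by (simp add: B_def field_simps)
  finally show ?thesis by (simp add: algebra_simps)
qed

lemma S_cauchy:
  assumes t: "t \<in> {0..T}"
  shows "N (S (m + p) t - S m t) \<le> B * (\<rho> ^ m - \<rho> ^ (m + p))"
proof (induction p)
  case (Suc p)
  have "N (S (m + Suc p) t - S m t) \<le> N (S (Suc (m + p)) t - S (m + p) t) + N (S (m + p) t - S m t)"
    using N_triangle_diff by simp
  also have "\<dots> \<le> B * (\<rho> ^ (m + p) - \<rho> ^ Suc (m + p)) + B * (\<rho> ^ m - \<rho> ^ (m + p))"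
    using Suc S_step[OF t, of "m + p"] by linarith
  finally show ?case by (simp add: algebra_simps)
qed simp

lemma B_nonneg: "0 \<le> B" unfolding B_def using \<rho> T C3_nonneg M_nonneg by simp

lemma S_cauchy': "t \<in> {0..T} \<Longrightarrow> N (S (m + p) t - S m t) \<le> B * \<rho> ^ m"
  by (rule order_trans[OF S_cauchy]) (use B_nonneg \<rho> in \<open>auto intro!: mult_left_mono\<close>)

text \<open>
  The argument is clamped to \<open>[0,T]\<close>, so that \<open>U\<close> is defined and Lipschitz on the whole line.
\<close>

definition U :: "real \<Rightarrow> 'a" where "U t = lim (\<lambda>m. S m (max 0 (min T t)))"

lemma rate_tendsto: "(\<lambda>m. B * \<rho> ^ m) \<longlonglongrightarrow> 0"
  using tendsto_mult[OF tendsto_const LIMSEQ_realpow_zero[of \<rho>], of B] \<rho> by simp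

lemma S_tendsto:
  assumes t: "t \<in> {0..T}"
  shows "(\<lambda>m. S m t) \<longlonglongrightarrow> U t"
proof -
  have "Cauchy (\<lambda>m. S m t)"
    unfolding Cauchy_altdef2
  proof (intro allI impI)
    fix e :: real assume e: "0 < e"
    have "eventually (\<lambda>m. B * \<rho> ^ m < e * sqrt c) sequentially"
      using rate_tendsto e c by (intro order_tendstoD(2)) auto
    then obtain n where n: "B * \<rho> ^ n < e * sqrt c" unfolding eventually_sequentially by blast
    have "dist (S m t) (S n t) < e" if "n \<le> m" for m
    proof -
      have "norm (S m t - S n t) \<le> N (S m t - S n t) / sqrt c" by (rule norm_le_N)
      also have "\<dots> < e" using S_cauchy'[OF t, of n "m - n"] n that c by (simp add: divide_simps)
      finally show ?thesis by (simp add: dist_norm)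
    qed
    then show "\<exists>n. \<forall>m\<ge>n. dist (S m t) (S n t) < e" by blast
  qed
  then have "convergent (\<lambda>m. S m t)" by (simp add: Cauchy_convergent_iff)
  moreover have "U t = lim (\<lambda>m. S m t)" using t by (simp add: U_def)
  ultimately show ?thesis by (simp add: convergent_LIMSEQ_iff)
qed

lemma S_rate:
  assumes t: "t \<in> {0..T}"
  shows "N (U t - S m t) \<le> B * \<rho> ^ m"
proof (rule LIMSEQ_le_const2)
  show "(\<lambda>p. N (S (p + m) t - S m t)) \<longlonglongrightarrow> N (U t - S m t)"
    by (intro tendsto_N tendsto_intros LIMSEQ_ignore_initial_segment S_tendsto t)
  show "\<exists>n. \<forall>p\<ge>n. N (S (p + m) t - S m t) \<le> B * \<rho> ^ m"
    using S_cauchy'[OF t, of m] by (auto simp: add.commute)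
qed

lemma h_tendsto: "h \<longlonglongrightarrow> 0"
proof -
  have "h = (\<lambda>m. T * (1/2) ^ m)" by (simp add: fun_eq_iff h_def power_one_over)
  moreover have "(\<lambda>m. T * (1/2) ^ m) \<longlonglongrightarrow> T * 0" by (intro tendsto_intros LIMSEQ_realpow_zero) auto
  ultimately show ?thesis by simp
qed

lemma U_clamp: "U t = U (max 0 (min T t))" using T by (simp add: U_def)

lemma U_zero: "U 0 = U0"
proof -
  have "(\<lambda>m. S m 0) \<longlonglongrightarrow> U 0" using T by (intro S_tendsto) auto
  moreover have "S m 0 = U0" for m by (simp add: S_def k_def)
  ultimately show ?thesis by (simp add: LIMSEQ_const_iff)
qed

lemma U_lip':
  assumes "0 \<le> s" "s \<le> t" "t \<le> T"
  shows "N (U t - U s) \<le> M * (t - s)"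
proof (rule LIMSEQ_le)
  show "(\<lambda>m. N (S m t - S m s)) \<longlonglongrightarrow> N (U t - U s)"
    using assms by (intro tendsto_N tendsto_intros S_tendsto) auto
  show "(\<lambda>m. M * (t - s + h m)) \<longlonglongrightarrow> M * (t - s)"
    using tendsto_mult[OF tendsto_const tendsto_add[OF tendsto_const h_tendsto], of M "t - s"] by simp
  have "N (S m t - S m s) \<le> M * (t - s + h m)" for m
  proof -
    have "N (E (h m) (k m s + (k m t - k m s)) - E (h m) (k m s)) \<le> h m * real (k m t - k m s) * M"
      using k_bounds(1)[of t m] k_mono[of s t m] assms by (intro E_lip h_pos) auto
    also have "\<dots> \<le> (t - s + h m) * M"
      using k_diff[of s t m] assms M_nonneg by (intro mult_right_mono) auto
    finally show ?thesis using k_mono[of s t m] assms by (simp add: S_def mult.commute)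
  qed
  then show "\<exists>n. \<forall>m\<ge>n. N (S m t - S m s) \<le> M * (t - s + h m)" by blast
qed

lemma U_lip: "N (U t - U s) \<le> M * \<bar>t - s\<bar>"
proof -
  let ?c = "\<lambda>t. max 0 (min T t)"
  have *: "N (U (?c t) - U (?c s)) \<le> M * (t - s)" if "s \<le> t" for s t
  proof -
    have "N (U (?c t) - U (?c s)) \<le> M * (?c t - ?c s)" using that T by (intro U_lip') auto
    also have "\<dots> \<le> M * (t - s)" using that M_nonneg by (intro mult_left_mono) auto
    finally show ?thesis .
  qed
  show ?thesis
  proof (cases "s \<le> t")
    case True
    then show ?thesis using *[of s t] U_clamp[of s] U_clamp[of t] by simp
  next
    case False
    then show ?thesis using *[of t s] U_clamp[of s] U_clamp[of t] N_minus[of "U t" "U s"] by simp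
  qed
qed

lemma U_lipschitz: "(M / sqrt c)-lipschitz_on UNIV U"
proof (rule lipschitz_onI)
  fix x y
  have "norm (U x - U y) \<le> N (U x - U y) / sqrt c" by (rule norm_le_N)
  also have "\<dots> \<le> M * \<bar>x - y\<bar> / sqrt c" using U_lip c by (intro divide_right_mono) auto
  finally show "dist (U x) (U y) \<le> M / sqrt c * dist x y" by (simp add: dist_norm)
qed (use M_nonneg c in simp)

lemma U_continuous: "continuous_on UNIV U"
  using U_lipschitz by (rule lipschitz_on_continuous_on)

lemma S_props:
  assumes t: "t \<in> {0..T}"
  shows "S m t \<in> D" "N (A (S m t)) \<le> M1"
  using E_in[OF h_pos] A_bound[OF h_pos] k_bounds(1)[of t m] t by (auto simp: S_def)

text \<open>Along the interpolations \<open>A\<close> is bounded but need not converge. The Yosida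
  approximations inherit the bound and, being bounded operators, keep it in the limit;
  \<open>yosida_limit\<close> then returns to \<open>A\<close>.\<close>

lemma U_props: "U t \<in> D" "N (A (U t)) \<le> M1"
proof -
  have *: "N (Y (1 / real (Suc n)) (U t)) \<le> M1" if t: "t \<in> {0..T}" for t n
  proof (rule LIMSEQ_le_const2)
    show "(\<lambda>m. N (Y (1 / real (Suc n)) (S m t))) \<longlonglongrightarrow> N (Y (1 / real (Suc n)) (U t))"
      by (intro tendsto_N bounded_linear.tendsto[OF Y_bounded_linear] S_tendsto t) simp
    show "\<exists>l. \<forall>m\<ge>l. N (Y (1 / real (Suc n)) (S m t)) \<le> M1"
      using N_Y_le[OF _ S_props(1)[OF t], of "1 / real (Suc n)"] S_props(2)[OF t]
      by (meson divide_pos_pos of_nat_0_less_iff order_trans zero_less_Suc zero_less_one)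
  qed
  have "max 0 (min T t) \<in> {0..T}" using T by auto
  from yosida_limit[OF *[OF this]] show "U t \<in> D" "N (A (U t)) \<le> M1"
    using U_clamp[of t] by auto
qed

text \<open>
  \<open>U\<close> itself need not be differentiable everywhere, but \<open>J 1\<close> turns \<open>A\<close> into the bounded operator \<open>Y 1\<close>,
  so \<open>J 1 (U t)\<close> is continuously differentiable; as \<open>J 1\<close> is injective, its equation determines that of \<open>U\<close>.
\<close>

definition G :: "'a \<Rightarrow> 'a" where "G x = J 1 (F x) - Y 1 x"

lemma N_Y1: "N (Y 1 x) \<le> 2 * N x"
  using N_triangle[of x "- J 1 x"] N_scale[of "-1" "J 1 x"] J_contraction[of 1 x] Y_eq[of 1 x] by simp

lemma G_lip: "N (G x - G y) \<le> (K + 2) * N (x - y)"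
proof -
  have "G x - G y = J 1 (F x - F y) + - Y 1 (x - y)"
    using linear_diff[OF J_linear[of 1]] linear_diff[OF bounded_linear.linear[OF Y_bounded_linear]] by (simp add: G_def)
  then have "N (G x - G y) \<le> N (J 1 (F x - F y)) + N (Y 1 (x - y))"
    using N_triangle[of "J 1 (F x - F y)" "- Y 1 (x - y)"] N_scale[of "-1" "Y 1 (x - y)"] by simp
  also have "\<dots> \<le> K * N (x - y) + 2 * N (x - y)"
    using J_contraction[of 1 "F x - F y"] F_lip[of x y] N_Y1[of "x - y"] by linarith
  finally show ?thesis by (simp add: algebra_simps)
qed

text \<open>Under \<open>J 1\<close> the operator \<open>A\<close> becomes \<open>Y 1\<close>, so
  every step is an Euler step for the Lipschitz field \<open>G\<close>, up to an error of order e^2.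
  \<open>P\<close> is fixed during the induction so that the error per step does not change with
  \<open>p\<close>.\<close>

lemma JE_increment:
  assumes e: "e > 0" and n: "e * real (a + P) \<le> T" and p: "p \<le> P"
  shows "N (J 1 (E e (a + p)) - J 1 (E e a) - (e * real p) *\<^sub>R G (E e a)) \<le> e * real p * ((K + 2) * M * (e * (real P + 1)))"
  using p
proof (induction p)
  case (Suc p)
  let ?x = "E e (a + p)" and ?y = "E e (Suc (a + p))" and ?z = "E e a"
  have "e * real (a + p) \<le> e * real (a + P)" using Suc(2) e by (intro mult_left_mono) auto
  then have np: "e * real (a + p) \<le> T" using n by simp
  have "J 1 ?y - J 1 ?x = e *\<^sub>R (J 1 (F ?x) - Y 1 ?y)"
  proof -
    have "J 1 ?y - J 1 ?x = J 1 (e *\<^sub>R (F ?x - A ?y))"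
      using E_step[OF e, of "a + p"] linear_diff[OF J_linear[of 1], of ?y ?x] by simp
    also have "\<dots> = e *\<^sub>R (J 1 (F ?x) - J 1 (A ?y))"
      by (simp add: linear_diff[OF J_linear] linear_scale[OF J_linear])
    finally show ?thesis by (simp only: J_commute[OF zero_less_one E_in[OF e]])
  qed
  also have "\<dots> = e *\<^sub>R G ?z + e *\<^sub>R ((G ?x - G ?z) + Y 1 (?x - ?y))"
    by (simp add: G_def linear_diff[OF bounded_linear.linear[OF Y_bounded_linear]] algebra_simps)
  finally have eq: "J 1 ?y - J 1 ?z - (e * real (Suc p)) *\<^sub>R G ?z
     = (J 1 ?x - J 1 ?z - (e * real p) *\<^sub>R G ?z) + e *\<^sub>R ((G ?x - G ?z) + Y 1 (?x - ?y))"
    by (simp add: algebra_simps)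
  have 1: "N (G ?x - G ?z) \<le> (K + 2) * (e * real p * M)"
    using K by (intro order_trans[OF G_lip] mult_left_mono E_lip e np) auto
  have 2: "N (Y 1 (?x - ?y)) \<le> (K + 2) * (e * M)"
  proof -
    have "N (Y 1 (?x - ?y)) \<le> 2 * (e * M)"
      using N_Y1[of "?x - ?y"] E_step_bound'[OF e np] N_minus[of ?x ?y] by simp
    also have "\<dots> \<le> (K + 2) * (e * M)" using K e M_nonneg by (intro mult_right_mono) auto
    finally show ?thesis .
  qed
  have "N (e *\<^sub>R ((G ?x - G ?z) + Y 1 (?x - ?y))) \<le> e * ((K + 2) * M * (e * (real p + 1)))"
  proof -
    have "N ((G ?x - G ?z) + Y 1 (?x - ?y)) \<le> (K + 2) * M * (e * (real p + 1))"
      using N_triangle[of "G ?x - G ?z" "Y 1 (?x - ?y)"] 1 2 by (simp add: algebra_simps)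
    then show ?thesis using e by (simp add: N_scale)
  qed
  also have "\<dots> \<le> e * ((K + 2) * M * (e * (real P + 1)))"
    using Suc(2) e K M_nonneg by (intro mult_left_mono) auto
  finally have 3: "N (e *\<^sub>R ((G ?x - G ?z) + Y 1 (?x - ?y))) \<le> e * ((K + 2) * M * (e * (real P + 1)))" .
  have "N (J 1 ?y - J 1 ?z - (e * real (Suc p)) *\<^sub>R G ?z)
     \<le> e * real p * ((K + 2) * M * (e * (real P + 1))) + e * ((K + 2) * M * (e * (real P + 1)))"
    unfolding eq using Suc(1) Suc(2) 3 by (intro order_trans[OF N_triangle] add_mono) auto
  then show ?case by (simp add: algebra_simps)
qed simp

lemma JU_increment:
  assumes "0 \<le> s" "s \<le> t" "t \<le> T"
  shows "N (J 1 (U t) - J 1 (U s) - (t - s) *\<^sub>R G (U s)) \<le> (K + 2) * M * (t - s)\<^sup>2"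
proof (rule LIMSEQ_le)
  let ?d = "\<lambda>m. h m * real (k m t - k m s)"
  have GL: "(\<lambda>m. G (S m s)) \<longlonglongrightarrow> G (U s)"
  proof (rule Lim_null[THEN iffD2], rule tendsto_norm_zero_cancel, rule tendsto_sandwich[of "\<lambda>_. 0"])
    show "\<forall>\<^sub>F m in sequentially. norm (G (S m s) - G (U s)) \<le> (K + 2) * N (S m s - U s) / sqrt c"
      using G_lip c by (intro always_eventually allI order_trans[OF norm_le_N] divide_right_mono) auto
    have "(\<lambda>m. N (S m s - U s)) \<longlonglongrightarrow> N (U s - U s)"
      using assms by (intro tendsto_N tendsto_intros S_tendsto) auto
    then show "(\<lambda>m. (K + 2) * N (S m s - U s) / sqrt c) \<longlonglongrightarrow> 0"
      using tendsto_divide[OF tendsto_mult[OF tendsto_const] tendsto_const, of _ 0 sequentially "sqrt c" "K + 2"] c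
      by simp
  qed auto
  have dL: "?d \<longlonglongrightarrow> t - s"
  proof (rule tendsto_sandwich)
    show "\<forall>\<^sub>F m in sequentially. t - s - h m \<le> ?d m"
      using k_bounds(1)[of s] k_bounds(2)[of t] k_mono[of s t] assms
      by (intro always_eventually allI) (simp add: of_nat_diff algebra_simps, smt (verit))
    show "\<forall>\<^sub>F m in sequentially. ?d m \<le> t - s + h m"
      using k_diff assms by (intro always_eventually allI) auto
    show "(\<lambda>m. t - s - h m) \<longlonglongrightarrow> t - s" "(\<lambda>m. t - s + h m) \<longlonglongrightarrow> t - s"
      using tendsto_diff[OF tendsto_const h_tendsto] tendsto_add[OF tendsto_const h_tendsto] by force+
  qed
  show "(\<lambda>m. N (J 1 (S m t) - J 1 (S m s) - ?d m *\<^sub>R G (S m s))) \<longlonglongrightarrow> N (J 1 (U t) - J 1 (U s) - (t - s) *\<^sub>R G (U s))"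
    using assms by (intro tendsto_N tendsto_intros bounded_linear.tendsto[OF J_bounded_linear] S_tendsto GL dL) auto
  show "(\<lambda>m. ?d m * ((K + 2) * M * (?d m + h m))) \<longlonglongrightarrow> (K + 2) * M * (t - s)\<^sup>2"
  proof -
    have "(\<lambda>m. ?d m * ((K + 2) * M * (?d m + h m))) \<longlonglongrightarrow> (t - s) * ((K + 2) * M * (t - s + 0))"
      by (intro tendsto_intros dL h_tendsto)
    then show ?thesis by (simp add: power2_eq_square mult_ac)
  qed
  have "N (J 1 (S m t) - J 1 (S m s) - ?d m *\<^sub>R G (S m s)) \<le> ?d m * ((K + 2) * M * (?d m + h m))" for m
  proof -
    have "h m * real (k m s + (k m t - k m s)) \<le> T"
      using k_mono[OF assms(1,2), of m] k_bounds(1)[of t m] assms by auto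
    from JE_increment[OF h_pos this order_refl] show ?thesis
      using k_mono[OF assms(1,2), of m] by (simp add: S_def algebra_simps)
  qed
  then show "\<exists>n. \<forall>m\<ge>n. N (J 1 (S m t) - J 1 (S m s) - ?d m *\<^sub>R G (S m s)) \<le> ?d m * ((K + 2) * M * (?d m + h m))"
    by blast
qed

lemma JU_derivative:
  assumes x: "x \<in> {0..T}"
  shows "((\<lambda>t. J 1 (U t)) has_vector_derivative G (U x)) (at x within {0..T})"
proof (rule has_vector_derivative_if_quadratic)
  fix y assume y: "y \<in> {0..T}"
  let ?C = "(K + 2) * M"
  have C: "0 \<le> ?C" using K M_nonneg by simp
  have "N (J 1 (U y) - J 1 (U x) - (y - x) *\<^sub>R G (U x)) \<le> 2 * ?C * (y - x)\<^sup>2"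
  proof (cases "x \<le> y")
    case True
    have "0 \<le> ?C * (y - x)\<^sup>2" using C by simp
    then show ?thesis using JU_increment[of x y] x y True by simp
  next
    case False
    \<comment> \<open>For \<open>y < x\<close> the estimate is based at \<open>y\<close>; moving the
      base point of \<open>G\<close> to \<open>x\<close> costs the same amount again, whence the
      factor 2.\<close>
    let ?a = "J 1 (U x) - J 1 (U y) - (x - y) *\<^sub>R G (U y)"
    have "J 1 (U y) - J 1 (U x) - (y - x) *\<^sub>R G (U x) = (-1) *\<^sub>R ?a + (x - y) *\<^sub>R (G (U x) - G (U y))"
      by (simp add: algebra_simps)
    then have "N (J 1 (U y) - J 1 (U x) - (y - x) *\<^sub>R G (U x))
        \<le> N ((-1) *\<^sub>R ?a) + N ((x - y) *\<^sub>R (G (U x) - G (U y)))"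
      by (simp only: N_triangle)
    also have "\<dots> = N ?a + \<bar>x - y\<bar> * N (G (U x) - G (U y))"
      by (simp only: N_scale abs_minus_cancel abs_one mult_1)
    also have "\<dots> \<le> ?C * (x - y)\<^sup>2 + \<bar>x - y\<bar> * ((K + 2) * (M * \<bar>x - y\<bar>))"
      using JU_increment[of y x] x y False G_lip[of "U x" "U y"] U_lip[of x y] K
      by (intro add_mono mult_left_mono) (auto intro: order_trans mult_left_mono)
    also have "\<dots> = 2 * ?C * (y - x)\<^sup>2" using False by (simp add: power2_eq_square algebra_simps)
    finally show ?thesis .
  qed
  then show "norm (J 1 (U y) - J 1 (U x) - (y - x) *\<^sub>R G (U x)) \<le> (2 * ?C / sqrt c) * (y - x)\<^sup>2"
    using norm_le_N[of "J 1 (U y) - J 1 (U x) - (y - x) *\<^sub>R G (U x)"] c by (simp add: divide_simps) 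
qed

end

section \<open>Functions with an integrable time derivative\<close>

lemma integral_Ioo:
  fixes g :: "real \<Rightarrow> 'b::{banach, second_countable_topology}"
  shows "integral\<^sup>L (lebesgue_on {a<..<b}) g = (LINT x|lebesgue. indicator {a<..<b} x *\<^sub>R g x)"
  by (rule integral_restrict_space) simp

lemma integrable_Ioo:
  fixes g :: "real \<Rightarrow> 'b::{banach, second_countable_topology}"
  shows "integrable (lebesgue_on {a<..<b}) g \<longleftrightarrow> integrable lebesgue (\<lambda>x. indicator {a<..<b} x *\<^sub>R g x)"
  by (rule integrable_restrict_space) simp

lemma integrable_Ioo_subset:
  fixes g :: "real \<Rightarrow> 'b::{banach, second_countable_topology}"
  assumes "integrable (lebesgue_on {a<..<b}) g" "a \<le> s" "t \<le> b"
  shows "integrable (lebesgue_on {s<..<t}) g"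
proof -
  have "integrable lebesgue (\<lambda>x. indicator {s<..<t} x *\<^sub>R (indicator {a<..<b} x *\<^sub>R g x))"
    using assms(1) unfolding integrable_Ioo by (rule integrable_mult_indicator[rotated]) simp
  also have "(\<lambda>x. indicator {s<..<t} x *\<^sub>R (indicator {a<..<b} x *\<^sub>R g x)) = (\<lambda>x. indicator {s<..<t} x *\<^sub>R g x)"
    using assms(2,3) by (auto simp: indicator_def)
  finally show ?thesis unfolding integrable_Ioo .
qed

lemma integral_Ioo_diff:
  fixes g :: "real \<Rightarrow> 'b::{banach, second_countable_topology}"
  assumes g: "integrable (lebesgue_on {a<..<b}) g" and "a \<le> s" "s \<le> t" "t \<le> b"
  shows "integral\<^sup>L (lebesgue_on {a<..<t}) g - integral\<^sup>L (lebesgue_on {a<..<s}) g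
          = integral\<^sup>L (lebesgue_on {s<..<t}) g"
proof -
  have i: "integrable lebesgue (\<lambda>x. indicator {u<..<v} x *\<^sub>R g x)" if "a \<le> u" "v \<le> b" for u v
    using integrable_Ioo_subset[OF g that] by (simp only: integrable_Ioo)
  have "(LINT x|lebesgue. indicator {a<..<t} x *\<^sub>R g x)
      = (LINT x|lebesgue. indicator {a<..<s} x *\<^sub>R g x + indicator {s<..<t} x *\<^sub>R g x)"
  proof (rule integral_cong_AE)
    \<comment> \<open>Open intervals omit their common endpoint, a null set.\<close>
    have "AE x in lebesgue. x \<noteq> s" by (rule AE_I'[of "{s}"]) (auto intro: null_sets_completionI)
    then show "AE x in lebesgue. indicator {a<..<t} x *\<^sub>R g x = indicator {a<..<s} x *\<^sub>R g x + indicator {s<..<t} x *\<^sub>R g x"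
      by eventually_elim (use assms in \<open>auto simp: indicator_def\<close>)
  qed (use i assms in \<open>auto intro!: borel_measurable_add borel_measurable_integrable\<close>)
  also have "\<dots> = (LINT x|lebesgue. indicator {a<..<s} x *\<^sub>R g x) + (LINT x|lebesgue. indicator {s<..<t} x *\<^sub>R g x)"
    using i assms by (intro Bochner_Integration.integral_add) auto
  finally show ?thesis by (simp add: integral_Ioo)
qed

lemma time_derivative_increment:
  assumes "has_time_derivative T u g" "0 \<le> s" "s \<le> t" "t \<le> T"
  shows "integrable (lebesgue_on {s<..<t}) g" "u t - u s = integral\<^sup>L (lebesgue_on {s<..<t}) g"
proof -
  have g: "integrable (lebesgue_on {0<..<T}) g" and u: "\<And>t. t \<in> {0..T} \<Longrightarrow> u t = u 0 + integral\<^sup>L (lebesgue_on {0<..<t}) g"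
    using assms(1) unfolding has_time_derivative_def by blast+
  show "integrable (lebesgue_on {s<..<t}) g" using integrable_Ioo_subset[OF g] assms by simp
  show "u t - u s = integral\<^sup>L (lebesgue_on {s<..<t}) g"
    using integral_Ioo_diff[OF g assms(2-4)] u[of s] u[of t] assms
    by (metis add_diff_cancel_left atLeastAtMost_iff order_trans)
qed

lemma has_time_derivative_linear:
  assumes "bounded_linear f" "has_time_derivative T u g"
  shows "has_time_derivative T (\<lambda>t. f (u t)) (\<lambda>t. f (g t))"
proof -
  interpret f: bounded_linear f by fact
  have g: "integrable (lebesgue_on {0<..<T}) g" and u: "\<And>t. t \<in> {0..T} \<Longrightarrow> u t = u 0 + integral\<^sup>L (lebesgue_on {0<..<t}) g"
    using assms(2) unfolding has_time_derivative_def by blast+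
  have "f (u t) = f (u 0) + integral\<^sup>L (lebesgue_on {0<..<t}) (\<lambda>t. f (g t))" if t: "t \<in> {0..T}" for t
  proof -
    have "integrable (lebesgue_on {0<..<t}) g" using integrable_Ioo_subset[OF g] t by simp
    then have "integral\<^sup>L (lebesgue_on {0<..<t}) (\<lambda>t. f (g t)) = f (integral\<^sup>L (lebesgue_on {0<..<t}) g)"
      by (rule integral_bounded_linear[OF assms(1)])
    then show ?thesis using arg_cong[OF u[OF t], of f] by (simp only: f.add)
  qed
  then show ?thesis unfolding has_time_derivative_def using integrable_bounded_linear[OF assms(1) g] by blast
qed

lemma has_time_derivative_add:
  assumes "has_time_derivative T u g" "has_time_derivative T v k"
  shows "has_time_derivative T (\<lambda>t. u t + v t) (\<lambda>t. g t + k t)"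
proof -
  have g: "integrable (lebesgue_on {0<..<T}) g" "integrable (lebesgue_on {0<..<T}) k"
    and u: "\<And>t. t \<in> {0..T} \<Longrightarrow> u t = u 0 + integral\<^sup>L (lebesgue_on {0<..<t}) g"
      "\<And>t. t \<in> {0..T} \<Longrightarrow> v t = v 0 + integral\<^sup>L (lebesgue_on {0<..<t}) k"
    using assms unfolding has_time_derivative_def by blast+
  have sum: "integral\<^sup>L (lebesgue_on {0<..<t}) (\<lambda>t. g t + k t)
      = integral\<^sup>L (lebesgue_on {0<..<t}) g + integral\<^sup>L (lebesgue_on {0<..<t}) k" if "t \<in> {0..T}" for t
    using integrable_Ioo_subset[OF g(1)] integrable_Ioo_subset[OF g(2)] that
    by (intro Bochner_Integration.integral_add) auto
  have "u t + v t = u 0 + v 0 + integral\<^sup>L (lebesgue_on {0<..<t}) (\<lambda>t. g t + k t)" if "t \<in> {0..T}" for t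
    by (subst u(1)[OF that], subst u(2)[OF that]) (simp add: sum[OF that])
  then show ?thesis unfolding has_time_derivative_def
    using Bochner_Integration.integrable_add[OF g] by blast
qed

lemma integrable_Ioo_bounded:
  fixes g :: "real \<Rightarrow> 'b::{banach, second_countable_topology}"
  assumes "g \<in> borel_measurable (lebesgue_on {a<..<b})" "AE t in lebesgue_on {a<..<b}. norm (g t) \<le> C"
  shows "integrable (lebesgue_on {a<..<b}) g"
proof -
  interpret finite_measure "lebesgue_on {a<..<b}" by (rule finite_measure_lebesgue_on) simp
  show ?thesis using assms by (intro integrable_const_bound)
qed

lemma borel_measurable_lebesgue_onI:
  "f \<in> borel_measurable borel \<Longrightarrow> f \<in> borel_measurable (lebesgue_on S)"
  by (intro measurable_restrict_space1 measurable_completion) simp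

lemma integral_le_linear:
  fixes g :: "real \<Rightarrow> real"
  assumes "s \<le> t" "integrable (lebesgue_on {s<..<t}) g" "integrable (lebesgue_on {s<..<t}) f"
    and "AE r in lebesgue_on {s<..<t}. g r \<le> b + e * f r"
  shows "integral\<^sup>L (lebesgue_on {s<..<t}) g \<le> b * (t - s) + e * integral\<^sup>L (lebesgue_on {s<..<t}) f"
proof -
  interpret finite_measure "lebesgue_on {s<..<t}" by (rule finite_measure_lebesgue_on) simp
  have "integral\<^sup>L (lebesgue_on {s<..<t}) g \<le> integral\<^sup>L (lebesgue_on {s<..<t}) (\<lambda>r. b + e * f r)"
    using assms by (intro integral_mono_AE) auto
  also have "\<dots> = b * (t - s) + e * integral\<^sup>L (lebesgue_on {s<..<t}) f"
    using assms by (simp add: measure_restrict_space)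
  finally show ?thesis .
qed

text \<open>Energies are estimated through linear functionals of increments, which avoids a product
  rule for functions differentiable almost everywhere. The term with \<open>e\<close> leaves room
  for freezing a time dependent functional at one time.\<close>

lemma functional_increment:
  fixes l :: "'b::{banach, second_countable_topology} \<Rightarrow> real"
  assumes l: "bounded_linear l" and u: "has_time_derivative T u g" and st: "0 \<le> s" "s \<le> t" "t \<le> T"
    and ae: "AE r in lebesgue_on {0<..<T}. s < r \<and> r < t \<longrightarrow> l (g r) \<le> b + e * norm (g r)"
  shows "l (u t - u s) \<le> b * (t - s)
     + e * (integral\<^sup>L (lebesgue_on {0<..<t}) (\<lambda>r. norm (g r)) - integral\<^sup>L (lebesgue_on {0<..<s}) (\<lambda>r. norm (g r)))"
proof -
  have g: "integrable (lebesgue_on {0<..<T}) g" using u unfolding has_time_derivative_def by blast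
  note inc = time_derivative_increment[OF u st]
  have "l (u t - u s) = integral\<^sup>L (lebesgue_on {s<..<t}) (\<lambda>r. l (g r))"
    unfolding inc(2) by (rule integral_bounded_linear[OF l inc(1), symmetric])
  also have "\<dots> \<le> b * (t - s) + e * integral\<^sup>L (lebesgue_on {s<..<t}) (\<lambda>r. norm (g r))"
  proof (rule integral_le_linear[OF st(2)])
    show "AE r in lebesgue_on {s<..<t}. l (g r) \<le> b + e * norm (g r)"
      using ae st by (auto simp: AE_restrict_space_iff elim!: eventually_mono)
  qed (use inc(1) integrable_bounded_linear[OF l inc(1)] in auto)
  also have "integral\<^sup>L (lebesgue_on {s<..<t}) (\<lambda>r. norm (g r))
      = integral\<^sup>L (lebesgue_on {0<..<t}) (\<lambda>r. norm (g r)) - integral\<^sup>L (lebesgue_on {0<..<s}) (\<lambda>r. norm (g r))"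
    using integral_Ioo_diff[OF integrable_norm[OF g] st] by simp
  finally show ?thesis .
qed

text \<open>The integrals vanish over half lines, an intersection-stable generator of the Borel
  sets, hence over all Borel sets, and then over Lebesgue sets, which differ from Borel sets by null
  sets.\<close>

lemma AE_zero_if_integrals_zero:
  fixes g :: "real \<Rightarrow> 'b::{banach, second_countable_topology}"
  assumes g: "integrable (lebesgue_on {0<..<T}) g"
    and zero: "\<And>t. t \<in> {0..T} \<Longrightarrow> integral\<^sup>L (lebesgue_on {0<..<t}) g = 0" and T: "0 \<le> T"
  shows "AE t in lebesgue_on {0<..<T}. g t = 0"
proof -
  define f where "f x = indicator {0<..<T} x *\<^sub>R g x" for x
  have f: "integrable lebesgue f" using g unfolding integrable_Ioo f_def .
  have fA: "integrable lebesgue (\<lambda>x. indicator A x *\<^sub>R f x)" if "A \<in> sets lebesgue" for A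
    using that f by (rule integrable_mult_indicator)
  have leb: "A \<in> sets lebesgue" if "A \<in> sigma_sets UNIV (range lessThan)" for A :: "real set"
  proof -
    have "A \<in> sets borel" using that unfolding borel_Iio by simp
    then show ?thesis by simp
  qed
  have bor: "(LINT x:A|lebesgue. f x) = 0" if "A \<in> sets borel" for A
  proof -
    have A: "A \<in> sigma_sets UNIV (range lessThan)" using that unfolding borel_Iio by simp
    have stable: "Int_stable (range lessThan :: real set set)"
    proof (rule Int_stableI)
      fix A B :: "real set" assume "A \<in> range lessThan" "B \<in> range lessThan"
      then obtain x y where "A = {..<x}" "B = {..<y}" by blast
      then have "A \<inter> B = {..<min x y}" by auto
      then show "A \<inter> B \<in> range lessThan" by blast
    qed
    have "range lessThan \<subseteq> Pow (UNIV :: real set)" by simp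
    from stable this A show ?thesis
    proof (induction rule: sigma_sets_induct_disjoint)
      case (basic A)
      then obtain t where A: "A = {..<t}" by blast
      \<comment> \<open>Since \<open>f\<close> vanishes outside (0,T), clamping reduces an arbitrary
        half line to one of the given intervals.\<close>
      let ?t = "max 0 (min t T)"
      have "(LINT x:A|lebesgue. f x) = integral\<^sup>L (lebesgue_on {0<..<?t}) g"
        unfolding set_lebesgue_integral_def integral_Ioo A f_def
        by (intro Bochner_Integration.integral_cong) (auto simp: indicator_def)
      also have "\<dots> = 0" using T by (intro zero) auto
      finally show ?case .
    next
      case (compl A)
      have A: "A \<in> sets lebesgue" using leb compl(1) .
      have "(LINT x:UNIV|lebesgue. f x) = 0"
        using zero[of T] T unfolding set_lebesgue_integral_def integral_Ioo f_def by simp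
      moreover have "(LINT x:UNIV|lebesgue. f x) = (LINT x:A|lebesgue. f x) + (LINT x:UNIV - A|lebesgue. f x)"
      proof -
        have "(LINT x:A \<union> (UNIV - A)|lebesgue. f x) = (LINT x:A|lebesgue. f x) + (LINT x:UNIV - A|lebesgue. f x)"
          using fA[OF A] fA[of "UNIV - A"] sets.compl_sets[OF A]
          by (intro set_integral_Un) (auto simp: set_integrable_def)
        then show ?thesis by simp
      qed
      ultimately show ?case using compl by simp
    next
      case (union A)
      have "(LINT x:(\<Union>i. A i)|lebesgue. f x) = (\<Sum>i. (LINT x:(A i)|lebesgue. f x))"
      proof (rule lebesgue_integral_countable_add)
        show Ai: "A i \<in> sets lebesgue" for i
          using union(2) by (intro leb) auto
        show "A i \<inter> A j = {}" if "i \<noteq> j" for i j using union(1) that by (auto simp: disjoint_family_on_def)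
        show "set_integrable lebesgue (\<Union> (range A)) f" using Ai fA by (auto simp: set_integrable_def)
      qed
      then show ?case using union(3) by simp
    qed (simp add: set_lebesgue_integral_def)
  qed
  have leb0: "(LINT x:A|lebesgue. f x) = 0" if sA: "A \<in> sets lebesgue" for A
  proof -
    obtain S N N' where A: "A = S \<union> N" "N \<subseteq> N'" "N' \<in> null_sets lborel" "S \<in> sets lborel"
      using sets_completionE[OF sA] by metis
    have "AE x in lebesgue. x \<notin> N'" using A(3) by (intro AE_not_in null_sets_completionI)
    then have "AE x in lebesgue. indicator A x *\<^sub>R f x = indicator S x *\<^sub>R f x"
      by eventually_elim (use A in \<open>auto simp: indicator_def\<close>)
    then have "(LINT x:A|lebesgue. f x) = (LINT x:S|lebesgue. f x)"
      unfolding set_lebesgue_integral_def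
      by (rule integral_cong_AE[rotated 2]) (use fA that A(4) in \<open>auto intro: borel_measurable_integrable\<close>)
    then show ?thesis using bor A(4) by simp
  qed
  interpret finite_measure "lebesgue_on {0<..<T}" by (rule finite_measure_lebesgue_on) simp
  show ?thesis
  proof (rule density_zero[OF g])
    fix A assume "A \<in> sets (lebesgue_on {0<..<T})"
    then have A: "A \<in> sets lebesgue" "A \<subseteq> {0<..<T}" by (auto simp: sets_restrict_space_iff)
    have "(LINT x:A|lebesgue_on {0<..<T}. g x) = (LINT x:A|lebesgue. f x)"
      unfolding set_lebesgue_integral_def integral_Ioo f_def
      by (intro Bochner_Integration.integral_cong) (auto simp: indicator_def)
    then show "(LINT x:A|lebesgue_on {0<..<T}. g x) = 0" using leb0[OF A(1)] by simp
  qed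
qed

text \<open>Used to match the derivative of \<phi> in V with its derivative in H, which the notion
  of solution introduces independently of each other.\<close>

lemma time_derivative_unique:
  assumes "has_time_derivative T u g" "has_time_derivative T u k" "0 \<le> T"
  shows "AE t in lebesgue_on {0<..<T}. g t = k t"
proof -
  have i: "integrable (lebesgue_on {0<..<t}) g" "integrable (lebesgue_on {0<..<t}) k"
     "integral\<^sup>L (lebesgue_on {0<..<t}) g = integral\<^sup>L (lebesgue_on {0<..<t}) k" if "t \<in> {0..T}" for t
    using time_derivative_increment[OF assms(1), of 0 t] time_derivative_increment[OF assms(2), of 0 t] that by auto
  have "AE t in lebesgue_on {0<..<T}. g t - k t = 0"
  proof (rule AE_zero_if_integrals_zero)
    show "integrable (lebesgue_on {0<..<T}) (\<lambda>t. g t - k t)" using i[of T] assms by auto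
    show "integral\<^sup>L (lebesgue_on {0<..<t}) (\<lambda>t. g t - k t) = 0" if "t \<in> {0..T}" for t
      using i[OF that] by simp
  qed fact
  then show ?thesis by simp
qed

text \<open>Completeness of Lebesgue measure: every subset of the exceptional null set is
  measurable.\<close>

lemma borel_measurable_lebesgue_on_AE:
  fixes f g :: "real \<Rightarrow> 'b::topological_space"
  assumes f: "f \<in> borel_measurable (lebesgue_on S)" and ae: "AE x in lebesgue_on S. f x = g x"
    and S: "S \<in> sets lebesgue"
  shows "g \<in> borel_measurable (lebesgue_on S)"
proof -
  obtain N where N: "N \<in> null_sets (lebesgue_on S)" "{x \<in> S. f x \<noteq> g x} \<subseteq> N"
    using ae by (auto elim!: AE_E simp: null_sets_def)
  have NS: "N \<subseteq> S" "N \<in> null_sets lebesgue" using N(1) S by (auto simp: null_sets_restrict_space)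
  have sub: "X \<in> sets (lebesgue_on S)" if "X \<subseteq> N" for X
    using null_sets_completion_subset[OF that NS(2)] that NS(1) S by (auto simp: sets_restrict_space_iff)
  show ?thesis
  proof (rule measurableI)
    fix B :: "'b set" assume B: "B \<in> sets borel"
    have "g -` B \<inter> S = ((f -` B \<inter> S) - N) \<union> (g -` B \<inter> N)" using N(2) NS(1) by auto
    moreover have "f -` B \<inter> S \<in> sets (lebesgue_on S)" using measurable_sets[OF f B] by simp
    ultimately show "g -` B \<inter> space (lebesgue_on S) \<in> sets (lebesgue_on S)"
      using sub[of "g -` B \<inter> N"] N(1) by auto
  qed simp
qed

text \<open>Vector-valued identities are reduced to this scalar case by inner products with a fixed
  vector.\<close>

lemma continuous_derivative_integral:
  fixes f :: "real \<Rightarrow> real"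
  assumes "a \<le> b" "\<And>x. x \<in> {a..b} \<Longrightarrow> (f has_vector_derivative f' x) (at x within {a..b})" "continuous_on {a..b} f'"
  shows "integral\<^sup>L (lebesgue_on {a<..<b}) f' = f b - f a"
proof -
  have "integrable (lebesgue_on {a..b}) f'" using assms(3) by (rule continuous_imp_integrable_real)
  then have "integrable lebesgue (\<lambda>x. indicator {a<..<b} x *\<^sub>R (indicator {a..b} x *\<^sub>R f' x))"
    by (intro integrable_mult_indicator[of "{a<..<b}"]) (simp_all add: integrable_restrict_space)
  also have "(\<lambda>x. indicator {a<..<b} x *\<^sub>R (indicator {a..b} x *\<^sub>R f' x)) = (\<lambda>x. indicator {a<..<b} x *\<^sub>R f' x)"
    by (auto simp: indicator_def)
  finally have "integrable (lebesgue_on {a<..<b}) f'" by (simp only: integrable_Ioo)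
  then have "(f' has_integral integral\<^sup>L (lebesgue_on {a<..<b}) f') {a..b}"
    unfolding has_integral_Icc_iff_Ioo by (rule has_integral_integral_lebesgue_on) simp
  moreover have "(f' has_integral (f b - f a)) {a..b}" using assms by (intro fundamental_theorem_of_calculus)
  ultimately show ?thesis by (rule has_integral_unique)
qed

section \<open>The limit solves the evolution equation\<close>

context evolution
begin

lemma F_continuous: "continuous_on UNIV F"
proof -
  obtain L where L: "L > 0" "\<And>x. N x \<le> L * norm x" using N_le_norm by blast
  have "(K * L / sqrt c)-lipschitz_on UNIV F"
  proof (rule lipschitz_onI)
    fix x y
    have "norm (F x - F y) \<le> N (F x - F y) / sqrt c" by (rule norm_le_N)
    also have "\<dots> \<le> K * (L * norm (x - y)) / sqrt c"
      using F_lip[of x y] L(2)[of "x - y"] K c by (intro divide_right_mono) (auto intro: order_trans mult_left_mono)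
    finally show "dist (F x) (F y) \<le> K * L / sqrt c * dist x y" by (simp add: dist_norm)
  qed (use K L c in simp)
  then show ?thesis by (rule lipschitz_on_continuous_on)
qed

text \<open>\<open>A\<close> need not be continuous along \<open>U\<close>, but it is the pointwise
  limit of the continuous Yosida approximations.\<close>

lemma AU_measurable: "(\<lambda>t. A (U t)) \<in> borel_measurable borel"
proof (rule borel_measurable_LIMSEQ_metric[where f = "\<lambda>n t. Y (1 / real (Suc n)) (U t)"])
  show "(\<lambda>t. Y (1 / real (Suc n)) (U t)) \<in> borel_measurable borel" for n
    by (intro borel_measurable_continuous_onI bounded_linear.continuous_on[OF Y_bounded_linear] U_continuous) simp
qed (use yosida_tendsto U_props in blast)

text \<open>An everywhere defined representative of the derivative, which makes boundedness and
  Borel measurability statements for all times.\<close>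

definition dU :: "real \<Rightarrow> 'a" where "dU t = F (U t) - A (U t)"

lemma dU_measurable: "dU \<in> borel_measurable borel"
  unfolding dU_def[abs_def]
  by (intro borel_measurable_diff AU_measurable borel_measurable_continuous_onI continuous_on_compose2[OF F_continuous U_continuous]) auto

lemma dU_bounded: obtains R where "\<And>t. norm (dU t) \<le> R"
proof -
  have "norm (dU t) \<le> (N (F U0) + K * (M * T) + M1) / sqrt c" for t
  proof -
    have "N (U t - U0) \<le> M * T"
    proof -
      have "N (U t - U0) \<le> M * \<bar>max 0 (min T t) - 0\<bar>" using U_lip[of "max 0 (min T t)" 0] U_clamp[of t] by (simp add: U_zero)
      also have "\<dots> \<le> M * T" using M_nonneg T by (intro mult_left_mono) auto
      finally show ?thesis .
    qed
    then have "K * N (U t - U0) \<le> K * (M * T)" using K by (rule mult_left_mono)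
    then have "N (F (U t)) \<le> N (F U0) + K * (M * T)"
      using N_triangle_sub[of "F (U t)" "F U0"] F_lip[of "U t" U0] by linarith
    moreover have "N (dU t) \<le> N (F (U t)) + N (A (U t))"
      unfolding dU_def using N_triangle[of "F (U t)" "- A (U t)"] N_scale[of "-1" "A (U t)"] by simp
    ultimately have "N (dU t) \<le> N (F U0) + K * (M * T) + M1" using U_props(2)[of t] by linarith
    then show ?thesis using norm_le_N[of "dU t"] c by (meson divide_right_mono order_trans real_sqrt_ge_zero less_imp_le)
  qed
  then show thesis using that by blast
qed

lemma G_continuous: "continuous_on UNIV G"
  unfolding G_def[abs_def]
  by (intro continuous_intros bounded_linear.continuous_on[OF J_bounded_linear] bounded_linear.continuous_on[OF Y_bounded_linear] F_continuous) auto

theorem U_derivative: "has_time_derivative T U dU"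
proof -
  obtain R where R: "\<And>t. norm (dU t) \<le> R" using dU_bounded by blast
  have int: "integrable (lebesgue_on {0<..<t}) dU" for t
    using R dU_measurable
    by (intro integrable_Ioo_bounded[of _ _ _ R] borel_measurable_lebesgue_onI) auto
  have JdU: "J 1 (dU t) = G (U t)" for t
    using linear_diff[OF J_linear[of 1]] J_commute[OF _ U_props(1)] by (simp add: dU_def G_def)
  have "U t = U 0 + integral\<^sup>L (lebesgue_on {0<..<t}) dU" if t: "t \<in> {0..T}" for t
  proof -
    let ?I = "integral\<^sup>L (lebesgue_on {0<..<t}) dU"
    \<comment> \<open>Tested with a vector, the identity is the fundamental theorem for the
      continuously differentiable \<open>J 1 (U t)\<close>; injectivity of \<open>J 1\<close> then
      removes the resolvent.\<close>
    have "J 1 ?I \<bullet> z = (J 1 (U t) - J 1 (U 0)) \<bullet> z" for z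
    proof -
      have bl: "bounded_linear (\<lambda>x. J 1 x \<bullet> z)"
        by (rule bounded_linear_compose[OF bounded_linear_inner_left J_bounded_linear]) simp
      have "J 1 ?I \<bullet> z = integral\<^sup>L (lebesgue_on {0<..<t}) (\<lambda>s. G (U s) \<bullet> z)"
        using integral_bounded_linear[OF bl int[of t]] by (simp add: JdU)
      also have "\<dots> = J 1 (U t) \<bullet> z - J 1 (U 0) \<bullet> z"
      proof (rule continuous_derivative_integral)
        show "((\<lambda>s. J 1 (U s) \<bullet> z) has_vector_derivative G (U x) \<bullet> z) (at x within {0..t})" if "x \<in> {0..t}" for x
          using JU_derivative[of x] that t
          by (intro bounded_linear.has_vector_derivative[OF bounded_linear_inner_left])
             (auto intro: has_vector_derivative_within_subset)
        show "continuous_on {0..t} (\<lambda>s. G (U s) \<bullet> z)"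
          by (intro continuous_intros continuous_on_compose2[OF G_continuous continuous_on_subset[OF U_continuous]]) auto
      qed (use t in simp)
      finally show ?thesis by (simp add: inner_diff_left)
    qed
    then have "J 1 ?I = J 1 (U t) - J 1 (U 0)" using vector_eq_rdot by blast
    also have "\<dots> = J 1 (U t - U 0)" using linear_diff[OF J_linear[of 1]] by simp
    finally have "?I = U t - U 0" by (rule J_inj[rotated]) simp
    then show ?thesis by simp
  qed
  then show ?thesis unfolding has_time_derivative_def using int by blast
qed

end

text \<open>Increments of \<open>u\<close> are dominated by those of the indefinite integral of the
  norm of \<open>g\<close>, which is continuous.\<close>

lemma time_derivative_continuous:
  assumes "has_time_derivative T u g"
  shows "continuous_on {0..T} u"
proof -
  define \<Gamma> where "\<Gamma> t = integral\<^sup>L (lebesgue_on {0<..<t}) (\<lambda>r. norm (g r))" for t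
  have g: "integrable (lebesgue_on {0<..<T}) g" using assms unfolding has_time_derivative_def by blast
  have n: "norm (u t - u s) \<le> \<bar>\<Gamma> t - \<Gamma> s\<bar>" if "0 \<le> s" "s \<le> t" "t \<le> T" for s t
  proof -
    have "norm (u t - u s) \<le> integral\<^sup>L (lebesgue_on {s<..<t}) (\<lambda>r. norm (g r))"
      unfolding time_derivative_increment(2)[OF assms that] by (rule integral_norm_bound)
    also have "\<dots> = \<Gamma> t - \<Gamma> s"
      unfolding \<Gamma>_def using integral_Ioo_diff[OF integrable_norm[OF g] that] by simp
    finally show ?thesis by simp
  qed
  have le: "norm (u t - u s) \<le> \<bar>\<Gamma> t - \<Gamma> s\<bar>" if "s \<in> {0..T}" "t \<in> {0..T}" for s t
    using n[of s t] n[of t s] that by (cases "s \<le> t") (auto simp: norm_minus_commute abs_minus_commute)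
  have "continuous_on {0..T} \<Gamma>"
  proof -
    have hk: "((\<lambda>r. norm (g r)) has_integral \<Gamma> t) {0..t}" if "t \<in> {0..T}" for t
      unfolding \<Gamma>_def has_integral_Icc_iff_Ioo
      by (rule has_integral_integral_lebesgue_on) (use integrable_norm[OF integrable_Ioo_subset[OF g]] that in auto)
    have "continuous_on {0..T} (\<lambda>t. integral {0..t} (\<lambda>r. norm (g r)))"
    proof (cases "0 \<le> T")
      case True
      then show ?thesis using hk[of T] by (intro indefinite_integral_continuous_1) (auto simp: integrable_on_def)
    qed simp
    then show ?thesis by (rule continuous_on_eq) (use hk in \<open>auto intro: integral_unique\<close>)
  qed
  then show ?thesis
    unfolding continuous_on_iff dist_norm real_norm_def using le by (meson le_less_trans)
qed

section \<open>Gronwall estimates from one-sided increments\<close>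

lemma one_le_exp_mult:
  fixes x :: real assumes "0 \<le> x" "x \<le> 1/2" shows "1 \<le> exp (2 * x) * (1 - x)"
proof -
  have "1 \<le> (1 + 2 * x) * (1 - x)" using assms mult_left_mono[of x "1/2" x] by (simp add: algebra_simps)
  also have "\<dots> \<le> exp (2 * x) * (1 - x)" using assms exp_ge_add_one_self[of "2 * x"] by (intro mult_right_mono) auto
  finally show ?thesis .
qed

text \<open>The increment is controlled by \<open>y\<close> at the later time, so each step divides
  by \<open>1 - C * \<kappa>\<close>; for \<open>C * \<kappa> \<le> 1/2\<close> this costs at most
  the factor \<open>exp (2 * (C * \<kappa>))\<close>, the origin of the 2 in the exponent. The
  errors in \<open>G\<close> telescope.\<close>

lemma discrete_gronwall:
  fixes y G :: "real \<Rightarrow> real"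
  assumes \<tau>: "0 \<le> \<tau>" and C: "0 \<le> C" and e: "0 \<le> e" and \<delta>: "\<delta> > 0"
    and y0: "\<And>t. \<lbrakk>0 \<le> t; t \<le> \<tau>\<rbrakk> \<Longrightarrow> 0 \<le> y t"
    and G: "\<And>s t. \<lbrakk>0 \<le> s; s \<le> t; t \<le> \<tau>\<rbrakk> \<Longrightarrow> G s \<le> G t"
    and inc: "\<And>s t. \<lbrakk>0 \<le> s; s \<le> t; t \<le> \<tau>; t - s < \<delta>\<rbrakk> \<Longrightarrow> y t - y s \<le> C * (t - s) * y t + e * (G t - G s)"
  shows "y \<tau> \<le> exp (2 * C * \<tau>) * (y 0 + e * (G \<tau> - G 0))"
proof -
  \<comment> \<open>Large enough for \<open>\<kappa> < \<delta>\<close> and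
    \<open>C * \<kappa> \<le> 1/2\<close>; the summand 1 keeps \<open>n\<close> positive.\<close>
  obtain n :: nat where n: "\<tau> / \<delta> + 2 * C * \<tau> + 1 < real n" using reals_Archimedean2 by blast
  define \<kappa> where "\<kappa> = \<tau> / real n"
  have pos: "0 \<le> \<tau> / \<delta>" "0 \<le> 2 * C * \<tau>" using \<tau> \<delta> C by auto
  then have n0: "0 < real n" using n by linarith
  have \<kappa>: "0 \<le> \<kappa>" using \<tau> n0 by (simp add: \<kappa>_def)
  have "\<tau> / \<delta> < real n" using n pos by linarith
  then have \<kappa>\<delta>: "\<kappa> < \<delta>" using n0 \<delta> by (simp add: \<kappa>_def divide_simps mult.commute)
  have "2 * C * \<tau> \<le> real n" using n pos by linarith
  then have \<kappa>C: "C * \<kappa> \<le> 1/2" using n0 by (simp add: \<kappa>_def divide_simps mult_ac)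
  have nk: "real n * \<kappa> = \<tau>" using n0 by (simp add: \<kappa>_def)
  have "y (real j * \<kappa>) \<le> exp (2 * (C * \<kappa>)) ^ j * (y 0 + e * (G (real j * \<kappa>) - G 0))" if "j \<le> n" for j
    using that
  proof (induction j)
    case (Suc j)
    let ?E = "exp (2 * (C * \<kappa>))"
    define s t where "s = real j * \<kappa>" and "t = real (Suc j) * \<kappa>"
    have "real (Suc j) * \<kappa> \<le> real n * \<kappa>" using Suc(2) \<kappa> by (intro mult_right_mono) auto
    then have st: "0 \<le> s" "s \<le> t" "t \<le> \<tau>" "t - s = \<kappa>"
      using \<kappa> nk by (auto simp: s_def t_def algebra_simps)
    have "y t - y s \<le> C * \<kappa> * y t + e * (G t - G s)" using inc[of s t] st \<kappa>\<delta> by simp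
    then have 1: "(1 - C * \<kappa>) * y t \<le> y s + e * (G t - G s)" by (simp add: algebra_simps)
    have E1: "1 \<le> ?E ^ j" using C \<kappa> by (intro one_le_power) simp
    have "y s + e * (G t - G s) \<le> ?E ^ j * (y 0 + e * (G s - G 0)) + ?E ^ j * (e * (G t - G s))"
      using Suc E1 G[OF st(1-3)] e mult_right_mono[OF E1, of "e * (G t - G s)"] by (simp add: s_def)
    also have "\<dots> = ?E ^ j * (y 0 + e * (G t - G 0))" by (simp add: algebra_simps)
    finally have 2: "(1 - C * \<kappa>) * y t \<le> ?E ^ j * (y 0 + e * (G t - G 0))" using 1 by linarith
    have E: "1 \<le> ?E * (1 - C * \<kappa>)" using one_le_exp_mult[of "C * \<kappa>"] \<kappa>C C \<kappa> by simp
    have "y t \<le> ?E * (1 - C * \<kappa>) * y t" using mult_right_mono[OF E y0[of t]] st by simp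
    also have "\<dots> \<le> ?E * (?E ^ j * (y 0 + e * (G t - G 0)))" using 2 by (simp add: mult.assoc)
    finally show ?case unfolding t_def[symmetric] by (simp add: mult_ac)
  qed simp
  from this[of n] have "y \<tau> \<le> exp (2 * (C * \<kappa>)) ^ n * (y 0 + e * (G \<tau> - G 0))" by (simp add: nk)
  also have "exp (2 * (C * \<kappa>)) ^ n = exp (2 * C * \<tau>)" by (simp add: exp_of_nat_mult[symmetric] nk[symmetric] mult_ac)
  finally show ?thesis .
qed

text \<open>
  The energy \<open>y\<close> is only assumed to have one-sided increments below those of a linear functional: it
  may contain the convex potential \<open>i\<close>, which is not differentiated.
\<close>

lemma energy_gronwall:
  fixes bil :: "'w::real_normed_vector \<Rightarrow> 'b::{banach, second_countable_topology} \<Rightarrow> real"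
  assumes u: "has_time_derivative T u g" and \<tau>: "0 \<le> \<tau>" "\<tau> \<le> T" and C: "0 \<le> C"
    and bil: "bounded_bilinear bil" and w: "continuous_on {0..\<tau>} w" and y: "continuous_on {0..\<tau>} y"
    and y0: "\<And>t. \<lbrakk>0 \<le> t; t \<le> \<tau>\<rbrakk> \<Longrightarrow> 0 \<le> y t"
    and inc: "\<And>s t. \<lbrakk>0 \<le> s; s \<le> t; t \<le> \<tau>\<rbrakk> \<Longrightarrow> y t - y s \<le> bil (w t) (u t - u s)"
    and ae: "AE r in lebesgue_on {0<..<T}. r < \<tau> \<longrightarrow> bil (w r) (g r) \<le> C * y r"
  shows "y \<tau> \<le> exp (2 * C * \<tau>) * y 0"
proof -
  interpret bil: bounded_bilinear bil by fact
  obtain L where L: "L > 0" "\<And>x z. norm (bil x z) \<le> norm x * norm z * L" using bil.pos_bounded by blast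
  have g: "integrable (lebesgue_on {0<..<T}) g" using u unfolding has_time_derivative_def by blast
  define \<Gamma> where "\<Gamma> t = integral\<^sup>L (lebesgue_on {0<..<t}) (\<lambda>r. norm (g r))" for t
  \<comment> \<open>Collects both errors of freezing at the later time \<open>t\<close>:
    \<open>C * t\<close> from replacing \<open>y r\<close> by \<open>y t + e\<close>, and
    \<open>L * \<Gamma> t\<close> from replacing \<open>w r\<close> by \<open>w t\<close>.\<close>
  define G where "G t = C * t + L * \<Gamma> t" for t
  have G: "G s \<le> G t" if "0 \<le> s" "s \<le> t" "t \<le> \<tau>" for s t
  proof -
    have "\<Gamma> t - \<Gamma> s = integral\<^sup>L (lebesgue_on {s<..<t}) (\<lambda>r. norm (g r))"
      unfolding \<Gamma>_def using that \<tau> by (intro integral_Ioo_diff[OF integrable_norm[OF g]]) auto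
    then have "0 \<le> \<Gamma> t - \<Gamma> s" by simp
    then show ?thesis using L(1) C that by (simp add: G_def add_mono mult_left_mono)
  qed
  have "y \<tau> \<le> exp (2 * C * \<tau>) * (y 0 + e * (G \<tau> - G 0))" if e: "e > 0" for e
  proof -
    have "uniformly_continuous_on {0..\<tau>} w" "uniformly_continuous_on {0..\<tau>} y"
      using w y by (auto intro: compact_uniformly_continuous)
    then obtain d1 d2 where d: "d1 > 0" "\<And>s t. \<lbrakk>s \<in> {0..\<tau>}; t \<in> {0..\<tau>}; dist s t < d1\<rbrakk> \<Longrightarrow> dist (w s) (w t) < e"
       "d2 > 0" "\<And>s t. \<lbrakk>s \<in> {0..\<tau>}; t \<in> {0..\<tau>}; dist s t < d2\<rbrakk> \<Longrightarrow> dist (y s) (y t) < e"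
      using e unfolding uniformly_continuous_on_def by metis
    show ?thesis
    proof (rule discrete_gronwall[OF \<tau>(1) C less_imp_le[OF e], of "min d1 d2"])
      show "0 < min d1 d2" using d by simp
      fix s t assume st: "0 \<le> s" "s \<le> t" "t \<le> \<tau>" "t - s < min d1 d2"
      have "y t - y s \<le> bil (w t) (u t - u s)" using inc st by blast
      also have "\<dots> \<le> C * (y t + e) * (t - s) + e * L * (\<Gamma> t - \<Gamma> s)"
        unfolding \<Gamma>_def
      proof (rule functional_increment[OF bil.bounded_linear_right u])
        show "AE r in lebesgue_on {0<..<T}. s < r \<and> r < t \<longrightarrow> bil (w t) (g r) \<le> C * (y t + e) + e * L * norm (g r)"
          using ae
        proof eventually_elim
          case (elim r)
          show ?case
          proof
            assume r: "s < r \<and> r < t"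
            have "dist (w t) (w r) < e" "dist (y r) (y t) < e" using r st d by (auto simp: dist_real_def)
            then have wy: "norm (w t - w r) \<le> e" "y r \<le> y t + e" by (auto simp: dist_norm)
            have "bil (w t) (g r) = bil (w r) (g r) + bil (w t - w r) (g r)" by (simp add: bil.diff_left)
            also have "bil (w r) (g r) \<le> C * y r" using elim r st by auto
            also have "C * y r \<le> C * (y t + e)" using wy C by (intro mult_left_mono)
            also have "bil (w t - w r) (g r) \<le> norm (w t - w r) * norm (g r) * L" using L(2)[of "w t - w r" "g r"] by simp
            also have "\<dots> \<le> e * norm (g r) * L" using wy L by (intro mult_right_mono) auto
            finally show "bil (w t) (g r) \<le> C * (y t + e) + e * L * norm (g r)" by (simp add: mult_ac)
          qed
        qed
      qed (use st \<tau> in auto)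
      finally show "y t - y s \<le> C * (t - s) * y t + e * (G t - G s)" by (simp add: G_def algebra_simps)
    qed (use y0 G in auto)
  qed
  note bound = this
  show ?thesis
  proof (rule field_le_epsilon)
    fix \<epsilon> :: real assume \<epsilon>: "0 < \<epsilon>"
    define P where "P = exp (2 * C * \<tau>) * (G \<tau> - G 0)"
    have P: "0 \<le> P" using G[of 0 \<tau>] \<tau> by (simp add: P_def)
    have "y \<tau> \<le> exp (2 * C * \<tau>) * y 0 + (\<epsilon> / (P + 1)) * P"
    proof -
      have "0 < \<epsilon> / (P + 1)" using \<epsilon> P by simp
      from bound[OF this] show ?thesis by (simp only: P_def distrib_left mult.left_commute)
    qed
    also have "(\<epsilon> / (P + 1)) * P \<le> \<epsilon>" using \<epsilon> P by (simp add: divide_simps)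
    finally show "y \<tau> \<le> exp (2 * C * \<tau>) * y 0 + \<epsilon>" by simp
  qed
qed

section \<open>Selfadjoint operators and Yosida approximations along functions of time\<close>

lemma accretive_operator_selfadjoint:
  fixes A :: "'a::{real_inner, banach} \<Rightarrow> 'a"
  assumes lin: "linear_operator D A" and mm: "maximal_monotone D A" and sa: "selfadjoint_operator D A"
  shows "accretive_operator (\<bullet>) 1 D A"
proof -
  have D: "subspace D" and Asc: "\<And>r x. x \<in> D \<Longrightarrow> A (r *\<^sub>R x) = r *\<^sub>R A x" using lin by (auto simp: linear_operator_def)
  have A0: "A 0 = 0" using Asc[OF subspace_0[OF D], of 0] by simp
  have mono: "0 \<le> A x \<bullet> x" if "x \<in> D" for x
  proof -
    have "monotone_graph (op_graph D A)" using mm by (simp add: maximal_monotone_def)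
    moreover have "(x, A x) \<in> op_graph D A" "(0, A 0) \<in> op_graph D A"
      using that subspace_0[OF D] by (auto simp: op_graph_def)
    ultimately have "0 \<le> (A x - A 0) \<bullet> (x - 0)" unfolding monotone_graph_def by blast
    then show ?thesis using A0 by simp
  qed
  have range: "\<exists>x\<in>D. x + lam *\<^sub>R A x = y" if "0 < lam" for lam y
    using selfadjoint_range[OF lin sa mono that] by metis
  show ?thesis
    by (rule accretive_operator.intro)
      (use range lin mono in
        \<open>auto simp: inner_commute power2_norm_eq_inner bounded_bilinear_inner\<close>)
qed

text \<open>Carries bounds that hold inside each grid interval, such as those of the Euler scheme,
  over to an integral in time.\<close>

lemma integral_le_sum:
  fixes f :: "real \<Rightarrow> real"
  assumes h: "h > 0" and f: "integrable (lebesgue_on {0<..<real n * h}) f"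
    and b: "\<And>j t. \<lbrakk>j < n; real j * h < t; t < real (Suc j) * h\<rbrakk> \<Longrightarrow> f t \<le> b j"
  shows "integral\<^sup>L (lebesgue_on {0<..<real n * h}) f \<le> h * (\<Sum>j<n. b j)"
proof -
  have "integral\<^sup>L (lebesgue_on {0<..<real m * h}) f \<le> h * (\<Sum>j<m. b j)" if "m \<le> n" for m
    using that
  proof (induction m)
    case (Suc m)
    let ?s = "real m * h" and ?t = "real (Suc m) * h"
    have st: "0 \<le> ?s" "?s \<le> ?t" "?t \<le> real n * h" using h Suc(2) by (auto intro: mult_right_mono)
    have "integral\<^sup>L (lebesgue_on {?s<..<?t}) f \<le> b m * (?t - ?s) + 0 * integral\<^sup>L (lebesgue_on {?s<..<?t}) f"
    proof (rule integral_le_linear[OF st(2)])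
      show "AE r in lebesgue_on {?s<..<?t}. f r \<le> b m + 0 * f r"
        using b[of m] Suc(2) by (intro AE_I2) auto
    qed (use integrable_Ioo_subset[OF f st(1,3)] in auto)
    then have "integral\<^sup>L (lebesgue_on {?s<..<?t}) f \<le> h * b m" by (simp add: algebra_simps)
    then show ?case using integral_Ioo_diff[OF f st] Suc by (simp add: algebra_simps)
  qed simp
  then show ?thesis by simp
qed

locale accretive_operator_sc = accretive_operator Q c D A
  for Q :: "'a::{real_inner, banach, second_countable_topology} \<Rightarrow> 'a \<Rightarrow> real" and c D A
begin

lemma Y_continuous: "0 < lam \<Longrightarrow> continuous_on S x \<Longrightarrow> continuous_on S (\<lambda>t. Y lam (x t))"
  by (rule bounded_linear.continuous_on[OF Y_bounded_linear])

text \<open>On \<open>D\<close> the operator is the limit of its Yosida approximations, which are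
  continuous along \<open>x\<close>; on the exceptional null set \<open>lim\<close> may take any
  value.\<close>

lemma measurable_operator:
  fixes x :: "real \<Rightarrow> 'a"
  assumes x: "continuous_on UNIV x" and ae: "AE t in lebesgue_on S. x t \<in> D" and S: "S \<in> sets lebesgue"
  shows "(\<lambda>t. A (x t)) \<in> borel_measurable (lebesgue_on S)"
proof (rule borel_measurable_lebesgue_on_AE)
  show "(\<lambda>t. lim (\<lambda>n. Y (1 / real (Suc n)) (x t))) \<in> borel_measurable (lebesgue_on S)"
    by (intro borel_measurable_lim_metric borel_measurable_lebesgue_onI borel_measurable_continuous_onI Y_continuous x) simp
  show "AE t in lebesgue_on S. lim (\<lambda>n. Y (1 / real (Suc n)) (x t)) = A (x t)"
    using ae by eventually_elim (intro limI yosida_tendsto)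
qed (rule S)

text \<open>The squared norms of the Yosida approximations increase in \<open>n\<close>, so monotone
  convergence applies; where their supremum is finite, \<open>yosida_limit\<close> puts
  \<open>x t\<close> into \<open>D\<close>.\<close>

lemma yosida_fatou:
  fixes x :: "real \<Rightarrow> 'a"
  assumes x: "continuous_on UNIV x"
    and C: "\<And>n. integrable (lebesgue_on {0<..<T}) (\<lambda>t. (N (Y (1 / real (Suc n)) (x t)))\<^sup>2)"
      "\<And>n. integral\<^sup>L (lebesgue_on {0<..<T}) (\<lambda>t. (N (Y (1 / real (Suc n)) (x t)))\<^sup>2) \<le> C"
  shows "AE t in lebesgue_on {0<..<T}. x t \<in> D"
    "(\<lambda>t. A (x t)) \<in> borel_measurable (lebesgue_on {0<..<T})"
    "integrable (lebesgue_on {0<..<T}) (\<lambda>t. (norm (A (x t)))\<^sup>2)"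
proof -
  let ?M = "lebesgue_on {0<..<T}"
  define f where "f n t = (N (Y (1 / real (Suc n)) (x t)))\<^sup>2" for n t
  have fi: "integrable ?M (f n)" "integral\<^sup>L ?M (f n) \<le> C" for n using C[of n] by (auto simp: f_def[abs_def])
  have f0: "0 \<le> f n t" for n t by (simp add: f_def)
  have inc: "f n t \<le> f m t" if "n \<le> m" for n m t
  proof (cases "n = m")
    case False
    then have "(N (Y (1 / real (Suc m)) (x t) - Y (1 / real (Suc n)) (x t)))\<^sup>2 \<le> f m t - f n t"
      unfolding f_def using that by (intro Y_monotone_in_lam) (auto simp: divide_simps)
    then show ?thesis by (meson diff_ge_0_iff_ge order_trans zero_le_power2)
  qed simp
  have nn: "(\<integral>\<^sup>+t. ennreal (f n t) \<partial>?M) \<le> ennreal C" for n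
    using fi f0 by (subst nn_integral_eq_integral) (auto intro: ennreal_leI)
  have "(\<integral>\<^sup>+t. (SUP n. ennreal (f n t)) \<partial>?M) = (SUP n. \<integral>\<^sup>+t. ennreal (f n t) \<partial>?M)"
    using fi inc by (intro nn_integral_monotone_convergence_SUP)
      (auto intro!: incseq_SucI le_funI ennreal_leI borel_measurable_integrable)
  also have "\<dots> \<le> ennreal C" using nn by (intro SUP_least)
  finally have sup: "(\<integral>\<^sup>+t. (SUP n. ennreal (f n t)) \<partial>?M) \<le> ennreal C" .
  have "AE t in ?M. (SUP n. ennreal (f n t)) \<noteq> \<infinity>"
    using sup fi by (intro nn_integral_noteq_infinite) (auto simp: top_unique intro: borel_measurable_integrable)
  then have ae: "AE t in ?M. x t \<in> D \<and> ennreal ((N (A (x t)))\<^sup>2) \<le> (SUP n. ennreal (f n t))"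
  proof eventually_elim
    case (elim t)
    define s where "s = enn2real (SUP n. ennreal (f n t))"
    have s: "(SUP n. ennreal (f n t)) = ennreal s" "0 \<le> s" using elim by (simp_all add: s_def less_top[symmetric])
    have "N (Y (1 / real (Suc n)) (x t)) \<le> sqrt s" for n
    proof -
      have "ennreal (f n t) \<le> ennreal s" unfolding s(1)[symmetric] by (rule SUP_upper) simp
      then have "f n t \<le> s" using s(2) by simp
      then show ?thesis unfolding f_def by (rule real_le_rsqrt)
    qed
    from yosida_limit(1,3)[OF this] have "x t \<in> D" "N (A (x t)) \<le> sqrt s" by auto
    moreover from this(2) have "(N (A (x t)))\<^sup>2 \<le> s" using s(2) by (metis N_nonneg power_mono real_sqrt_pow2)
    ultimately show ?case using s by (auto intro: ennreal_leI)
  qed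
  then show D: "AE t in ?M. x t \<in> D" by eventually_elim simp
  show meas: "(\<lambda>t. A (x t)) \<in> borel_measurable ?M" by (rule measurable_operator[OF x D]) simp
  show "integrable ?M (\<lambda>t. (norm (A (x t)))\<^sup>2)"
  proof (rule integrableI_bounded)
    show "(\<lambda>t. (norm (A (x t)))\<^sup>2) \<in> borel_measurable ?M" using meas by measurable
    have "(\<integral>\<^sup>+t. ennreal (norm ((norm (A (x t)))\<^sup>2)) \<partial>?M) \<le> (\<integral>\<^sup>+t. ennreal (1/c) * (SUP n. ennreal (f n t)) \<partial>?M)"
    proof (rule nn_integral_mono_AE)
      show "AE t in ?M. ennreal (norm ((norm (A (x t)))\<^sup>2)) \<le> ennreal (1/c) * (SUP n. ennreal (f n t))"
        using ae
      proof eventually_elim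
        case (elim t)
        have "(norm (A (x t)))\<^sup>2 \<le> (1/c) * (N (A (x t)))\<^sup>2"
          using Q_coercive[of "A (x t)"] c by (simp add: N_sq field_simps)
        then have "ennreal (norm ((norm (A (x t)))\<^sup>2)) \<le> ennreal (1/c) * ennreal ((N (A (x t)))\<^sup>2)"
          using c by (simp add: ennreal_mult[symmetric] ennreal_leI)
        also have "\<dots> \<le> ennreal (1/c) * (SUP n. ennreal (f n t))" using elim by (intro mult_left_mono) auto
        finally show ?case .
      qed
    qed
    also have "\<dots> = ennreal (1/c) * (\<integral>\<^sup>+t. (SUP n. ennreal (f n t)) \<partial>?M)"
      using fi by (intro nn_integral_cmult) (auto intro: borel_measurable_integrable)
    also have "\<dots> \<le> ennreal (1/c) * ennreal C" using sup by (intro mult_left_mono) auto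
    also have "\<dots> < \<infinity>" by (simp add: ennreal_mult_less_top)
    finally show "(\<integral>\<^sup>+t. ennreal (norm ((norm (A (x t)))\<^sup>2)) \<partial>?M) < \<infinity>" .
  qed
qed

end

section \<open>The generator of the coupled system\<close>

lemma bounded_bilinear_add:
  assumes "bounded_bilinear f" "bounded_bilinear g"
  shows "bounded_bilinear (\<lambda>x y. f x y + g x y)"
proof -
  interpret f: bounded_bilinear f by fact
  interpret g: bounded_bilinear g by fact
  obtain K L where K: "\<And>a b. norm (f a b) \<le> norm a * norm b * K" and L: "\<And>a b. norm (g a b) \<le> norm a * norm b * L"
    using f.bounded g.bounded by blast
  show ?thesis
  proof
    have "norm (f a b + g a b) \<le> norm a * norm b * (K + L)" for a b
      using norm_triangle_ineq[of "f a b" "g a b"] K[of a b] L[of a b] by (simp add: distrib_left)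
    then show "\<exists>K. \<forall>a b. norm (f a b + g a b) \<le> norm a * norm b * K" by blast
  qed (simp_all add: f.add_left f.add_right g.add_left g.add_right f.scaleR_left f.scaleR_right
      g.scaleR_left g.scaleR_right scaleR_add_right)
qed

lemma bounded_bilinear_scaleR_const:
  assumes "bounded_bilinear f"
  shows "bounded_bilinear (\<lambda>x y. r *\<^sub>R f x y)"
proof -
  interpret f: bounded_bilinear f by fact
  obtain K where K: "\<And>a b. norm (f a b) \<le> norm a * norm b * K" using f.bounded by blast
  show ?thesis
  proof
    have "norm (r *\<^sub>R f a b) \<le> norm a * norm b * (\<bar>r\<bar> * K)" for a b
      using mult_left_mono[OF K[of a b], of "\<bar>r\<bar>"] by (simp add: mult_ac)
    then show "\<exists>K. \<forall>a b. norm (r *\<^sub>R f a b) \<le> norm a * norm b * K" by blast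
  qed (simp_all add: f.add_left f.add_right f.scaleR_left f.scaleR_right scaleR_add_right)
qed

lemma bounded_bilinear_blinfun: "bounded_bilinear (\<lambda>x y. blinfun_apply (blinfun_apply (A :: _ \<Rightarrow>\<^sub>L (_ \<Rightarrow>\<^sub>L _)) x) y)"
  by (rule bounded_bilinear.comp1[OF bounded_bilinear_blinfun_apply blinfun.bounded_linear_right])

lemma to_dual_apply: "to_dual \<iota> x z = x \<bullet> \<iota> z"
  by (simp add: to_dual_def)

lemma to_dual_add: "to_dual \<iota> (x + y) = to_dual \<iota> x + to_dual \<iota> y"
  and to_dual_diff: "to_dual \<iota> (x - y) = to_dual \<iota> x - to_dual \<iota> y"
  and to_dual_scaleR: "to_dual \<iota> (r *\<^sub>R x) = r *\<^sub>R to_dual \<iota> x"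
  by (rule blinfun_eqI, simp add: to_dual_apply inner_simps blinfun.bilinear_simps)+

text \<open>Collects what the linear part of the problem relies on. \<open>regularity\<close> is the
  linear core of (A10), without the terms that have values in H anyway.\<close>

locale coupled_system =
  fixes \<eta> :: real
    and \<iota> :: "'v::{real_inner, banach, second_countable_topology}
                \<Rightarrow>\<^sub>L 'h::{real_inner, banach, second_countable_topology}"
    and L :: "'h \<Rightarrow>\<^sub>L 'h"
    and DA1 DA2 DB1 DB2 :: "'h set"
    and A1 A2 B1 B2 :: "'h \<Rightarrow> 'h"
    and A1s A2s B1s :: "'v \<Rightarrow>\<^sub>L ('v \<Rightarrow>\<^sub>L real)"
    and c\<^sub>L C\<^sub>A\<^sub>B :: real
  assumes \<eta>: "\<eta> > 0"
    and embedding: "dense_compact_embedding \<iota>"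
    and L_sym: "L w \<bullet> z = w \<bullet> L z"
    and c\<^sub>L: "c\<^sub>L > 0" and L_coercive: "c\<^sub>L * (norm w)\<^sup>2 \<le> L w \<bullet> w"
    and A1: "linear_operator DA1 A1" "maximal_monotone DA1 A1" "selfadjoint_operator DA1 A1"
    and A2: "linear_operator DA2 A2" "maximal_monotone DA2 A2" "selfadjoint_operator DA2 A2"
    and DA: "DA1 \<subseteq> range \<iota>" "DA2 \<subseteq> range \<iota>"
    and dual_ext: "dual_extension \<iota> DA1 A1 A1s" "dual_extension \<iota> DA2 A2 A2s" "dual_extension \<iota> DB1 B1 B1s"
    and A1s_coercive: "\<alpha> > 0 \<Longrightarrow> \<exists>\<omega>>0. \<forall>w. \<omega> * (norm w)\<^sup>2 \<le> A1s w w + \<alpha> * (norm (\<iota> w))\<^sup>2"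
    and A2s_coercive: "\<alpha> > 0 \<Longrightarrow> \<exists>\<omega>>0. \<forall>w. \<omega> * (norm w)\<^sup>2 \<le> A2s w w + \<alpha> * (norm (\<iota> w))\<^sup>2"
    and B1: "linear_operator DB1 B1" "maximal_monotone DB1 B1" "selfadjoint_operator DB1 B1"
    and B2: "linear_operator DB2 B2" "maximal_monotone DB2 B2" "selfadjoint_operator DB2 B2"
    and DA1_DB2: "DA1 \<subseteq> DB2"
    and B1_A2_nonneg: "w \<in> DB1 \<inter> DA2 \<Longrightarrow> 0 \<le> B1 w \<bullet> A2 w"
    and B2_A1_nonneg: "w \<in> DA1 \<Longrightarrow> 0 \<le> B2 w \<bullet> A1 w"
    and B1_A2_sym: "\<lbrakk>w \<in> DB1 \<inter> DA2; z \<in> DB1 \<inter> DA2\<rbrakk> \<Longrightarrow> B1 w \<bullet> A2 z = B1 z \<bullet> A2 w"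
    and C\<^sub>A\<^sub>B: "C\<^sub>A\<^sub>B > 0" and B2_bound: "w \<in> DA1 \<Longrightarrow> norm (B2 w) \<le> C\<^sub>A\<^sub>B * (norm (A1 w) + norm w)"
    and regularity: "\<lbrakk>0 < a; 0 < b; a *\<^sub>R B1s u + b *\<^sub>R A2s u = to_dual \<iota> g\<rbrakk> \<Longrightarrow> \<iota> u \<in> DB1 \<inter> DA2"
begin

sublocale OA1: accretive_operator_sc "(\<bullet>)" 1 DA1 A1
  by (intro accretive_operator_sc.intro accretive_operator_selfadjoint A1)
sublocale OA2: accretive_operator_sc "(\<bullet>)" 1 DA2 A2
  by (intro accretive_operator_sc.intro accretive_operator_selfadjoint A2)
sublocale OB1: accretive_operator_sc "(\<bullet>)" 1 DB1 B1
  by (intro accretive_operator_sc.intro accretive_operator_selfadjoint B1)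
sublocale OB2: accretive_operator_sc "(\<bullet>)" 1 DB2 B2
  by (intro accretive_operator_sc.intro accretive_operator_selfadjoint B2)

text \<open>By density of V, an element of H is determined by its action on V.\<close>

lemma to_dual_inj: assumes "to_dual \<iota> x = to_dual \<iota> y" shows "x = y"
proof -
  have 0: "(x - y) \<bullet> \<iota> z = 0" for z
    using arg_cong[OF assms, of "\<lambda>f. blinfun_apply f z"] by (simp add: to_dual_apply inner_diff_left)
  have "x - y \<in> closure (range \<iota>)" using embedding by (simp add: dense_compact_embedding_def)
  then obtain s where s: "\<And>n. s n \<in> range \<iota>" "s \<longlonglongrightarrow> x - y" by (auto simp: closure_sequential)
  have "(\<lambda>n. (x - y) \<bullet> s n) \<longlonglongrightarrow> (x - y) \<bullet> (x - y)" by (intro tendsto_intros s)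
  moreover have "(x - y) \<bullet> s n = 0" for n using s(1)[of n] 0 by auto
  ultimately have "(x - y) \<bullet> (x - y) = 0" by (simp add: LIMSEQ_const_iff)
  then show ?thesis by simp
qed

lemma \<iota>_inj: "\<iota> x = \<iota> y \<Longrightarrow> x = y"
  using embedding by (auto simp: dense_compact_embedding_def dest: injD)

lemma A1s_sym: "A1s w z = A1s z w" and A2s_sym: "A2s w z = A2s z w" and B1s_sym: "B1s w z = B1s z w"
  using dual_ext by (auto simp: dual_extension_def)

lemma A1s_eq: "\<iota> w \<in> DA1 \<Longrightarrow> A1s w = to_dual \<iota> (A1 (\<iota> w))"
  and A2s_eq: "\<iota> w \<in> DA2 \<Longrightarrow> A2s w = to_dual \<iota> (A2 (\<iota> w))"
  and B1s_eq: "\<iota> w \<in> DB1 \<Longrightarrow> B1s w = to_dual \<iota> (B1 (\<iota> w))"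
  using dual_ext by (auto simp: dual_extension_def)

lemma dual_extension_nonneg: "dual_extension \<iota> D A As \<Longrightarrow> 0 \<le> As w w"
  unfolding dual_extension_def by (metis blinfun.zero_right diff_zero)

lemmas A1s_nonneg = dual_extension_nonneg[OF dual_ext(1)]
  and A2s_nonneg = dual_extension_nonneg[OF dual_ext(2)]
  and B1s_nonneg = dual_extension_nonneg[OF dual_ext(3)]

text \<open>Elements of \<open>DA2\<close> come from V, so they may be used as test vectors; the
  symmetry of \<open>A2s\<close> then puts the pair into the graph of the adjoint of
  \<open>A2\<close>, which is \<open>A2\<close>.\<close>

lemma A2s_in_H:
  assumes "A2s w = to_dual \<iota> f"
  shows "\<iota> w \<in> DA2" "A2 (\<iota> w) = f"
proof -
  have "A2 z \<bullet> \<iota> w = z \<bullet> f" if z: "z \<in> DA2" for z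
  proof -
    obtain \<zeta> where \<zeta>: "z = \<iota> \<zeta>" using DA z by blast
    have "A2 z \<bullet> \<iota> w = A2s \<zeta> w" using A2s_eq[of \<zeta>] z \<zeta> by (simp add: to_dual_apply)
    also have "\<dots> = f \<bullet> \<iota> \<zeta>" using A2s_sym[of \<zeta> w] assms by (simp add: to_dual_apply)
    finally show ?thesis by (simp add: \<zeta> inner_commute)
  qed
  from selfadjoint_adjointD[OF A2(3) this] show "\<iota> w \<in> DA2" "A2 (\<iota> w) = f" by auto
qed

lemma L_inj: "L x = L y \<Longrightarrow> x = y"
proof -
  assume "L x = L y"
  then have "c\<^sub>L * (norm (x - y))\<^sup>2 \<le> 0" using L_coercive[of "x - y"] by (simp add: blinfun.diff_right)
  then show "x = y" using c\<^sub>L by (simp add: mult_le_0_iff)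
qed

lemma L_surj: "\<exists>x. L x = y"
proof -
  have "bounded_bilinear (\<lambda>x y. L x \<bullet> y)"
    by (rule bounded_bilinear.comp1[OF bounded_bilinear_inner blinfun.bounded_linear_right])
  from lax_milgram[OF this c\<^sub>L L_coercive bounded_linear_inner_right[of y]]
  obtain u where "\<And>z. L u \<bullet> z = y \<bullet> z" by blast
  then show ?thesis using vector_eq_rdot by blast
qed

definition Li :: "'h \<Rightarrow> 'h" where "Li y = (SOME x. L x = y)"

lemma L_Li: "L (Li y) = y"
  unfolding Li_def by (rule someI_ex[OF L_surj])

lemma Li_diff: "Li x - Li y = Li (x - y)"
  by (rule L_inj) (simp add: L_Li blinfun.diff_right)

lemma Li_bound: "norm (Li y) \<le> norm y / c\<^sub>L"
proof (cases "Li y = 0")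
  case False
  have "c\<^sub>L * (norm (Li y))\<^sup>2 \<le> y \<bullet> Li y" using L_coercive[of "Li y"] by (simp add: L_Li)
  also have "\<dots> \<le> norm y * norm (Li y)" by (rule norm_cauchy_schwarz)
  finally show ?thesis using False c\<^sub>L by (simp add: power2_eq_square field_simps)
qed (use c\<^sub>L in simp)

text \<open>
  \<open>state_rel x y\<close> says that \<open>y\<close> is the generator applied to \<open>x = (\<theta>, \<phi>, v)\<close>.  The velocity \<open>v\<close> is the image of
  the second component of \<open>- y\<close>, and \<open>B1 v + A2 \<phi>\<close> is formed in the dual of \<open>V\<close>: only the sum has to lie
  in \<open>H\<close>.
\<close>

definition state_rel :: "'v \<times> 'v \<times> 'h \<Rightarrow> 'v \<times> 'v \<times> 'h \<Rightarrow> bool" where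
  "state_rel x y \<longleftrightarrow>
     \<iota> (fst x) \<in> DA1 \<and>
     \<iota> (fst y) = A1 (\<iota> (fst x)) + \<eta> *\<^sub>R snd (snd x) \<and>
     \<iota> (fst (snd y)) = - snd (snd x) \<and>
     A2s (fst (snd x)) - B1s (fst (snd y)) = to_dual \<iota> (L (snd (snd y)) + B2 (\<iota> (fst x)))"

text \<open>\<open>A1s\<close> and \<open>A2s\<close> are coercive on V only together with the H
  norm; the added H products make \<open>Q\<close> equivalent to the inner product of the product
  space.\<close>

definition Q :: "'v \<times> 'v \<times> 'h \<Rightarrow> 'v \<times> 'v \<times> 'h \<Rightarrow> real" where
  "Q x y = A1s (fst x) (fst y) + \<iota> (fst x) \<bullet> \<iota> (fst y)
     + (A2s (fst (snd x)) (fst (snd y)) + \<iota> (fst (snd x)) \<bullet> \<iota> (fst (snd y)))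
     + L (snd (snd x)) \<bullet> snd (snd y)"

lemma state_rel_unique: assumes "state_rel x y" "state_rel x z" shows "y = z"
proof -
  have 1: "fst y = fst z" "fst (snd y) = fst (snd z)"
    using assms by (auto simp: state_rel_def intro: \<iota>_inj)
  then have "to_dual \<iota> (L (snd (snd y)) + B2 (\<iota> (fst x))) = to_dual \<iota> (L (snd (snd z)) + B2 (\<iota> (fst x)))"
    using assms by (simp add: state_rel_def)
  then have "L (snd (snd y)) + B2 (\<iota> (fst x)) = L (snd (snd z)) + B2 (\<iota> (fst x))" by (rule to_dual_inj)
  then have "snd (snd y) = snd (snd z)" by (rule L_inj[OF add_right_imp_eq])
  with 1 show ?thesis by (simp add: prod_eq_iff)
qed

lemma state_rel_add: assumes "state_rel x y" "state_rel x' y'" shows "state_rel (x + x') (y + y')"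
proof -
  have *: "\<iota> (fst x) \<in> DA1" "\<iota> (fst x') \<in> DA1" using assms by (auto simp: state_rel_def)
  have "A2s (fst (snd x) + fst (snd x')) - B1s (fst (snd y) + fst (snd y'))
     = (A2s (fst (snd x)) - B1s (fst (snd y))) + (A2s (fst (snd x')) - B1s (fst (snd y')))"
    by (simp add: blinfun.add_right)
  also have "\<dots> = to_dual \<iota> (L (snd (snd y)) + B2 (\<iota> (fst x))) + to_dual \<iota> (L (snd (snd y')) + B2 (\<iota> (fst x')))"
    using assms by (simp add: state_rel_def)
  finally have "A2s (fst (snd x) + fst (snd x')) - B1s (fst (snd y) + fst (snd y'))
     = to_dual \<iota> ((L (snd (snd y)) + B2 (\<iota> (fst x))) + (L (snd (snd y')) + B2 (\<iota> (fst x'))))"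
    by (simp only: to_dual_add)
  moreover have "B2 (\<iota> (fst x) + \<iota> (fst x')) = B2 (\<iota> (fst x)) + B2 (\<iota> (fst x'))"
    using * DA1_DB2 by (intro OB2.A_add) auto
  moreover have "A1 (\<iota> (fst x) + \<iota> (fst x')) = A1 (\<iota> (fst x)) + A1 (\<iota> (fst x'))" using * by (rule OA1.A_add)
  moreover have "\<iota> (fst x) + \<iota> (fst x') \<in> DA1" using * OA1.D_subspace by (simp add: subspace_add)
  ultimately show ?thesis using assms
    by (simp add: state_rel_def blinfun.add_right scaleR_add_right add_ac)
qed

lemma state_rel_scaleR: assumes "state_rel x y" shows "state_rel (r *\<^sub>R x) (r *\<^sub>R y)"
proof -
  have *: "\<iota> (fst x) \<in> DA1" using assms by (auto simp: state_rel_def)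
  have "A2s (r *\<^sub>R fst (snd x)) - B1s (r *\<^sub>R fst (snd y)) = r *\<^sub>R (A2s (fst (snd x)) - B1s (fst (snd y)))"
    by (simp add: blinfun.scaleR_right scaleR_diff_right)
  also have "\<dots> = to_dual \<iota> (r *\<^sub>R (L (snd (snd y)) + B2 (\<iota> (fst x))))"
    using assms by (simp add: state_rel_def to_dual_scaleR)
  finally have "A2s (r *\<^sub>R fst (snd x)) - B1s (r *\<^sub>R fst (snd y))
     = to_dual \<iota> (r *\<^sub>R (L (snd (snd y)) + B2 (\<iota> (fst x))))" .
  moreover have "B2 (r *\<^sub>R \<iota> (fst x)) = r *\<^sub>R B2 (\<iota> (fst x))"
    using * DA1_DB2 by (intro OB2.A_scale) auto
  moreover have "A1 (r *\<^sub>R \<iota> (fst x)) = r *\<^sub>R A1 (\<iota> (fst x))" using * by (rule OA1.A_scale)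
  moreover have "r *\<^sub>R \<iota> (fst x) \<in> DA1" using * OA1.D_subspace by (simp add: subspace_mul)
  ultimately show ?thesis using assms
    by (simp add: state_rel_def blinfun.scaleR_right scaleR_add_right)
qed

lemma Q_bilinear: "bounded_bilinear Q"
proof -
  have f2: "bounded_linear (\<lambda>x::'v \<times> 'v \<times> 'h. fst (snd x))" "bounded_linear (\<lambda>x::'v \<times> 'v \<times> 'h. snd (snd x))"
    by (intro bounded_linear_compose[OF bounded_linear_fst] bounded_linear_compose[OF bounded_linear_snd] bounded_linear_snd)+
  have i: "bounded_linear (\<lambda>x. \<iota> (f x))" if "bounded_linear f" for f :: "'v \<times> 'v \<times> 'h \<Rightarrow> 'v"
    using that by (rule bounded_linear_compose[OF blinfun.bounded_linear_right])
  have l: "bounded_linear (\<lambda>x::'v \<times> 'v \<times> 'h. L (snd (snd x)))"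
    using f2(2) by (rule bounded_linear_compose[OF blinfun.bounded_linear_right])
  show ?thesis
    unfolding Q_def
    by (intro bounded_bilinear_add bounded_bilinear.comp[OF bounded_bilinear_blinfun]
        bounded_bilinear.comp[OF bounded_bilinear_inner] f2 i l bounded_linear_fst)
qed

lemma Q_sym: "Q x y = Q y x"
  using L_sym[of "snd (snd x)" "snd (snd y)"]
  by (simp add: Q_def A1s_sym[of "fst x"] A2s_sym[of "fst (snd x)"] inner_commute)

lemma Q_coercive_ex: "\<exists>c>0. \<forall>x. c * (norm x)\<^sup>2 \<le> Q x x"
proof -
  obtain a b where a: "a > 0" "\<And>w. a * (norm w)\<^sup>2 \<le> A1s w w + 1 * (norm (\<iota> w))\<^sup>2"
    and b: "b > 0" "\<And>w. b * (norm w)\<^sup>2 \<le> A2s w w + 1 * (norm (\<iota> w))\<^sup>2"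
    using A1s_coercive[of 1] A2s_coercive[of 1] by auto
  define c where "c = min a (min b c\<^sub>L)"
  have c: "c > 0" "c \<le> a" "c \<le> b" "c \<le> c\<^sub>L" using a b c\<^sub>L by (auto simp: c_def)
  have "c * (norm x)\<^sup>2 \<le> Q x x" for x
  proof -
    have "(norm x)\<^sup>2 = (norm (fst x))\<^sup>2 + (norm (fst (snd x)))\<^sup>2 + (norm (snd (snd x)))\<^sup>2"
      by (cases x) (auto simp: norm_Pair)
    then have "c * (norm x)\<^sup>2 = c * (norm (fst x))\<^sup>2 + c * (norm (fst (snd x)))\<^sup>2 + c * (norm (snd (snd x)))\<^sup>2"
      by (simp add: algebra_simps)
    also have "\<dots> \<le> a * (norm (fst x))\<^sup>2 + b * (norm (fst (snd x)))\<^sup>2 + c\<^sub>L * (norm (snd (snd x)))\<^sup>2"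
      using c by (intro add_mono mult_right_mono) auto
    also have "\<dots> \<le> Q x x"
      using a(2)[of "fst x"] b(2)[of "fst (snd x)"] L_coercive[of "snd (snd x)"]
      by (simp add: Q_def power2_norm_eq_inner)
    finally show ?thesis .
  qed
  then show ?thesis using c by blast
qed

definition c\<^sub>Q :: real where "c\<^sub>Q = (SOME c. c > 0 \<and> (\<forall>x. c * (norm x)\<^sup>2 \<le> Q x x))"

lemma c\<^sub>Q: "c\<^sub>Q > 0" and Q_coercive: "c\<^sub>Q * (norm x)\<^sup>2 \<le> Q x x"
  using someI_ex[OF Q_coercive_ex] unfolding c\<^sub>Q_def by blast+

lemma Q_H_bounds:
  "(norm (\<iota> (fst x)))\<^sup>2 + (norm (\<iota> (fst (snd x))))\<^sup>2 + c\<^sub>L * (norm (snd (snd x)))\<^sup>2 \<le> Q x x"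
  using A1s_nonneg[of "fst x"] A2s_nonneg[of "fst (snd x)"] L_coercive[of "snd (snd x)"]
  by (simp add: Q_def power2_norm_eq_inner)

text \<open>With K = \<eta> + \<open>C\<^sub>A\<^sub>B\<close>, the term K^2/4 completes the square
  with the norm of A1 \<theta>, the terms K/2 and 1/2 come from Young's inequality for the remaining
  products, and the last factor passes from H norms to \<open>Q\<close>.\<close>

definition \<omega> :: real where
  "\<omega> = ((\<eta> + C\<^sub>A\<^sub>B)\<^sup>2 / 4 + (\<eta> + C\<^sub>A\<^sub>B) / 2 + 1/2) * (1 + 1 / c\<^sub>L)"

lemma \<omega>: "\<omega> > 0"
  unfolding \<omega>_def using \<eta> C\<^sub>A\<^sub>B c\<^sub>L by (intro mult_pos_pos add_nonneg_pos add_nonneg_nonneg) auto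

text \<open>The terms \<open>A2s \<phi> w\<close> of the second and third components cancel,
  \<open>B1s w w\<close> has a sign, and pairing the first component through \<open>A1s\<close>
  produces the squared norm of A1 \<theta>, which dominates the coupling through \<eta> and
  \<open>B2\<close> up to H norms.\<close>

lemma state_rel_energy:
  assumes "state_rel x y"
  shows "- (\<omega> * Q x x) \<le> Q y x"
proof -
  define \<theta> \<phi> v w K where "\<theta> = fst x" and "\<phi> = fst (snd x)" and "v = snd (snd x)" and "w = - fst (snd y)"
    and "K = \<eta> + C\<^sub>A\<^sub>B"
  have K: "K > 0" using \<eta> C\<^sub>A\<^sub>B by (simp add: K_def)
  have r: "\<iota> \<theta> \<in> DA1" "\<iota> (fst y) = A1 (\<iota> \<theta>) + \<eta> *\<^sub>R v" "\<iota> w = v"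
    "B1s w + A2s \<phi> = to_dual \<iota> (L (snd (snd y)) + B2 (\<iota> \<theta>))"
    using assms by (auto simp: state_rel_def \<theta>_def \<phi>_def v_def w_def blinfun.minus_right)
  define a m n m' where "a = norm (A1 (\<iota> \<theta>))" and "m = norm (\<iota> \<theta>)" and "n = norm v" and "m' = norm (\<iota> \<phi>)"
  note defs = a_def m_def n_def m'_def
  have nn: "0 \<le> a" "0 \<le> m" "0 \<le> n" "0 \<le> m'" by (auto simp: defs)
  have t1: "A1s (fst y) \<theta> + \<iota> (fst y) \<bullet> \<iota> \<theta> \<ge> a\<^sup>2 - \<eta> * a * n - \<eta> * m * n"
  proof -
    have "A1s (fst y) \<theta> = A1 (\<iota> \<theta>) \<bullet> (A1 (\<iota> \<theta>) + \<eta> *\<^sub>R v)"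
      unfolding A1s_sym[of _ \<theta>] A1s_eq[OF r(1)] to_dual_apply r(2) ..
    moreover have "\<eta> * (A1 (\<iota> \<theta>) \<bullet> v) \<ge> - (\<eta> * (a * n))"
      using \<eta> Cauchy_Schwarz_ineq2[of "A1 (\<iota> \<theta>)" v] mult_left_mono[of "- (a * n)" "A1 (\<iota> \<theta>) \<bullet> v" \<eta>]
      by (simp add: defs)
    moreover have "\<eta> * (v \<bullet> \<iota> \<theta>) \<ge> - (\<eta> * (m * n))"
      using \<eta> Cauchy_Schwarz_ineq2[of v "\<iota> \<theta>"] mult_left_mono[of "- (m * n)" "v \<bullet> \<iota> \<theta>" \<eta>]
      by (simp add: defs mult.commute)
    moreover have "0 \<le> A1 (\<iota> \<theta>) \<bullet> \<iota> \<theta>" using OA1.mono r(1) by blast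
    ultimately show ?thesis unfolding r(2)
      by (simp add: inner_add_left inner_add_right a_def power2_norm_eq_inner)
  qed
  have t2: "A2s (fst (snd y)) \<phi> + \<iota> (fst (snd y)) \<bullet> \<iota> \<phi> \<ge> - A2s \<phi> w - m' * n"
  proof -
    have "A2s (fst (snd y)) \<phi> = - A2s \<phi> w" unfolding A2s_sym[of _ \<phi>] by (simp add: w_def blinfun.minus_right)
    moreover have "\<iota> (fst (snd y)) = - v" using r(3) by (auto simp: w_def blinfun.minus_right)
    moreover have "v \<bullet> \<iota> \<phi> \<le> m' * n" using norm_cauchy_schwarz[of v "\<iota> \<phi>"] by (simp add: defs mult.commute)
    ultimately show ?thesis by simp
  qed
  have t3: "L (snd (snd y)) \<bullet> v \<ge> A2s \<phi> w - C\<^sub>A\<^sub>B * (a + m) * n"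
  proof -
    have "L (snd (snd y)) \<bullet> v + B2 (\<iota> \<theta>) \<bullet> v = B1s w w + A2s \<phi> w"
      using arg_cong[OF r(4), of "\<lambda>f. blinfun_apply f w"] r(3)
      by (simp add: to_dual_apply blinfun.add_left inner_add_left)
    moreover have "B2 (\<iota> \<theta>) \<bullet> v \<le> C\<^sub>A\<^sub>B * (a + m) * n"
    proof -
      have "B2 (\<iota> \<theta>) \<bullet> v \<le> norm (B2 (\<iota> \<theta>)) * n" unfolding n_def by (rule norm_cauchy_schwarz)
      also have "\<dots> \<le> C\<^sub>A\<^sub>B * (a + m) * n" using B2_bound[OF r(1)] nn by (intro mult_right_mono) (auto simp: defs)
      finally show ?thesis .
    qed
    ultimately show ?thesis using B1s_nonneg[of w] by linarith
  qed
  have "Q y x \<ge> a\<^sup>2 - \<eta> * a * n - \<eta> * m * n - m' * n - C\<^sub>A\<^sub>B * (a + m) * n"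
    using t1 t2 t3 unfolding Q_def \<theta>_def[symmetric] \<phi>_def[symmetric] v_def[symmetric] by linarith
  also have "a\<^sup>2 - \<eta> * a * n - \<eta> * m * n - m' * n - C\<^sub>A\<^sub>B * (a + m) * n = a\<^sup>2 - K * a * n - K * m * n - m' * n"
    by (simp add: K_def algebra_simps)
  finally have 1: "Q y x \<ge> a\<^sup>2 - K * a * n - K * m * n - m' * n" .
  have "0 \<le> (a - K * n / 2)\<^sup>2" by simp
  then have 2: "a\<^sup>2 - K * a * n \<ge> - (K\<^sup>2 / 4 * n\<^sup>2)" by (simp add: power2_eq_square algebra_simps)
  have "K * (2 * m * n) \<le> K * (m\<^sup>2 + n\<^sup>2)" using K sum_squares_bound[of m n] by (intro mult_left_mono) auto
  then have 3: "K * m * n \<le> K / 2 * m\<^sup>2 + K / 2 * n\<^sup>2" by (simp add: algebra_simps)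
  have 4: "m' * n \<le> m'\<^sup>2 / 2 + n\<^sup>2 / 2" using sum_squares_bound[of m' n] by simp
  let ?g = "K\<^sup>2 / 4 + K / 2 + 1/2"
  have "- Q y x \<le> ?g * n\<^sup>2 + K / 2 * m\<^sup>2 + 1/2 * m'\<^sup>2"
    using 1 2 3 4 by (simp add: algebra_simps)
  also have "\<dots> \<le> ?g * n\<^sup>2 + ?g * m\<^sup>2 + ?g * m'\<^sup>2"
    using K by (intro add_mono mult_right_mono) auto
  also have "\<dots> = ?g * (m\<^sup>2 + m'\<^sup>2 + n\<^sup>2)" by (simp add: algebra_simps)
  also have "\<dots> \<le> ?g * ((1 + 1 / c\<^sub>L) * Q x x)"
  proof (rule mult_left_mono)
    have b: "m\<^sup>2 + m'\<^sup>2 + c\<^sub>L * n\<^sup>2 \<le> Q x x" using Q_H_bounds[of x] by (simp add: defs \<theta>_def \<phi>_def v_def)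
    moreover have "0 \<le> c\<^sub>L * n\<^sup>2" "0 \<le> m\<^sup>2" "0 \<le> m'\<^sup>2" using c\<^sub>L by auto
    ultimately have "m\<^sup>2 + m'\<^sup>2 \<le> Q x x" "c\<^sub>L * n\<^sup>2 \<le> Q x x" by linarith+
    then have "m\<^sup>2 + m'\<^sup>2 \<le> Q x x" "n\<^sup>2 \<le> 1 / c\<^sub>L * Q x x" using c\<^sub>L by (auto simp: field_simps)
    then show "m\<^sup>2 + m'\<^sup>2 + n\<^sup>2 \<le> (1 + 1 / c\<^sub>L) * Q x x" by (simp add: algebra_simps)
    show "0 \<le> ?g" using K by simp
  qed
  also have "\<dots> = \<omega> * Q x x" by (simp add: \<omega>_def K_def)
  finally show ?thesis by simp
qed

end

context evolution
begin

lemma k_eqI: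
  assumes "real j * h m \<le> t" "t < real (Suc j) * h m"
  shows "k m t = j"
proof -
  have "0 \<le> t" using assms(1) h_pos[of m] by (meson less_imp_le mult_nonneg_nonneg of_nat_0_le_iff order_trans)
  from k_bounds[OF this, of m] assms have "h m * real (k m t) < h m * real (Suc j)" "h m * real j < h m * (real (k m t) + 1)"
    by (simp_all add: mult.commute)
  then have "real (k m t) < real (Suc j)" "real j < real (k m t) + 1" using h_pos[of m] by (auto simp: mult_less_cancel_left_pos)
  then show ?thesis by linarith
qed

text \<open>The comparison is with the right end of the interval, because the discrete bound on B1 v
  concerns the values after each step.\<close>

lemma U_E_close:
  assumes t: "real j * h m \<le> t" "t < real (Suc j) * h m" "t \<le> T"
  shows "N (U t - E (h m) (Suc j)) \<le> B * \<rho> ^ m + h m * M"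
proof -
  have t0: "0 \<le> t" using t(1) h_pos[of m] by (meson less_imp_le mult_nonneg_nonneg of_nat_0_le_iff order_trans)
  have S: "S m t = E (h m) j" using k_eqI[OF t(1,2)] by (simp add: S_def)
  have "N (U t - E (h m) (Suc j)) \<le> N (U t - S m t) + N (S m t - E (h m) (Suc j))" by (rule N_triangle_diff)
  also have "N (U t - S m t) \<le> B * \<rho> ^ m" using t0 t by (intro S_rate) auto
  also have "N (S m t - E (h m) (Suc j)) \<le> h m * M"
    using E_step_bound'[OF h_pos, of m j] t N_minus[of "E (h m) j"] by (simp add: S mult.commute)
  finally show ?thesis by simp
qed

end

section \<open>The resolvent problem and the implicit step\<close>

context coupled_system
begin

lemma B2_J_bounded_linear:
  assumes "\<mu> > 0"
  shows "bounded_linear (\<lambda>x. B2 (OA1.J \<mu> x))"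
proof -
  interpret J: bounded_linear "OA1.J \<mu>" using assms by (rule OA1.J_bounded_linear)
  interpret Y: bounded_linear "OA1.Y \<mu>" using assms by (rule OA1.Y_bounded_linear)
  obtain a b where a: "\<And>x. norm (OA1.J \<mu> x) \<le> norm x * a" and b: "\<And>x. norm (OA1.Y \<mu> x) \<le> norm x * b"
    using J.bounded Y.bounded by blast
  have J2: "OA1.J \<mu> x \<in> DB2" for x using OA1.J_in[OF assms] DA1_DB2 by blast
  show ?thesis
  proof (rule bounded_linear_intro)
    show "B2 (OA1.J \<mu> (x + y)) = B2 (OA1.J \<mu> x) + B2 (OA1.J \<mu> y)" for x y
      by (simp add: J.add OB2.A_add J2)
    show "B2 (OA1.J \<mu> (r *\<^sub>R x)) = r *\<^sub>R B2 (OA1.J \<mu> x)" for r x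
      by (simp add: J.scaleR OB2.A_scale J2)
    show "norm (B2 (OA1.J \<mu> x)) \<le> norm x * (C\<^sub>A\<^sub>B * (b + a))" for x
    proof -
      have "norm (B2 (OA1.J \<mu> x)) \<le> C\<^sub>A\<^sub>B * (norm (OA1.Y \<mu> x) + norm (OA1.J \<mu> x))"
        using B2_bound[OF OA1.J_in[OF assms]] by (simp add: OA1.Y_def)
      also have "\<dots> \<le> C\<^sub>A\<^sub>B * (norm x * b + norm x * a)"
        using a b C\<^sub>A\<^sub>B by (intro mult_left_mono add_mono) auto
      finally show ?thesis by (simp add: algebra_simps)
    qed
  qed
qed

text \<open>Writing \<open>x\<close> through its resolvent y as y + \<mu> A1 y splits the product
  into two nonnegative ones, the second by (A4). This keeps the implicit problem coercive after the
  temperature is eliminated.\<close>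

lemma B2_J_nonneg:
  assumes "\<mu> > 0"
  shows "0 \<le> B2 (OA1.J \<mu> x) \<bullet> x"
proof -
  let ?y = "OA1.J \<mu> x"
  have y: "?y \<in> DA1" using OA1.J_in[OF assms] .
  have "B2 ?y \<bullet> x = B2 ?y \<bullet> ?y + \<mu> * (B2 ?y \<bullet> A1 ?y)"
    using arg_cong[OF OA1.J_eq[OF assms, of x], of "\<lambda>u. B2 ?y \<bullet> u"] by (simp add: inner_add_right)
  moreover have "0 \<le> B2 ?y \<bullet> ?y" using OB2.mono y DA1_DB2 by blast
  ultimately show ?thesis using B2_A1_nonneg[OF y] assms by simp
qed

text \<open>Everything is reduced to the velocity w in V: the first line gives \<theta> as the
  resolvent of \<open>A1\<close> at a - \<mu> \<eta> w, the second gives \<phi> = b + \<mu> w, and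
  inserting both into the third leaves the equation of \<open>\<beta>\<close> and
  \<open>f\<close>.\<close>

lemma state_rel_surj:
  assumes \<mu>: "\<mu> > 0"
  shows "\<exists>x y. state_rel x y \<and> x + \<mu> *\<^sub>R y = z"
proof -
  let ?J = "OA1.J \<mu>"
  interpret J: bounded_linear ?J using \<mu> by (rule OA1.J_bounded_linear)
  interpret BJ: bounded_linear "\<lambda>x. B2 (?J x)" using \<mu> by (rule B2_J_bounded_linear)
  define a b d where "a = fst z" and "b = fst (snd z)" and "d = snd (snd z)"
  define \<beta> where "\<beta> w \<zeta> = (1/\<mu>) *\<^sub>R (L (\<iota> w) \<bullet> \<iota> \<zeta>) + B1s w \<zeta> + \<mu> *\<^sub>R A2s w \<zeta>
      + (\<mu> * \<eta>) *\<^sub>R (B2 (?J (\<iota> w)) \<bullet> \<iota> \<zeta>)" for w \<zeta>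
  define f where "f \<zeta> = (1/\<mu>) *\<^sub>R (L d \<bullet> \<iota> \<zeta>) - A2s b \<zeta> + B2 (?J (\<iota> a)) \<bullet> \<iota> \<zeta>" for \<zeta>
  have \<beta>: "bounded_bilinear \<beta>"
    unfolding \<beta>_def
    by (intro bounded_bilinear_add bounded_bilinear_scaleR_const bounded_bilinear_blinfun
      bounded_bilinear.comp[OF bounded_bilinear_inner _ blinfun.bounded_linear_right]
      bounded_linear_compose[OF BJ.bounded_linear blinfun.bounded_linear_right]
      bounded_linear_compose[OF blinfun.bounded_linear_right blinfun.bounded_linear_right])
  have f: "bounded_linear f"
    unfolding f_def
    by (intro bounded_linear_add bounded_linear_sub bounded_linear_const_scaleR blinfun.bounded_linear_right
      bounded_linear_compose[OF bounded_linear_inner_right blinfun.bounded_linear_right])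
  \<comment> \<open>This \<alpha> is chosen so that the H norm lacking in the coercivity of
    \<open>A2s\<close>, multiplied by \<mu>, is exactly what the term with \<open>L\<close>
    supplies.\<close>
  obtain e where e: "e > 0" "\<And>w. e * (norm w)\<^sup>2 \<le> A2s w w + c\<^sub>L / \<mu>\<^sup>2 * (norm (\<iota> w))\<^sup>2"
    using A2s_coercive[of "c\<^sub>L / \<mu>\<^sup>2"] c\<^sub>L \<mu> by auto
  have coercive: "(\<mu> * e) * (norm w)\<^sup>2 \<le> \<beta> w w" for w
  proof -
    have "(\<mu> * e) * (norm w)\<^sup>2 \<le> \<mu> * (A2s w w + c\<^sub>L / \<mu>\<^sup>2 * (norm (\<iota> w))\<^sup>2)"
      using mult_left_mono[OF e(2)[of w] less_imp_le[OF \<mu>]] by (simp add: mult.assoc)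
    also have "\<dots> = \<mu> * A2s w w + (1/\<mu>) * (c\<^sub>L * (norm (\<iota> w))\<^sup>2)"
      using \<mu> by (simp add: field_simps power2_eq_square)
    also have "\<dots> \<le> \<mu> * A2s w w + (1/\<mu>) * (L (\<iota> w) \<bullet> \<iota> w)"
      using L_coercive[of "\<iota> w"] \<mu> by (intro add_left_mono mult_left_mono) auto
    also have "\<dots> \<le> \<beta> w w"
      using B1s_nonneg[of w] mult_nonneg_nonneg[OF _ B2_J_nonneg[OF \<mu>, of "\<iota> w"], of "\<mu> * \<eta>"] \<mu> \<eta>
      by (simp add: \<beta>_def)
    finally show ?thesis .
  qed
  have "0 < \<mu> * e" using \<mu> e by simp
  from lax_milgram[OF \<beta> this coercive f] obtain w where w: "\<And>\<zeta>. \<beta> w \<zeta> = f \<zeta>" by blast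
  define \<theta>h where "\<theta>h = ?J (\<iota> a - (\<mu> * \<eta>) *\<^sub>R \<iota> w)"
  have \<theta>h: "\<theta>h \<in> DA1" "\<theta>h + \<mu> *\<^sub>R A1 \<theta>h = \<iota> a - (\<mu> * \<eta>) *\<^sub>R \<iota> w"
    unfolding \<theta>h_def using OA1.J_in[OF \<mu>] OA1.J_eq[OF \<mu>] by auto
  obtain \<theta> where \<theta>: "\<theta>h = \<iota> \<theta>" using \<theta>h(1) DA by blast
  define x where "x = (\<theta>, b + \<mu> *\<^sub>R w, \<iota> w)"
  define y where "y = (1/\<mu>) *\<^sub>R (z - x)"
  have z: "z = (a, b, d)" by (simp add: a_def b_def d_def)
  have y_eq: "fst y = (1/\<mu>) *\<^sub>R (a - \<theta>)" "fst (snd y) = - w" "snd (snd y) = (1/\<mu>) *\<^sub>R (d - \<iota> w)"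
    using \<mu> by (simp_all add: y_def x_def z)
  have "state_rel x y"
    unfolding state_rel_def y_eq
  proof (intro conjI)
    show "\<iota> (fst x) \<in> DA1" using \<theta>h(1) by (simp add: x_def \<theta>)
    have "\<mu> *\<^sub>R (A1 \<theta>h + \<eta> *\<^sub>R \<iota> w) = \<iota> a - \<theta>h"
      using \<theta>h(2) by (simp add: algebra_simps)
    then have "A1 \<theta>h + \<eta> *\<^sub>R \<iota> w = (1/\<mu>) *\<^sub>R (\<iota> a - \<theta>h)"
      using \<mu> by (metis scaleR_scaleR divide_self_if less_irrefl nonzero_divide_eq_eq scaleR_one times_divide_eq_left mult_1)
    then show "\<iota> ((1/\<mu>) *\<^sub>R (a - \<theta>)) = A1 (\<iota> (fst x)) + \<eta> *\<^sub>R snd (snd x)"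
      by (simp add: x_def \<theta> blinfun.scaleR_right blinfun.diff_right)
    show "\<iota> (- w) = - snd (snd x)" by (simp add: x_def blinfun.minus_right)
    show "A2s (fst (snd x)) - B1s (- w) = to_dual \<iota> (L ((1/\<mu>) *\<^sub>R (d - \<iota> w)) + B2 (\<iota> (fst x)))"
    proof (rule blinfun_eqI)
      fix \<zeta>
      have "B2 (\<iota> (fst x)) = B2 (?J (\<iota> a)) - (\<mu> * \<eta>) *\<^sub>R B2 (?J (\<iota> w))"
        unfolding x_def fst_conv \<theta>[symmetric] \<theta>h_def by (simp only: BJ.diff BJ.scaleR)
      then have "B2 (\<iota> \<theta>) \<bullet> \<iota> \<zeta> = B2 (?J (\<iota> a)) \<bullet> \<iota> \<zeta> - \<mu> * \<eta> * (B2 (?J (\<iota> w)) \<bullet> \<iota> \<zeta>)"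
        by (simp add: x_def inner_diff_left)
      then show "(A2s (fst (snd x)) - B1s (- w)) \<zeta> = to_dual \<iota> (L ((1/\<mu>) *\<^sub>R (d - \<iota> w)) + B2 (\<iota> (fst x))) \<zeta>"
        using w[of \<zeta>] unfolding \<beta>_def f_def to_dual_apply
        by (simp add: x_def blinfun.bilinear_simps inner_add_left inner_diff_left algebra_simps)
    qed
  qed
  moreover have "x + \<mu> *\<^sub>R y = z" using \<mu> by (simp add: y_def)
  ultimately show ?thesis by blast
qed

definition state_dom :: "('v \<times> 'v \<times> 'h) set" where "state_dom = {x. \<exists>y. state_rel x y}"

definition generator :: "'v \<times> 'v \<times> 'h \<Rightarrow> 'v \<times> 'v \<times> 'h" where "generator x = (THE y. state_rel x y)"

text \<open>
  The shift makes the generator monotone for \<open>Q\<close>; \<open>forcing\<close> below undoes it.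
\<close>

definition shifted_generator :: "'v \<times> 'v \<times> 'h \<Rightarrow> 'v \<times> 'v \<times> 'h" where "shifted_generator x = generator x + \<omega> *\<^sub>R x"

lemma generator_eq: "state_rel x y \<Longrightarrow> generator x = y"
  unfolding generator_def by (rule the_equality) (auto intro: state_rel_unique)

lemma generator_rel: "x \<in> state_dom \<Longrightarrow> state_rel x (generator x)"
  using generator_eq unfolding state_dom_def by blast

lemma state_dom_add: "\<lbrakk>x \<in> state_dom; y \<in> state_dom\<rbrakk> \<Longrightarrow> x + y \<in> state_dom \<and> generator (x + y) = generator x + generator y"
  using state_rel_add[OF generator_rel generator_rel] generator_eq unfolding state_dom_def by blast

lemma state_dom_scaleR: "x \<in> state_dom \<Longrightarrow> r *\<^sub>R x \<in> state_dom \<and> generator (r *\<^sub>R x) = r *\<^sub>R generator x"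
  using state_rel_scaleR[OF generator_rel] generator_eq unfolding state_dom_def by blast

sublocale X: accretive_operator_sc Q c\<^sub>Q state_dom shifted_generator
proof (intro accretive_operator_sc.intro accretive_operator.intro)
  show "bounded_bilinear Q" by (rule Q_bilinear)
  show "Q x y = Q y x" for x y by (rule Q_sym)
  show "0 < c\<^sub>Q" by (rule c\<^sub>Q)
  show "c\<^sub>Q * (norm x)\<^sup>2 \<le> Q x x" for x by (rule Q_coercive)
  obtain x0 where "x0 \<in> state_dom" using state_rel_surj[OF zero_less_one] unfolding state_dom_def by blast
  then have "0 \<in> state_dom" using state_dom_scaleR[of x0 0] by simp
  then show "linear_operator state_dom shifted_generator"
    unfolding linear_operator_def subspace_def shifted_generator_def using state_dom_add state_dom_scaleR
    by (simp add: scaleR_add_right)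
  interpret Q: bounded_bilinear Q by (rule Q_bilinear)
  show "0 \<le> Q (shifted_generator x) x" if "x \<in> state_dom" for x
    using state_rel_energy[OF generator_rel[OF that]] by (simp add: shifted_generator_def Q.add_left Q.scaleR_left)
  show "\<exists>x\<in>state_dom. x + lam *\<^sub>R shifted_generator x = y" if lam: "0 < lam" for lam y
  proof -
    \<comment> \<open>The shift by \<omega> is absorbed by rescaling: divided by \<open>s\<close>,
      the equation is one for the unshifted generator with parameter \<open>lam / s\<close>.\<close>
    define s where "s = 1 + lam * \<omega>"
    have s: "s > 0" using lam \<omega> by (simp add: s_def add_pos_pos)
    obtain x y' where x: "state_rel x y'" "x + (lam / s) *\<^sub>R y' = (1 / s) *\<^sub>R y"
      using state_rel_surj[OF divide_pos_pos[OF lam s]] by blast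
    have "s *\<^sub>R (x + (lam / s) *\<^sub>R y') = y" unfolding x(2) using s by simp
    then have "s *\<^sub>R x + lam *\<^sub>R y' = y" using s by (simp add: scaleR_add_right)
    then have "x + lam *\<^sub>R (y' + \<omega> *\<^sub>R x) = y" by (simp add: s_def algebra_simps)
    then show ?thesis using x(1) generator_eq[OF x(1)] unfolding state_dom_def shifted_generator_def by blast
  qed
qed

definition forcing :: "('v \<Rightarrow> 'h) \<Rightarrow> 'v \<times> 'v \<times> 'h \<Rightarrow> 'v \<times> 'v \<times> 'h" where
  "forcing f x = (0, 0, - Li (f (fst (snd x)))) + \<omega> *\<^sub>R x"

lemma norm_components: "norm (fst x) \<le> norm x" "norm (fst (snd x)) \<le> norm x" "norm (snd (snd x)) \<le> norm x"
  for x :: "'v \<times> 'v \<times> 'h"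
  using norm_fst_le[of "fst x" "snd x"] norm_snd_le[of "snd x" "fst x"]
    norm_fst_le[of "fst (snd x)" "snd (snd x)"] norm_snd_le[of "snd (snd x)" "fst (snd x)"]
  by (simp_all only: prod.collapse)

lemma forcing_lipschitz:
  assumes f: "\<And>u v. norm (f u - f v) \<le> \<Lambda> * norm (u - v)"
  shows "\<exists>K\<ge>0. \<forall>x y. X.N (forcing f x - forcing f y) \<le> K * X.N (x - y)"
proof -
  obtain K0 where K0: "K0 > 0" "\<And>x. X.N x \<le> K0 * norm x" using X.N_le_norm by blast
  define K where "K = K0 * (\<bar>\<Lambda>\<bar> / c\<^sub>L) / sqrt c\<^sub>Q + \<omega>"
  have "X.N (forcing f x - forcing f y) \<le> K * X.N (x - y)" for x y
  proof -
    let ?u = "fst (snd x)" and ?v = "fst (snd y)"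
    have eq: "forcing f x - forcing f y = (0, 0, - Li (f ?u - f ?v)) + \<omega> *\<^sub>R (x - y)"
      unfolding forcing_def Li_diff[symmetric] by (simp add: scaleR_diff_right prod_eq_iff)
    have "norm (Li (f ?u - f ?v)) \<le> norm (f ?u - f ?v) / c\<^sub>L" by (rule Li_bound)
    also have "\<dots> \<le> (\<bar>\<Lambda>\<bar> * norm (x - y)) / c\<^sub>L"
    proof (intro divide_right_mono)
      have "norm (f ?u - f ?v) \<le> \<Lambda> * norm (?u - ?v)" by (rule f)
      also have "\<dots> \<le> \<bar>\<Lambda>\<bar> * norm (x - y)"
        using norm_components(2)[of "x - y"] by (intro mult_mono) auto
      finally show "norm (f ?u - f ?v) \<le> \<bar>\<Lambda>\<bar> * norm (x - y)" .
    qed (use c\<^sub>L in simp)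
    finally have "norm (0 :: 'v, 0 :: 'v, - Li (f ?u - f ?v)) \<le> (\<bar>\<Lambda>\<bar> / c\<^sub>L) * norm (x - y)"
      by (simp add: norm_Pair)
    also have "\<dots> \<le> (\<bar>\<Lambda>\<bar> / c\<^sub>L) * (X.N (x - y) / sqrt c\<^sub>Q)"
      using X.norm_le_N[of "x - y"] c\<^sub>L by (intro mult_left_mono) auto
    finally have "K0 * norm (0 :: 'v, 0 :: 'v, - Li (f ?u - f ?v)) \<le> K0 * ((\<bar>\<Lambda>\<bar> / c\<^sub>L) * (X.N (x - y) / sqrt c\<^sub>Q))"
      by (rule mult_left_mono) (use K0 in simp)
    then have "X.N (0, 0, - Li (f ?u - f ?v)) \<le> K0 * (\<bar>\<Lambda>\<bar> / c\<^sub>L) / sqrt c\<^sub>Q * X.N (x - y)"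
      using K0(2)[of "(0, 0, - Li (f ?u - f ?v))"] by simp
    moreover have "X.N (\<omega> *\<^sub>R (x - y)) = \<omega> * X.N (x - y)" using \<omega> by (simp add: X.N_scale)
    ultimately show ?thesis unfolding eq K_def
      using X.N_triangle[of "(0, 0, - Li (f ?u - f ?v))" "\<omega> *\<^sub>R (x - y)"] by (simp add: distrib_right)
  qed
  moreover have "K \<ge> 0" using K0 c\<^sub>L c\<^sub>Q \<omega> by (simp add: K_def)
  ultimately show ?thesis by blast
qed

text \<open>The first line of \<open>state_rel\<close> expresses A1 \<theta> by the derivative and
  the velocity, so (A5) bounds B2 \<theta>. The quantity estimated represents the sum B1 v + A2
  \<phi>.\<close>

lemma state_rel_bound:
  "\<exists>C\<ge>0. \<forall>x y. state_rel x y \<longrightarrow> norm (L (snd (snd y)) + B2 (\<iota> (fst x))) \<le> C * (norm x + norm y)"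
proof -
  define C where "C = norm L + C\<^sub>A\<^sub>B * (norm \<iota> + \<eta> + norm \<iota>)"
  have "norm (L (snd (snd y)) + B2 (\<iota> (fst x))) \<le> C * (norm x + norm y)" if "state_rel x y" for x y
  proof -
    have r: "\<iota> (fst x) \<in> DA1" "\<iota> (fst y) = A1 (\<iota> (fst x)) + \<eta> *\<^sub>R snd (snd x)" using that by (auto simp: state_rel_def)
    let ?s = "norm x + norm y"
    have s: "norm x \<le> ?s" "norm y \<le> ?s" by auto
    have "norm (L (snd (snd y))) \<le> norm L * ?s"
      using norm_blinfun[of L "snd (snd y)"] norm_components(3)[of y] s
      by (meson mult_left_mono norm_ge_zero order_trans)
    moreover have i: "norm (\<iota> (fst z)) \<le> norm \<iota> * ?s" if "norm z \<le> ?s" for z :: "'v \<times> 'v \<times> 'h"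
      using norm_blinfun[of \<iota> "fst z"] norm_components(1)[of z] that
      by (meson mult_left_mono norm_ge_zero order_trans)
    have "norm (A1 (\<iota> (fst x))) \<le> norm \<iota> * ?s + \<eta> * ?s"
    proof -
      have "A1 (\<iota> (fst x)) = \<iota> (fst y) - \<eta> *\<^sub>R snd (snd x)" using r(2) by simp
      then have "norm (A1 (\<iota> (fst x))) \<le> norm (\<iota> (fst y)) + \<eta> * norm (snd (snd x))"
        using norm_triangle_ineq4[of "\<iota> (fst y)" "\<eta> *\<^sub>R snd (snd x)"] \<eta> by simp
      also have "\<dots> \<le> norm \<iota> * ?s + \<eta> * ?s"
        using i[OF s(2)] order_trans[OF norm_components(3)[of x] s(1)] \<eta> by (intro add_mono mult_left_mono) auto
      finally show ?thesis .
    qed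
    then have "norm (B2 (\<iota> (fst x))) \<le> C\<^sub>A\<^sub>B * ((norm \<iota> * ?s + \<eta> * ?s) + norm \<iota> * ?s)"
      using i[OF s(1)] C\<^sub>A\<^sub>B by (intro order_trans[OF B2_bound[OF r(1)]] mult_left_mono add_mono) auto
    ultimately show ?thesis
      using norm_triangle_ineq[of "L (snd (snd y))" "B2 (\<iota> (fst x))"] by (simp add: C_def algebra_simps)
  qed
  moreover have "C \<ge> 0" using C\<^sub>A\<^sub>B \<eta> by (simp add: C_def)
  ultimately show ?thesis by blast
qed

text \<open>
  In one implicit step \<open>v'\<close> is proportional to \<open>u' - u\<close>, so \<open>u'\<close> solves a stationary problem to which (A10)
  applies, and the mixed term in the test with \<open>B1 v'\<close> telescopes.
\<close>

lemma implicit_step_regularity: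
  assumes state_rel: "state_rel x' y'" and \<kappa>: "\<kappa> > 0" and step: "- fst (snd y') = \<kappa> *\<^sub>R (fst (snd x') - u)"
    and u: "\<iota> u \<in> DB1 \<inter> DA2"
    and r: "r = L (snd (snd y')) + B2 (\<iota> (fst x'))"
  defines "u' \<equiv> fst (snd x')" and "v' \<equiv> snd (snd x')"
  shows "\<iota> u' \<in> DB1 \<inter> DA2" "v' \<in> DB1"
    "(norm (B1 v'))\<^sup>2 \<le> (norm r)\<^sup>2 + \<kappa> * (B1 (\<iota> u) \<bullet> A2 (\<iota> u) - B1 (\<iota> u') \<bullet> A2 (\<iota> u'))"
proof -
  have y': "fst (snd y') = - (\<kappa> *\<^sub>R (u' - u))" using step by (metis minus_minus u'_def)
  have v': "v' = \<kappa> *\<^sub>R (\<iota> u' - \<iota> u)"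
    using state_rel by (simp add: state_rel_def y' v'_def blinfun.minus_right blinfun.scaleR_right blinfun.diff_right)
  have A2r: "A2s u' - B1s (fst (snd y')) = to_dual \<iota> r" using state_rel by (simp add: state_rel_def r u'_def)
  \<comment> \<open>Since \<open>\<iota> u\<close> lies in \<open>DB1\<close>, the term with
    \<open>B1s u\<close> moved to the right is an element of H, as \<open>regularity\<close>
    requires.\<close>
  have "\<kappa> *\<^sub>R B1s u' + 1 *\<^sub>R A2s u' = to_dual \<iota> r + \<kappa> *\<^sub>R B1s u"
    using A2r unfolding y' by (simp add: blinfun.minus_right blinfun.scaleR_right blinfun.diff_right algebra_simps)
  also have "\<dots> = to_dual \<iota> (r + \<kappa> *\<^sub>R B1 (\<iota> u))"
    using B1s_eq[of u] u by (simp add: to_dual_add to_dual_scaleR)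
  finally have "\<kappa> *\<^sub>R B1s u' + 1 *\<^sub>R A2s u' = to_dual \<iota> (r + \<kappa> *\<^sub>R B1 (\<iota> u))" .
  from regularity[OF \<kappa> zero_less_one this] show u': "\<iota> u' \<in> DB1 \<inter> DA2" .
  have d: "\<iota> u' - \<iota> u \<in> DB1 \<inter> DA2" using u u' OB1.D_diff OA2.D_diff by blast
  then show v'D: "v' \<in> DB1" unfolding v' using OB1.D_subspace by (auto intro: subspace_mul)
  have B1v: "B1 v' = \<kappa> *\<^sub>R (B1 (\<iota> u') - B1 (\<iota> u))"
    unfolding v' using u u' d by (simp add: OB1.A_scale OB1.A_diff)
  have req: "A2 (\<iota> u') + B1 v' = r"
  proof (rule to_dual_inj)
    have "B1s (- fst (snd y')) = to_dual \<iota> (B1 v')"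
      using B1s_eq[of "- fst (snd y')"] v'D state_rel by (simp add: state_rel_def blinfun.minus_right v'_def)
    moreover have "A2s u' = to_dual \<iota> (A2 (\<iota> u'))" using A2s_eq u' by blast
    ultimately show "to_dual \<iota> (A2 (\<iota> u') + B1 v') = to_dual \<iota> r"
      using A2r by (simp add: to_dual_add blinfun.minus_right diff_conv_add_uminus del: add_uminus_conv_diff)
  qed
  let ?q = "\<lambda>w. B1 w \<bullet> A2 w"
  \<comment> \<open>Expanded with the symmetry from (A4), nonnegativity on the increment bounds the
    mixed term from below by a difference of values of \<open>?q\<close>.\<close>
  have "0 \<le> ?q (\<iota> u' - \<iota> u)" using B1_A2_nonneg[OF d] .
  also have "\<dots> = ?q (\<iota> u') - 2 * (B1 (\<iota> u) \<bullet> A2 (\<iota> u')) + ?q (\<iota> u)"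
    using u u' B1_A2_sym[of "\<iota> u'" "\<iota> u"] by (simp add: OB1.A_diff OA2.A_diff inner_diff_left inner_diff_right)
  finally have "2 * (A2 (\<iota> u') \<bullet> (B1 (\<iota> u') - B1 (\<iota> u))) \<ge> ?q (\<iota> u') - ?q (\<iota> u)"
    by (simp add: inner_diff_right inner_commute)
  then have q: "2 * (A2 (\<iota> u') \<bullet> B1 v') \<ge> \<kappa> * (?q (\<iota> u') - ?q (\<iota> u))"
    unfolding B1v using \<kappa> by (simp add: mult.left_commute)
  have "B1 v' \<bullet> B1 v' + A2 (\<iota> u') \<bullet> B1 v' = r \<bullet> B1 v'" by (simp add: req[symmetric] inner_add_left)
  moreover have "2 * (r \<bullet> B1 v') \<le> (norm r)\<^sup>2 + (norm (B1 v'))\<^sup>2"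
    using norm_cauchy_schwarz[of r "B1 v'"] sum_squares_bound[of "norm r" "norm (B1 v')"] by simp
  ultimately show "(norm (B1 v'))\<^sup>2 \<le> (norm r)\<^sup>2 + \<kappa> * (?q (\<iota> u) - ?q (\<iota> u'))"
    using q by (simp add: power2_norm_eq_inner algebra_simps)
qed

end

section \<open>Solutions of the truncated problem\<close>

lemma integrable_Ioo_continuous:
  fixes g :: "real \<Rightarrow> 'b::{banach, second_countable_topology}"
  assumes "continuous_on UNIV g"
  shows "integrable (lebesgue_on {a<..<b}) g"
proof -
  have "bounded (g ` {a..b})"
    using assms by (intro compact_imp_bounded compact_continuous_image) (auto intro: continuous_on_subset)
  then obtain C where "\<And>t. t \<in> {a..b} \<Longrightarrow> norm (g t) \<le> C" unfolding bounded_iff by blast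
  then show ?thesis
    using assms by (intro integrable_Ioo_bounded[of _ _ _ C] borel_measurable_lebesgue_onI borel_measurable_continuous_onI AE_I2) auto
qed

context coupled_system
begin

lemma OB1_N: "OB1.N x = norm x"
  by (simp add: OB1.N_def norm_eq_sqrt_inner)

theorem truncated_solution:
  assumes f: "\<And>u v. norm (f u - f v) \<le> \<Lambda> * norm (u - v)" and T: "T > 0"
    and U0: "U0 \<in> state_dom" "\<iota> (fst (snd U0)) \<in> DB1 \<inter> DA2"
  shows "\<exists>U dU M R. has_time_derivative T U dU \<and> U 0 = U0 \<and> M-lipschitz_on UNIV U
      \<and> dU \<in> borel_measurable borel \<and> (\<forall>t. norm (dU t) \<le> R)
      \<and> (\<forall>t. U t \<in> state_dom \<and> dU t = (0, 0, - Li (f (fst (snd (U t))))) - generator (U t))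
      \<and> (AE t in lebesgue_on {0<..<T}. snd (snd (U t)) \<in> DB1)
      \<and> (\<lambda>t. B1 (snd (snd (U t)))) \<in> L2_space T"
proof -
  obtain K where K: "K \<ge> 0" "\<And>x y. X.N (forcing f x - forcing f y) \<le> K * X.N (x - y)"
    using forcing_lipschitz[OF f] by blast
  interpret ev: evolution Q c\<^sub>Q state_dom shifted_generator "forcing f" K T U0
    by (intro evolution.intro evolution_axioms.intro X.accretive_operator_axioms K T U0)
  obtain C where C: "C \<ge> 0" "\<And>x y. state_rel x y \<Longrightarrow> norm (L (snd (snd y)) + B2 (\<iota> (fst x))) \<le> C * (norm x + norm y)"
    using state_rel_bound by blast
  \<comment> \<open>Bounds uniform in the step size: \<open>R1\<close> for the scheme,
    \<open>R2\<close> for the generator along it, and \<open>Rr\<close> for the H-valued sum B1 v +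
    A2 \<phi>.\<close>
  define R1 where "R1 = norm U0 + T * ev.M / sqrt c\<^sub>Q"
  define R2 where "R2 = ev.M1 / sqrt c\<^sub>Q + \<omega> * R1"
  define Rr where "Rr = C * (R1 + R2)"
  define q where "q w = B1 w \<bullet> A2 w" for w
  have R1: "norm (ev.E h n) \<le> R1" if h: "h > 0" "h * real n \<le> T" for h n
  proof -
    have "norm (ev.E h n - U0) \<le> X.N (ev.E h n - U0) / sqrt c\<^sub>Q" by (rule X.norm_le_N)
    also have "X.N (ev.E h n - U0) \<le> h * real n * ev.M" using ev.E_lip[OF h(1), of 0 n] h by simp
    also have "\<dots> \<le> T * ev.M" using h ev.M_nonneg by (intro mult_right_mono)
    finally have "norm (ev.E h n - U0) \<le> T * ev.M / sqrt c\<^sub>Q" using c\<^sub>Q by (simp add: divide_right_mono)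
    then show ?thesis unfolding R1_def using norm_triangle_sub[of "ev.E h n" U0] by linarith
  qed
  have reg: "\<iota> (fst (snd (ev.E h n))) \<in> DB1 \<inter> DA2 \<and> snd (snd (ev.E h (Suc n))) \<in> DB1 \<and>
      (h * real (Suc n) \<le> T \<longrightarrow> h * (norm (B1 (snd (snd (ev.E h (Suc n))))))\<^sup>2
        \<le> h * Rr\<^sup>2 + (1 + h * \<omega>) * (q (\<iota> (fst (snd (ev.E h n)))) - q (\<iota> (fst (snd (ev.E h (Suc n)))))))"
    if h: "h > 0" for h n
  proof -
    have step: "\<iota> (fst (snd (ev.E h (Suc n)))) \<in> DB1 \<inter> DA2 \<and> snd (snd (ev.E h (Suc n))) \<in> DB1 \<and>
      (h * real (Suc n) \<le> T \<longrightarrow> h * (norm (B1 (snd (snd (ev.E h (Suc n))))))\<^sup>2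
        \<le> h * Rr\<^sup>2 + (1 + h * \<omega>) * (q (\<iota> (fst (snd (ev.E h n)))) - q (\<iota> (fst (snd (ev.E h (Suc n)))))))"
      if u: "\<iota> (fst (snd (ev.E h n))) \<in> DB1 \<inter> DA2" for n
    proof -
      define e e' y' where "e = ev.E h n" and "e' = ev.E h (Suc n)" and "y' = generator e'"
      \<comment> \<open>The Euler step contributes 1/h; \<omega> appears because the shift is
        implicit in the generator and explicit in the forcing.\<close>
      define \<kappa> where "\<kappa> = 1 / h + \<omega>"
      have \<kappa>: "\<kappa> > 0" "h * \<kappa> = 1 + h * \<omega>" using h \<omega> by (auto simp: \<kappa>_def algebra_simps add_pos_pos)
      have state_rel: "state_rel e' y'" unfolding y'_def e'_def by (rule generator_rel[OF ev.E_in[OF h]])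
      have "e' - e = h *\<^sub>R (forcing f e - shifted_generator e')" unfolding e_def e'_def by (rule ev.E_step[OF h])
      from arg_cong[OF this, of "\<lambda>x. fst (snd x)"]
      have "fst (snd e') - fst (snd e) = h *\<^sub>R (\<omega> *\<^sub>R fst (snd e) - (fst (snd y') + \<omega> *\<^sub>R fst (snd e')))"
        by (simp add: forcing_def shifted_generator_def y'_def)
      then have "(1/h) *\<^sub>R (fst (snd e') - fst (snd e)) = \<omega> *\<^sub>R fst (snd e) - (fst (snd y') + \<omega> *\<^sub>R fst (snd e'))"
        using h by simp
      then have "- fst (snd y') = \<kappa> *\<^sub>R (fst (snd e') - fst (snd e))"
        by (simp add: \<kappa>_def algebra_simps)
      note isr = implicit_step_regularity[OF state_rel \<kappa>(1) this u[folded e_def] refl]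
      have "h * (norm (B1 (snd (snd e'))))\<^sup>2 \<le> h * Rr\<^sup>2 + (1 + h * \<omega>) * (q (\<iota> (fst (snd e))) - q (\<iota> (fst (snd e'))))"
        if hn: "h * real (Suc n) \<le> T"
      proof -
        have "norm e' \<le> R1" unfolding e'_def using R1[OF h hn] .
        have "norm (shifted_generator e') \<le> X.N (shifted_generator e') / sqrt c\<^sub>Q" by (rule X.norm_le_N)
        also have "\<dots> \<le> ev.M1 / sqrt c\<^sub>Q" using ev.A_bound[OF h hn] c\<^sub>Q by (simp add: e'_def divide_right_mono)
        finally have "norm (shifted_generator e') \<le> ev.M1 / sqrt c\<^sub>Q" .
        moreover have "norm y' \<le> norm (shifted_generator e') + \<omega> * norm e'"
          using norm_triangle_ineq4[of "shifted_generator e'" "\<omega> *\<^sub>R e'"] \<omega> by (simp add: shifted_generator_def y'_def)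
        moreover have "\<omega> * norm e' \<le> \<omega> * R1" using \<open>norm e' \<le> R1\<close> \<omega> by simp
        ultimately have "norm y' \<le> R2" unfolding R2_def by linarith
        then have "norm (L (snd (snd y')) + B2 (\<iota> (fst e'))) \<le> Rr"
          unfolding Rr_def using \<open>norm e' \<le> R1\<close> C(1) by (intro order_trans[OF C(2)[OF state_rel]] mult_left_mono) auto
        then have "(norm (L (snd (snd y')) + B2 (\<iota> (fst e'))))\<^sup>2 \<le> Rr\<^sup>2" by (intro power_mono) auto
        then have "(norm (B1 (snd (snd e'))))\<^sup>2 \<le> Rr\<^sup>2 + \<kappa> * (q (\<iota> (fst (snd e))) - q (\<iota> (fst (snd e'))))"
          using isr(3) unfolding q_def by linarith
        then have "h * (norm (B1 (snd (snd e'))))\<^sup>2 \<le> h * (Rr\<^sup>2 + \<kappa> * (q (\<iota> (fst (snd e))) - q (\<iota> (fst (snd e')))))"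
          using h by simp
        also have "\<dots> = h * Rr\<^sup>2 + (h * \<kappa>) * (q (\<iota> (fst (snd e))) - q (\<iota> (fst (snd e'))))"
          by (simp add: algebra_simps)
        finally show ?thesis unfolding \<kappa>(2) .
      qed
      then show ?thesis using isr(1,2) unfolding e_def e'_def by blast
    qed
    \<comment> \<open>Regularity after one step is the hypothesis of the next, so it propagates from
      the initial displacement.\<close>
    have "\<iota> (fst (snd (ev.E h n))) \<in> DB1 \<inter> DA2" for n
      by (induction n) (use U0 step in auto)
    then show ?thesis using step by blast
  qed
  \<comment> \<open>The differences of \<open>q\<close> telescope; since \<open>q\<close> is
    nonnegative at the last index, only its initial value will enter \<open>C0\<close>.\<close>
  have sum: "h * (\<Sum>j<n. (norm (B1 (snd (snd (ev.E h (Suc j))))))\<^sup>2) + (1 + h * \<omega>) * q (\<iota> (fst (snd (ev.E h n))))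
      \<le> h * real n * Rr\<^sup>2 + (1 + h * \<omega>) * q (\<iota> (fst (snd U0)))" if h: "h > 0" "h * real n \<le> T" for h n
    using h(2)
  proof (induction n)
    case (Suc n)
    have "h * real n \<le> T" using Suc(2) h by (simp add: algebra_simps)
    then show ?case using Suc(1) reg[OF h(1), of n] Suc(2) by (simp add: algebra_simps)
  qed simp
  define C0 where "C0 = T * Rr\<^sup>2 + (1 + T * \<omega>) * q (\<iota> (fst (snd U0)))"
  have hm: "ev.h m > 0" "ev.h m \<le> T" "ev.h m * real (2 ^ m) = T" for m
    using T by (auto simp: ev.h_def divide_simps)
  have q0: "0 \<le> q (\<iota> (fst (snd (ev.E h n))))" if "h > 0" for h n
    unfolding q_def using B1_A2_nonneg reg[OF that] by blast
  have sumC: "ev.h m * (\<Sum>j<2 ^ m. (norm (B1 (snd (snd (ev.E (ev.h m) (Suc j))))))\<^sup>2) \<le> C0" for m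
  proof -
    have "0 \<le> (1 + ev.h m * \<omega>) * q (\<iota> (fst (snd (ev.E (ev.h m) (2 ^ m)))))"
      using q0[OF hm(1)] hm(1)[of m] \<omega> by simp
    moreover have "(1 + ev.h m * \<omega>) * q (\<iota> (fst (snd U0))) \<le> (1 + T * \<omega>) * q (\<iota> (fst (snd U0)))"
      using q0[OF hm(1), of m 0] hm(2)[of m] \<omega> by (intro mult_right_mono) auto
    moreover have "ev.h m * real (2 ^ m) * Rr\<^sup>2 = T * Rr\<^sup>2" unfolding hm(3) ..
    ultimately show ?thesis using sum[OF hm(1), of m "2 ^ m"] hm(3)[of m] unfolding C0_def by linarith
  qed
  define v where "v t = snd (snd (ev.U t))" for t
  have v: "continuous_on UNIV v"
    unfolding v_def by (intro continuous_intros ev.U_continuous)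
  have Yint: "integrable (lebesgue_on {0<..<T}) (\<lambda>t. (OB1.N (OB1.Y lam (v t)))\<^sup>2)" if "lam > 0" for lam
    unfolding OB1_N by (intro integrable_Ioo_continuous continuous_intros OB1.Y_continuous v that)
  \<comment> \<open>For fixed \<open>lam\<close> the operator \<open>OB1.Y lam\<close> is bounded,
    so the distance between limit and scheme contributes an error that vanishes as the grid is
    refined. What remains does not depend on \<open>lam\<close>, as \<open>yosida_fatou\<close>
    requires; the factor 2 comes from squaring a sum.\<close>
  have bound: "integral\<^sup>L (lebesgue_on {0<..<T}) (\<lambda>t. (OB1.N (OB1.Y lam (v t)))\<^sup>2) \<le> 2 * C0" if lam: "lam > 0" for lam
  proof -
    interpret Y: bounded_linear "OB1.Y lam" using lam by (rule OB1.Y_bounded_linear)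
    obtain k where k: "\<And>x. norm (OB1.Y lam x) \<le> norm x * k" "k > 0" using Y.pos_bounded by blast
    define \<epsilon> where "\<epsilon> m = (ev.B * ev.\<rho> ^ m + ev.h m * ev.M) / sqrt c\<^sub>Q" for m
    have \<epsilon>: "\<epsilon> \<longlonglongrightarrow> (0 + 0 * ev.M) / sqrt c\<^sub>Q"
      unfolding \<epsilon>_def using c\<^sub>Q by (intro tendsto_intros ev.rate_tendsto ev.h_tendsto) simp
    have le: "integral\<^sup>L (lebesgue_on {0<..<T}) (\<lambda>t. (OB1.N (OB1.Y lam (v t)))\<^sup>2) \<le> 2 * C0 + T * (2 * (\<epsilon> m * k)\<^sup>2)" for m
    proof -
      let ?b = "\<lambda>j. 2 * (norm (B1 (snd (snd (ev.E (ev.h m) (Suc j))))))\<^sup>2 + 2 * (\<epsilon> m * k)\<^sup>2"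
      have nh: "real (2 ^ m) * ev.h m = T" using hm(3)[of m] by (simp add: mult.commute)
      have "integral\<^sup>L (lebesgue_on {0<..<real (2 ^ m) * ev.h m}) (\<lambda>t. (OB1.N (OB1.Y lam (v t)))\<^sup>2) \<le> ev.h m * (\<Sum>j<2 ^ m. ?b j)"
      proof (rule integral_le_sum[OF hm(1)])
        show "integrable (lebesgue_on {0<..<real (2 ^ m) * ev.h m}) (\<lambda>t. (OB1.N (OB1.Y lam (v t)))\<^sup>2)"
          unfolding nh by (rule Yint[OF lam])
        fix j :: nat and t :: real
        assume j: "j < 2 ^ m" and t: "real j * ev.h m < t" "t < real (Suc j) * ev.h m"
        let ?w = "snd (snd (ev.E (ev.h m) (Suc j)))"
        have "real (Suc j) * ev.h m \<le> real (2 ^ m) * ev.h m"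
          using j hm(1)[of m] by (intro mult_right_mono) (auto simp del: of_nat_Suc of_nat_power simp: Suc_le_eq)
        then have "t \<le> T" using t nh by linarith
        then have "X.N (ev.U t - ev.E (ev.h m) (Suc j)) \<le> ev.B * ev.\<rho> ^ m + ev.h m * ev.M"
          using t by (intro ev.U_E_close) auto
        then have "norm (ev.U t - ev.E (ev.h m) (Suc j)) \<le> \<epsilon> m"
          unfolding \<epsilon>_def using X.norm_le_N[of "ev.U t - ev.E (ev.h m) (Suc j)"] c\<^sub>Q
          by (meson divide_right_mono order_trans real_sqrt_ge_zero less_imp_le)
        then have d: "norm (v t - ?w) \<le> \<epsilon> m"
          using norm_components(3)[of "ev.U t - ev.E (ev.h m) (Suc j)"] by (simp add: v_def)
        have "norm (OB1.Y lam ?w) \<le> norm (B1 ?w)"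
          using OB1.N_Y_le[OF lam] reg[OF hm(1)] unfolding OB1_N by blast
        moreover have "norm (OB1.Y lam (v t - ?w)) \<le> \<epsilon> m * k"
          using k d by (intro order_trans[OF k(1)] mult_right_mono) auto
        ultimately have "norm (OB1.Y lam (v t)) \<le> norm (B1 ?w) + \<epsilon> m * k"
          using norm_triangle_sub[of "OB1.Y lam (v t)" "OB1.Y lam ?w"] unfolding Y.diff by linarith
        then have "(norm (OB1.Y lam (v t)))\<^sup>2 \<le> (norm (B1 ?w) + \<epsilon> m * k)\<^sup>2" by (intro power_mono) auto
        also have "\<dots> \<le> ?b j" using sum_squares_bound[of "norm (B1 ?w)" "\<epsilon> m * k"] by (simp add: power2_sum)
        finally show "(OB1.N (OB1.Y lam (v t)))\<^sup>2 \<le> ?b j" unfolding OB1_N .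
      qed
      also have "ev.h m * (\<Sum>j<2 ^ m. ?b j)
          = 2 * (ev.h m * (\<Sum>j<2 ^ m. (norm (B1 (snd (snd (ev.E (ev.h m) (Suc j))))))\<^sup>2)) + (ev.h m * real (2 ^ m)) * (2 * (\<epsilon> m * k)\<^sup>2)"
        by (simp add: sum.distrib sum_distrib_left[symmetric] distrib_left mult.left_commute del: ev.E.simps)
      also have "\<dots> \<le> 2 * C0 + T * (2 * (\<epsilon> m * k)\<^sup>2)" using sumC[of m] hm(3)[of m] by simp
      finally show ?thesis unfolding nh .
    qed
    have "(\<lambda>m. 2 * C0 + T * (2 * (\<epsilon> m * k)\<^sup>2)) \<longlonglongrightarrow> 2 * C0 + T * (2 * ((0 + 0 * ev.M) / sqrt c\<^sub>Q * k)\<^sup>2)"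
      by (intro tendsto_intros \<epsilon>)
    from LIMSEQ_le_const[OF this] le show ?thesis by simp
  qed
  have sq: "(1::real) / real (Suc n) > 0" for n by simp
  note fatou = OB1.yosida_fatou[OF v, of T "2 * C0", OF Yint[OF sq] bound[OF sq]]
  obtain R where R: "\<And>t. norm (ev.dU t) \<le> R" using ev.dU_bounded by blast
  have "ev.dU t = (0, 0, - Li (f (fst (snd (ev.U t))))) - generator (ev.U t)" for t
    by (simp add: ev.dU_def forcing_def shifted_generator_def)
  moreover have "(\<lambda>t. B1 (v t)) \<in> L2_space T" using fatou(2,3) by (simp add: L2_space_def)
  ultimately show ?thesis
    using ev.U_derivative ev.U_zero ev.U_lipschitz ev.dU_measurable R ev.U_props(1) fatou(1)
    unfolding v_def by blast
qed

end

section \<open>The energy bound\<close>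

definition retraction_ball :: "real \<Rightarrow> 'a::real_normed_vector \<Rightarrow> 'a" where
  "retraction_ball R x = (R / max R (norm x)) *\<^sub>R x"

text \<open>Splitting the difference into a scaled difference and a change of the scaling factor
  gives the constant 2 in any normed space, enough to make the truncated \<Phi> globally
  Lipschitz.\<close>

lemma retraction_ball:
  assumes R: "R > 0"
  shows norm_retraction_ball: "norm (retraction_ball R x) \<le> R"
    and retraction_ball_id: "norm x \<le> R \<Longrightarrow> retraction_ball R x = x"
    and retraction_ball_lipschitz: "norm (retraction_ball R x - retraction_ball R y) \<le> 2 * norm (x - y)"
proof -
  define a b where "a = max R (norm x)" and "b = max R (norm y)"
  have ab: "R \<le> a" "norm x \<le> a" "R \<le> b" "norm y \<le> b" "0 < a" "0 < b" using R by (auto simp: a_def b_def)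
  have "R * norm x \<le> R * a" using ab R by simp
  then show "norm (retraction_ball R x) \<le> R"
    using R ab by (simp add: retraction_ball_def a_def[symmetric] pos_divide_le_eq)
  show "norm x \<le> R \<Longrightarrow> retraction_ball R x = x" using R by (simp add: retraction_ball_def max_def)
  have eq: "retraction_ball R x - retraction_ball R y = (R / a) *\<^sub>R (x - y) + (R / a - R / b) *\<^sub>R y"
    by (simp add: retraction_ball_def a_def b_def algebra_simps)
  have 1: "norm ((R / a) *\<^sub>R (x - y)) \<le> 1 * norm (x - y)"
    unfolding norm_scaleR using R ab by (intro mult_right_mono) auto
  have "\<bar>b - a\<bar> \<le> norm (x - y)"
    unfolding a_def b_def using norm_triangle_ineq3[of x y] by (auto simp: max_def abs_if split: if_splits)
  have "R / a - R / b = R * (b - a) / (a * b)" using ab by (simp add: field_simps)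
  then have "norm ((R / a - R / b) *\<^sub>R y) = (R / a) * (norm y / b) * \<bar>b - a\<bar>"
    using R ab by (simp add: abs_mult)
  also have "\<dots> \<le> 1 * 1 * \<bar>b - a\<bar>" using R ab by (intro mult_right_mono mult_mono) auto
  finally have 2: "norm ((R / a - R / b) *\<^sub>R y) \<le> norm (x - y)" using \<open>\<bar>b - a\<bar> \<le> norm (x - y)\<close> by simp
  show "norm (retraction_ball R x - retraction_ball R y) \<le> 2 * norm (x - y)"
    unfolding eq using norm_triangle_ineq[of "(R / a) *\<^sub>R (x - y)" "(R / a - R / b) *\<^sub>R y"] 1 2 by linarith
qed

lemma bounded_measurable_spaces:
  fixes u :: "real \<Rightarrow> 'b::{banach, second_countable_topology}"
  assumes u: "u \<in> borel_measurable (lebesgue_on {0<..<T})" and b: "\<And>t. t \<in> {0<..<T} \<Longrightarrow> norm (u t) \<le> C"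
  shows "u \<in> Linf_space T" "u \<in> L2_space T"
proof -
  show "u \<in> Linf_space T" using u b by (auto simp: Linf_space_def intro!: exI[of _ C])
  have "integrable (lebesgue_on {0<..<T}) (\<lambda>t. (norm (u t))\<^sup>2)"
  proof (rule integrable_Ioo_bounded)
    show "(\<lambda>t. (norm (u t))\<^sup>2) \<in> borel_measurable (lebesgue_on {0<..<T})" using u by measurable
    show "AE t in lebesgue_on {0<..<T}. norm ((norm (u t))\<^sup>2) \<le> C\<^sup>2" using b by (auto intro!: power_mono)
  qed
  then show "u \<in> L2_space T" using u by (simp add: L2_space_def)
qed

locale coupled_problem = coupled_system \<eta> \<iota> L DA1 DA2 DB1 DB2 A1 A2 B1 B2 A1s A2s B1s c\<^sub>L C\<^sub>A\<^sub>B
  for \<eta> :: real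
    and \<iota> :: "'v::{real_inner, banach, second_countable_topology}
                \<Rightarrow>\<^sub>L 'h::{real_inner, banach, second_countable_topology}"
    and L DA1 DA2 DB1 DB2 A1 A2 B1 B2 A1s A2s B1s c\<^sub>L C\<^sub>A\<^sub>B +
  fixes T :: real and \<Phi> \<L> :: "'h \<Rightarrow> 'h" and i :: "'v \<Rightarrow> real" and p q C\<^sub>\<Phi> C\<^sub>\<L> :: real
    and \<theta>0 \<phi>0 v0 :: 'h
  assumes T: "T > 0"
    and pq: "p > 0" "q > 0" and C\<^sub>\<Phi>: "C\<^sub>\<Phi> > 0"
    and \<Phi>_lip: "norm (\<Phi> (\<iota> w) - \<Phi> (\<iota> z)) \<le> C\<^sub>\<Phi> * (1 + norm w powr p + norm z powr q) * norm (w - z)"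
    and i_nonneg: "0 \<le> i w" and i_sub: "i w - i z \<le> \<Phi> (\<iota> w) \<bullet> (\<iota> w - \<iota> z)"
    and C\<^sub>\<L>: "C\<^sub>\<L> > 0" and \<L>_lip: "norm (\<L> x - \<L> y) \<le> C\<^sub>\<L> * norm (x - y)"
    and initial: "\<theta>0 \<in> DA1" "A1 \<theta>0 \<in> range \<iota>" "\<phi>0 \<in> DB1 \<inter> DA2" "v0 \<in> DB1 \<inter> range \<iota>"
begin

text \<open>The Lipschitz constant that (A6) provides on the ball of radius \<open>R\<close> in
  V.\<close>

definition \<Lambda> :: "real \<Rightarrow> real" where "\<Lambda> R = C\<^sub>\<Phi> * (1 + R powr p + R powr q)"

lemma \<Lambda>_nonneg: "0 \<le> \<Lambda> R" using C\<^sub>\<Phi> by (simp add: \<Lambda>_def)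

lemma \<Phi>_ball:
  assumes "norm w \<le> R" "norm z \<le> R"
  shows "norm (\<Phi> (\<iota> w) - \<Phi> (\<iota> z)) \<le> \<Lambda> R * norm (w - z)"
proof -
  have "C\<^sub>\<Phi> * (1 + norm w powr p + norm z powr q) \<le> \<Lambda> R"
    unfolding \<Lambda>_def using assms pq C\<^sub>\<Phi> by (intro mult_left_mono add_mono powr_mono2) auto
  then show ?thesis using \<Phi>_lip[of w z] by (meson mult_right_mono norm_ge_zero order_trans)
qed

lemma \<Phi>_retraction:
  assumes R: "R > 0"
  shows "norm (\<Phi> (\<iota> (retraction_ball R w)) - \<Phi> (\<iota> (retraction_ball R z))) \<le> 2 * \<Lambda> R * norm (w - z)"
proof -
  have "norm (\<Phi> (\<iota> (retraction_ball R w)) - \<Phi> (\<iota> (retraction_ball R z)))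
      \<le> \<Lambda> R * norm (retraction_ball R w - retraction_ball R z)"
    by (intro \<Phi>_ball norm_retraction_ball R)
  also have "\<dots> \<le> \<Lambda> R * (2 * norm (w - z))"
    by (intro mult_left_mono retraction_ball_lipschitz R \<Lambda>_nonneg)
  finally show ?thesis by simp
qed

lemma \<Phi>_retraction_continuous: "R > 0 \<Longrightarrow> continuous_on UNIV (\<lambda>w. \<Phi> (\<iota> (retraction_ball R w)))"
  by (rule lipschitz_on_continuous_on[of "2 * \<Lambda> R"], rule lipschitz_onI)
    (use \<Phi>_retraction \<Lambda>_nonneg in \<open>auto simp: dist_norm\<close>)

lemma bounded_on_balls:
  assumes "norm w \<le> R"
  shows "norm (\<Phi> (\<iota> w)) \<le> norm (\<Phi> (\<iota> 0)) + \<Lambda> R * R" "norm (\<L> (\<iota> w)) \<le> norm (\<L> 0) + C\<^sub>\<L> * (norm \<iota> * R)"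
proof -
  have R: "0 \<le> R" using assms norm_ge_zero order_trans by blast
  have "norm (\<Phi> (\<iota> w) - \<Phi> (\<iota> 0)) \<le> \<Lambda> R * norm (w - 0)" using R assms by (intro \<Phi>_ball) auto
  also have "\<dots> \<le> \<Lambda> R * R" using assms \<Lambda>_nonneg by (intro mult_left_mono) auto
  finally show "norm (\<Phi> (\<iota> w)) \<le> norm (\<Phi> (\<iota> 0)) + \<Lambda> R * R"
    using norm_triangle_sub[of "\<Phi> (\<iota> w)" "\<Phi> (\<iota> 0)"] by linarith
  have "norm (\<iota> w) \<le> norm \<iota> * R"
    using norm_blinfun[of \<iota> w] assms by (meson mult_left_mono norm_ge_zero order_trans)
  then have "norm (\<L> (\<iota> w) - \<L> 0) \<le> C\<^sub>\<L> * (norm \<iota> * R)"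
    using C\<^sub>\<L> by (intro order_trans[OF \<L>_lip] mult_left_mono) auto
  then show "norm (\<L> (\<iota> w)) \<le> norm (\<L> 0) + C\<^sub>\<L> * (norm \<iota> * R)"
    using norm_triangle_sub[of "\<L> (\<iota> w)" "\<L> 0"] by linarith
qed

text \<open>(A7), used with its two arguments in either order, makes \<open>i\<close> Lipschitz on
  balls, where \<Phi> is bounded. Continuity of the energy in time rests on this.\<close>

lemma i_continuous: "continuous_on (cball 0 R) i"
proof (cases "R < 0")
  case False
  define b where "b = norm (\<Phi> (\<iota> 0)) + \<Lambda> R * R"
  have b: "norm (\<Phi> (\<iota> w)) \<le> b" if "norm w \<le> R" for w
    unfolding b_def using that by (rule bounded_on_balls(1))
  have b0: "0 \<le> b" using False \<Lambda>_nonneg by (simp add: b_def)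
  have le: "i w - i z \<le> b * norm \<iota> * norm (w - z)" if "norm w \<le> R" for w z
  proof -
    have "i w - i z \<le> norm (\<Phi> (\<iota> w)) * norm (\<iota> w - \<iota> z)"
      using i_sub norm_cauchy_schwarz order_trans by blast
    also have "\<dots> \<le> b * (norm \<iota> * norm (w - z))"
      using b[OF that] norm_blinfun[of \<iota> "w - z"] b0 by (intro mult_mono) (auto simp: blinfun.diff_right)
    finally show ?thesis by (simp add: mult.assoc)
  qed
  show ?thesis
  proof (rule lipschitz_on_continuous_on, rule lipschitz_onI)
    show "dist (i w) (i z) \<le> b * norm \<iota> * dist w z" if "w \<in> cball 0 R" "z \<in> cball 0 R" for w z
      using le[of w z] le[of z w] that by (simp add: dist_norm norm_minus_commute[of z w] abs_le_iff)
  qed (use b0 in simp)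
qed simp

definition truncated_forcing :: "real \<Rightarrow> 'v \<Rightarrow> 'h" where "truncated_forcing R u = \<Phi> (\<iota> (retraction_ball R u)) + \<L> (\<iota> u)"

lemma truncated_forcing_lipschitz:
  assumes R: "R > 0"
  shows "norm (truncated_forcing R u - truncated_forcing R w) \<le> (2 * \<Lambda> R + C\<^sub>\<L> * norm \<iota>) * norm (u - w)"
proof -
  have "norm (\<L> (\<iota> u) - \<L> (\<iota> w)) \<le> C\<^sub>\<L> * (norm \<iota> * norm (u - w))"
    using norm_blinfun[of \<iota> "u - w"] C\<^sub>\<L>
    by (intro order_trans[OF \<L>_lip] mult_left_mono) (auto simp: blinfun.diff_right)
  then show ?thesis
    using \<Phi>_retraction[OF R, of u w]
      norm_triangle_ineq[of "\<Phi> (\<iota> (retraction_ball R u)) - \<Phi> (\<iota> (retraction_ball R w))" "\<L> (\<iota> u) - \<L> (\<iota> w)"]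
    by (simp add: truncated_forcing_def algebra_simps)
qed

text \<open>Neither \<Lambda> nor the truncation radius enters. \<open>2 * \<omega>\<close> comes
  from the linear part, the rest from Young's inequality for the product of the velocity with \<L>
  \<phi>.\<close>

definition C1 :: real where
  "C1 = 2 * \<omega> + 1 / c\<^sub>L + (norm (\<L> 0))\<^sup>2 / 2 + C\<^sub>\<L> * (1 / c\<^sub>L + 1)"

lemma C1_nonneg: "0 \<le> C1" using \<omega> c\<^sub>L C\<^sub>\<L> by (simp add: C1_def)

text \<open>The constant 1 lets the contribution of \<open>\<L> 0\<close> be bounded by a multiple
  of the energy.\<close>

definition energy :: "'v \<times> 'v \<times> 'h \<Rightarrow> real" where "energy x = 1 + Q x x / 2 + i (fst (snd x))"

lemma energy_ge: "1 \<le> energy x" "Q x x \<le> 2 * energy x"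
  using X.Q_pos[of x] i_nonneg[of "fst (snd x)"] by (auto simp: energy_def)

text \<open>The forcing contributes - (v, \<Phi> \<phi>), and since the second component of
  \<open>g\<close> is the velocity, this cancels against the term added for the potential.\<close>

lemma energy_dissipation:
  assumes x: "x \<in> state_dom" and R: "R > 0" "norm (fst (snd x)) \<le> R"
    and g: "g = (0, 0, - Li (truncated_forcing R (fst (snd x)))) - generator x"
  shows "Q x g + \<Phi> (\<iota> (fst (snd x))) \<bullet> \<iota> (fst (snd g)) \<le> C1 * energy x"
proof -
  let ?\<phi> = "fst (snd x)" and ?v = "snd (snd x)" and ?y = "energy x"
  have state_rel: "state_rel x (generator x)" using x by (rule generator_rel)
  have "\<iota> (fst (snd g)) = ?v" using state_rel by (simp add: g state_rel_def blinfun.minus_right)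
  moreover have "Q x (0, 0, - Li (truncated_forcing R ?\<phi>)) = - (?v \<bullet> truncated_forcing R ?\<phi>)"
  proof -
    have "L ?v \<bullet> Li (truncated_forcing R ?\<phi>) = ?v \<bullet> truncated_forcing R ?\<phi>" by (simp add: L_sym L_Li)
    then show ?thesis by (simp add: Q_def blinfun.zero_right)
  qed
  moreover have "truncated_forcing R ?\<phi> = \<Phi> (\<iota> ?\<phi>) + \<L> (\<iota> ?\<phi>)"
    using R by (simp add: truncated_forcing_def retraction_ball_id)
  ultimately have eq: "Q x g + \<Phi> (\<iota> ?\<phi>) \<bullet> \<iota> (fst (snd g)) = - Q (generator x) x - ?v \<bullet> \<L> (\<iota> ?\<phi>)"
    by (simp add: g X.Q.diff_right Q_sym[of x "generator x"] inner_add_right inner_commute)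
  have Qy: "- Q (generator x) x \<le> 2 * \<omega> * ?y"
  proof -
    have "\<omega> * Q x x \<le> \<omega> * (2 * ?y)" using energy_ge(2)[of x] \<omega> by (intro mult_left_mono) auto
    then show ?thesis using state_rel_energy[OF state_rel] by simp
  qed
  have b: "(norm ?v)\<^sup>2 \<le> 2 * ?y / c\<^sub>L" "(norm (\<iota> ?\<phi>))\<^sup>2 \<le> 2 * ?y"
  proof -
    have "0 \<le> c\<^sub>L * (norm ?v)\<^sup>2" "0 \<le> (norm (\<iota> (fst x)))\<^sup>2" "0 \<le> (norm (\<iota> ?\<phi>))\<^sup>2" using c\<^sub>L by auto
    then have "c\<^sub>L * (norm ?v)\<^sup>2 \<le> 2 * ?y" "(norm (\<iota> ?\<phi>))\<^sup>2 \<le> 2 * ?y"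
      using Q_H_bounds[of x] energy_ge(2)[of x] by linarith+
    then show "(norm ?v)\<^sup>2 \<le> 2 * ?y / c\<^sub>L" "(norm (\<iota> ?\<phi>))\<^sup>2 \<le> 2 * ?y" using c\<^sub>L by (auto simp: field_simps)
  qed
  have "- (?v \<bullet> \<L> (\<iota> ?\<phi>)) \<le> norm ?v * norm (\<L> (\<iota> ?\<phi>))"
    using Cauchy_Schwarz_ineq2[of ?v "\<L> (\<iota> ?\<phi>)"] by linarith
  also have "\<dots> \<le> norm ?v * (norm (\<L> 0) + C\<^sub>\<L> * norm (\<iota> ?\<phi>))"
    using \<L>_lip[of "\<iota> ?\<phi>" 0] norm_triangle_sub[of "\<L> (\<iota> ?\<phi>)" "\<L> 0"] by (intro mult_left_mono) auto
  also have "\<dots> = norm ?v * norm (\<L> 0) + C\<^sub>\<L> * (norm ?v * norm (\<iota> ?\<phi>))" by (simp add: algebra_simps)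
  also have "\<dots> \<le> (?y / c\<^sub>L + (norm (\<L> 0))\<^sup>2 / 2 * ?y) + C\<^sub>\<L> * (?y / c\<^sub>L + ?y)"
  proof (intro add_mono mult_left_mono)
    have "(norm (\<L> 0))\<^sup>2 / 2 * 1 \<le> (norm (\<L> 0))\<^sup>2 / 2 * ?y" by (intro mult_left_mono energy_ge) simp
    then show "norm ?v * norm (\<L> 0) \<le> ?y / c\<^sub>L + (norm (\<L> 0))\<^sup>2 / 2 * ?y"
      using sum_squares_bound[of "norm ?v" "norm (\<L> 0)"] b(1) by simp
    show "norm ?v * norm (\<iota> ?\<phi>) \<le> ?y / c\<^sub>L + ?y"
      using sum_squares_bound[of "norm ?v" "norm (\<iota> ?\<phi>)"] b by simp
  qed (use C\<^sub>\<L> in simp)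
  finally have "- (?v \<bullet> \<L> (\<iota> ?\<phi>)) \<le> (1 / c\<^sub>L + (norm (\<L> 0))\<^sup>2 / 2 + C\<^sub>\<L> * (1 / c\<^sub>L + 1)) * ?y"
    by (simp add: algebra_simps)
  then show ?thesis unfolding eq using Qy by (simp add: C1_def algebra_simps)
qed

lemma energy_bound:
  assumes U: "has_time_derivative T U dU" and c: "continuous_on UNIV U" and R: "R > 0"
    and dU: "\<And>t. U t \<in> state_dom" "\<And>t. dU t = (0, 0, - Li (truncated_forcing R (fst (snd (U t))))) - generator (U t)"
    and \<tau>: "0 \<le> \<tau>" "\<tau> \<le> T" and b: "\<And>t. \<lbrakk>0 \<le> t; t \<le> \<tau>\<rbrakk> \<Longrightarrow> norm (fst (snd (U t))) \<le> R"
  shows "energy (U \<tau>) \<le> exp (2 * C1 * \<tau>) * energy (U 0)"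
proof -
  define \<Psi> where "\<Psi> t = \<Phi> (\<iota> (retraction_ball R (fst (snd (U t)))))" for t
  have \<Psi>: "\<Psi> t = \<Phi> (\<iota> (fst (snd (U t))))" if "0 \<le> t" "t \<le> \<tau>" for t
    using b[OF that] R by (simp add: \<Psi>_def retraction_ball_id)
  \<comment> \<open>The functional that dominates increments of the energy: the derivative of the
    quadratic part, and \<Phi> \<phi> as a subgradient of \<open>i\<close>.\<close>
  define bil where "bil w g = Q (fst w) g + snd w \<bullet> \<iota> (fst (snd g))" for w :: "('v \<times> 'v \<times> 'h) \<times> 'h" and g :: "'v \<times> 'v \<times> 'h"
  have cU: "continuous_on {0..\<tau>} U" using c continuous_on_subset by blast
  have bil: "bounded_bilinear bil"
    unfolding bil_def
    by (intro bounded_bilinear_add bounded_bilinear.comp1[OF Q_bilinear] bounded_bilinear.comp[OF bounded_bilinear_inner]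
      bounded_linear_fst bounded_linear_snd bounded_linear_compose[OF blinfun.bounded_linear_right]
      bounded_linear_compose[OF bounded_linear_fst])
  show ?thesis
  proof (rule energy_gronwall[OF U \<tau> C1_nonneg bil, of "\<lambda>t. (U t, \<Psi> t)" "\<lambda>t. energy (U t)"])
    show "continuous_on {0..\<tau>} (\<lambda>t. (U t, \<Psi> t))"
      unfolding \<Psi>_def
      by (intro continuous_intros cU continuous_on_compose2[OF \<Phi>_retraction_continuous[OF R]]) auto
    show "continuous_on {0..\<tau>} (\<lambda>t. energy (U t))"
      unfolding energy_def
      by (intro continuous_intros X.Q.continuous_on cU continuous_on_compose2[OF i_continuous[of R]]) (use b in auto)
    show "0 \<le> energy (U t)" for t using energy_ge(1)[of "U t"] by simp
    show "energy (U t) - energy (U s) \<le> bil (U t, \<Psi> t) (U t - U s)" if "0 \<le> s" "s \<le> t" "t \<le> \<tau>" for s t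
    proof -
      have "Q (U t) (U t) / 2 - Q (U s) (U s) / 2 \<le> Q (U t) (U t - U s)"
        using X.Q_pos[of "U t - U s"] by (simp add: X.Q.diff_left X.Q.diff_right Q_sym[of "U s" "U t"])
      moreover have "i (fst (snd (U t))) - i (fst (snd (U s))) \<le> \<Psi> t \<bullet> \<iota> (fst (snd (U t - U s)))"
        using i_sub[of "fst (snd (U t))" "fst (snd (U s))"] \<Psi>[of t] that by (simp add: blinfun.diff_right)
      ultimately show ?thesis by (simp add: energy_def bil_def)
    qed
    show "AE r in lebesgue_on {0<..<T}. r < \<tau> \<longrightarrow> bil (U r, \<Psi> r) (dU r) \<le> C1 * energy (U r)"
    proof (rule AE_I2, rule impI)
      fix r assume r: "r \<in> space (lebesgue_on {0<..<T})" "r < \<tau>"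
      then show "bil (U r, \<Psi> r) (dU r) \<le> C1 * energy (U r)"
        using energy_dissipation[OF dU(1) R _ dU(2), of r] b[of r] \<Psi>[of r] by (simp add: bil_def)
    qed
  qed
qed

text \<open>(A12) enters here: A1 \<theta>0 and v0 belong to V, so the first two components of the
  generator are V-valued, and A2 \<phi>0 + B1 v0 exists in H.\<close>

lemma initial_state:
  "\<exists>U0. U0 \<in> state_dom \<and> \<iota> (fst U0) = \<theta>0 \<and> \<iota> (fst (snd U0)) = \<phi>0 \<and> snd (snd U0) = v0"
proof -
  obtain a b d e where *: "\<theta>0 = \<iota> a" "\<phi>0 = \<iota> b" "v0 = \<iota> d" "A1 \<theta>0 = \<iota> e"
    using initial DA by blast
  define x y where "x = (a, b, v0)" and "y = (e + \<eta> *\<^sub>R d, - d, Li (A2 \<phi>0 + B1 v0 - B2 \<theta>0))"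
  have "state_rel x y"
    unfolding state_rel_def x_def y_def using initial A2s_eq[of b] B1s_eq[of d]
    by (simp add: *[symmetric] blinfun.add_right blinfun.scaleR_right blinfun.minus_right L_Li to_dual_add)
  then have "x \<in> state_dom" unfolding state_dom_def by blast
  then show ?thesis using * by (intro exI[of _ x]) (simp add: x_def)
qed

text \<open>Up to the first time at which the V norm of \<phi> equals \<open>R\<close> the energy
  bound is valid, and at that time it forces the norm below \<open>R\<close>. Hence there is no such
  time and the truncation stays inactive.\<close>

theorem strong_solution:
  "\<exists>U dU M R. has_time_derivative T U dU \<and> M-lipschitz_on UNIV U
      \<and> \<iota> (fst (U 0)) = \<theta>0 \<and> \<iota> (fst (snd (U 0))) = \<phi>0 \<and> snd (snd (U 0)) = v0
      \<and> dU \<in> borel_measurable borel \<and> (\<forall>t. norm (dU t) \<le> R) \<and> R > 0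
      \<and> (\<forall>t\<in>{0..T}. norm (fst (snd (U t))) \<le> R)
      \<and> (\<forall>t. U t \<in> state_dom)
      \<and> (\<forall>t\<in>{0..T}. dU t = (0, 0, - Li (\<Phi> (\<iota> (fst (snd (U t)))) + \<L> (\<iota> (fst (snd (U t)))))) - generator (U t))
      \<and> (AE t in lebesgue_on {0<..<T}. snd (snd (U t)) \<in> DB1)
      \<and> (\<lambda>t. B1 (snd (snd (U t)))) \<in> L2_space T"
proof -
  obtain U0 where U0: "U0 \<in> state_dom" "\<iota> (fst U0) = \<theta>0" "\<iota> (fst (snd U0)) = \<phi>0" "snd (snd U0) = v0"
    using initial_state by blast
  define Y where "Y = exp (2 * C1 * T) * energy U0"
  have e1: "1 \<le> exp (2 * C1 * T)" using C1_nonneg T by simp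
  have Y: "energy U0 \<le> Y" "0 \<le> Y"
    using mult_right_mono[OF e1, of "energy U0"] energy_ge(1)[of U0] by (auto simp: Y_def)
  \<comment> \<open>One more than the norm that an energy of at most \<open>Y\<close> permits, which
    makes the inequality in \<open>small\<close> strict.\<close>
  define R where "R = sqrt (2 * Y / c\<^sub>Q) + 1"
  have R: "R > 0" using Y c\<^sub>Q by (simp add: R_def add_nonneg_pos)
  have small: "norm (fst (snd x)) < R" if "energy x \<le> Y" for x
  proof -
    have "c\<^sub>Q * (norm x)\<^sup>2 \<le> 2 * Y" using Q_coercive[of x] energy_ge(2)[of x] that by linarith
    then have "(norm x)\<^sup>2 \<le> 2 * Y / c\<^sub>Q" using c\<^sub>Q by (simp add: field_simps)
    then have "norm x \<le> sqrt (2 * Y / c\<^sub>Q)" by (rule real_le_rsqrt)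
    then show ?thesis using norm_components(2)[of x] by (simp add: R_def)
  qed
  obtain U dU M R' where U: "has_time_derivative T U dU" "U 0 = U0" "M-lipschitz_on UNIV U"
      "dU \<in> borel_measurable borel" "\<And>t. norm (dU t) \<le> R'"
      "\<And>t. U t \<in> state_dom" "\<And>t. dU t = (0, 0, - Li (truncated_forcing R (fst (snd (U t))))) - generator (U t)"
      "AE t in lebesgue_on {0<..<T}. snd (snd (U t)) \<in> DB1" "(\<lambda>t. B1 (snd (snd (U t)))) \<in> L2_space T"
    using truncated_solution[OF truncated_forcing_lipschitz[OF R] T U0(1)] U0(3) initial(3) by metis
  have cU: "continuous_on UNIV U" using U(3) by (rule lipschitz_on_continuous_on)
  define \<nu> where "\<nu> t = norm (fst (snd (U t)))" for t
  have c\<nu>: "continuous_on S \<nu>" for S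
    unfolding \<nu>_def by (intro continuous_intros continuous_on_subset[OF cU]) auto
  have \<nu>0: "\<nu> 0 < R" unfolding \<nu>_def U(2) by (intro small Y)
  have \<nu>: "\<nu> t < R" if t: "t \<in> {0..T}" for t
  proof (rule ccontr)
    assume "\<not> \<nu> t < R"
    let ?S = "{s \<in> {0..T}. \<nu> s = R}"
    have ivt: "\<exists>s. 0 \<le> s \<and> s \<le> t' \<and> \<nu> s = R" if "0 \<le> t'" "R \<le> \<nu> t'" for t'
      using IVT'[of \<nu> 0 R t'] \<nu>0 that c\<nu> by auto
    have "closed ?S"
      using continuous_closed_preimage[OF c\<nu>[of "{0..T}"], of "{R}"] by (simp add: vimage_def Int_def conj_commute)
    moreover have "bounded ?S" by (rule bounded_subset[of "{0..T}"]) auto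
    ultimately have "compact ?S" by (simp add: compact_eq_bounded_closed)
    moreover have "?S \<noteq> {}"
    proof -
      obtain s where "0 \<le> s" "s \<le> t" "\<nu> s = R" using ivt[of t] t \<open>\<not> \<nu> t < R\<close> by auto
      then have "s \<in> ?S" using t by simp
      then show ?thesis by blast
    qed
    ultimately have "\<exists>s\<in>?S. \<forall>r\<in>?S. s \<le> r" by (rule compact_attains_inf)
    then obtain s where s: "s \<in> ?S" "\<And>r. r \<in> ?S \<Longrightarrow> s \<le> r" by blast
    have "\<nu> r \<le> R" if r: "0 \<le> r" "r \<le> s" for r
    proof (rule ccontr)
      assume "\<not> \<nu> r \<le> R"
      then obtain r' where "0 \<le> r'" "r' \<le> r" "\<nu> r' = R" using ivt[of r] r by auto
      then have "r' \<noteq> r" "s \<le> r'" using s r \<open>\<not> \<nu> r \<le> R\<close> by auto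
      then show False using \<open>r' \<le> r\<close> r by simp
    qed
    then have "energy (U s) \<le> exp (2 * C1 * s) * energy (U 0)"
      using s(1) by (intro energy_bound[OF U(1) cU R U(6,7)]) (auto simp: \<nu>_def)
    also have "\<dots> \<le> Y" unfolding Y_def U(2)
      using s(1) C1_nonneg energy_ge(1)[of U0] by (intro mult_right_mono) (auto intro: mult_left_mono)
    finally have "\<nu> s < R" unfolding \<nu>_def by (rule small)
    then show False using s(1) by simp
  qed
  define R2 where "R2 = max R R'"
  have "truncated_forcing R (fst (snd (U t))) = \<Phi> (\<iota> (fst (snd (U t)))) + \<L> (\<iota> (fst (snd (U t))))" if "t \<in> {0..T}" for t
    using \<nu>[OF that] R by (simp add: truncated_forcing_def \<nu>_def retraction_ball_id)
  then have "\<forall>t\<in>{0..T}. dU t = (0, 0, - Li (\<Phi> (\<iota> (fst (snd (U t)))) + \<L> (\<iota> (fst (snd (U t)))))) - generator (U t)"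
    using U(7) by simp
  moreover have "\<forall>t. norm (dU t) \<le> R2" unfolding R2_def using U(5) by (meson max.coboundedI2)
  moreover have "R2 > 0" using R by (simp add: R2_def)
  moreover have "\<forall>t\<in>{0..T}. norm (fst (snd (U t))) \<le> R2"
    unfolding R2_def using \<nu> unfolding \<nu>_def by (meson less_imp_le max.coboundedI1)
  ultimately show ?thesis using U U0 by blast
qed

end

section \<open>Existence and uniqueness\<close>

lemma has_time_derivative_cong:
  assumes u: "has_time_derivative T u g" and eq: "\<And>t. t \<in> {0<..<T} \<Longrightarrow> g t = k t"
  shows "has_time_derivative T u k"
proof -
  have "integrable (lebesgue_on {0<..<T}) k"
    using u eq unfolding has_time_derivative_def
    by (subst Bochner_Integration.integrable_cong[OF refl, of _ k g]) auto
  moreover have "integral\<^sup>L (lebesgue_on {0<..<t}) g = integral\<^sup>L (lebesgue_on {0<..<t}) k" if "t \<in> {0..T}" for t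
    using that eq by (intro Bochner_Integration.integral_cong) auto
  ultimately show ?thesis using u unfolding has_time_derivative_def by metis
qed

lemma has_time_derivative_diff:
  assumes "has_time_derivative T u g" "has_time_derivative T v k"
  shows "has_time_derivative T (\<lambda>t. u t - v t) (\<lambda>t. g t - k t)"
  using has_time_derivative_add[OF assms(1) has_time_derivative_linear[OF bounded_linear_minus[OF bounded_linear_ident] assms(2)]]
  by simp

lemma has_time_derivative_Pair:
  assumes u: "has_time_derivative T u g" and v: "has_time_derivative T v k"
  shows "has_time_derivative T (\<lambda>t. (u t, v t)) (\<lambda>t. (g t, k t))"
proof -
  have "bounded_linear (\<lambda>x. (x, 0))" "bounded_linear (\<lambda>x. (0, x))"
    by (intro bounded_linear_Pair bounded_linear_ident bounded_linear_zero)+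
  from has_time_derivative_add[OF has_time_derivative_linear[OF this(1) u] has_time_derivative_linear[OF this(2) v]]
  show ?thesis by simp
qed

lemma measurable_lebesgue_on_cong:
  assumes "u \<in> borel_measurable (lebesgue_on {0<..<T})" "\<And>t. t \<in> {0<..<T} \<Longrightarrow> v t = u t"
  shows "v \<in> borel_measurable (lebesgue_on {0<..<T})"
  using assms by (subst measurable_cong[of _ v u]) auto

context coupled_problem
begin

text \<open>Once B1 v lies in H, the equation puts \<open>A2s \<phi>\<close> into H and
  \<open>A2s_in_H\<close> applies, so the controlled sum splits into its two terms.\<close>

lemma strong_form:
  assumes state_rel: "state_rel x y" and v: "snd (snd x) \<in> DB1"
  shows "\<iota> (fst (snd x)) \<in> DA2"
    "A2 (\<iota> (fst (snd x))) + B1 (snd (snd x)) = L (snd (snd y)) + B2 (\<iota> (fst x))"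
proof -
  let ?r = "L (snd (snd y)) + B2 (\<iota> (fst x))"
  have "B1s (- fst (snd y)) = to_dual \<iota> (B1 (snd (snd x)))"
    using B1s_eq[of "- fst (snd y)"] v state_rel by (simp add: state_rel_def blinfun.minus_right)
  then have "A2s (fst (snd x)) = to_dual \<iota> (?r - B1 (snd (snd x)))"
    using state_rel by (simp add: state_rel_def to_dual_diff blinfun.minus_right diff_eq_eq) (metis add_uminus_conv_diff diff_add_cancel minus_minus)
  from A2s_in_H[OF this] show "\<iota> (fst (snd x)) \<in> DA2" "A2 (\<iota> (fst (snd x))) + B1 (snd (snd x)) = ?r" by auto
qed

abbreviation solution :: "(real \<Rightarrow> 'v) \<Rightarrow> (real \<Rightarrow> 'v) \<Rightarrow> bool" where
  "solution \<equiv> is_solution T \<eta> \<iota> L DA1 A1 DA2 A2 DB1 B1 B2 \<Phi> \<L> \<theta>0 \<phi>0 v0"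

theorem existence: "\<exists>\<theta> \<phi>. solution \<theta> \<phi>"
proof -
  obtain U dU M R where U: "has_time_derivative T U dU" "M-lipschitz_on UNIV U"
      "\<iota> (fst (U 0)) = \<theta>0" "\<iota> (fst (snd (U 0))) = \<phi>0" "snd (snd (U 0)) = v0"
    and dU: "dU \<in> borel_measurable borel" "\<And>t. norm (dU t) \<le> R" and R: "R > 0"
    and \<phi>R: "\<And>t. t \<in> {0..T} \<Longrightarrow> norm (fst (snd (U t))) \<le> R"
    and state_dom: "\<And>t. U t \<in> state_dom"
    and eq: "\<And>t. t \<in> {0..T} \<Longrightarrow>
        dU t = (0, 0, - Li (\<Phi> (\<iota> (fst (snd (U t)))) + \<L> (\<iota> (fst (snd (U t)))))) - generator (U t)"
    and B1v: "AE t in lebesgue_on {0<..<T}. snd (snd (U t)) \<in> DB1" "(\<lambda>t. B1 (snd (snd (U t)))) \<in> L2_space T"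
    using strong_solution by blast
  define \<theta> \<phi> v where "\<theta> t = fst (U t)" and "\<phi> t = fst (snd (U t))" and "v t = snd (snd (U t))" for t
  define \<theta>d \<phi>d vd where "\<theta>d t = fst (dU t)" and "\<phi>d t = fst (snd (dU t))" and "vd t = snd (snd (dU t))" for t
  note defs = \<theta>_def \<phi>_def v_def \<theta>d_def \<phi>d_def vd_def
  have bl: "bounded_linear (\<lambda>x::'v \<times> 'v \<times> 'h. fst x)" "bounded_linear (\<lambda>x::'v \<times> 'v \<times> 'h. fst (snd x))"
    "bounded_linear (\<lambda>x::'v \<times> 'v \<times> 'h. snd (snd x))"
    by (intro bounded_linear_fst bounded_linear_compose[OF bounded_linear_fst bounded_linear_snd]
        bounded_linear_compose[OF bounded_linear_snd bounded_linear_snd])+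
  have td: "has_time_derivative T \<theta> \<theta>d" "has_time_derivative T \<phi> \<phi>d" "has_time_derivative T v vd"
    using bl[THEN has_time_derivative_linear, OF U(1)] by (simp_all add: defs[abs_def])
  have cU: "continuous_on UNIV U" using U(2) by (rule lipschitz_on_continuous_on)
  have c: "continuous_on UNIV \<theta>" "continuous_on UNIV \<phi>" "continuous_on UNIV v"
    unfolding defs by (intro continuous_intros cU)+
  have md: "f \<circ> dU \<in> borel_measurable (lebesgue_on {0<..<T})" if "bounded_linear f" for f :: "_ \<Rightarrow> 'z::{banach, second_countable_topology}"
    unfolding comp_def
    by (intro borel_measurable_lebesgue_onI borel_measurable_continuous_on[OF _ dU(1)] bounded_linear.continuous_on[OF that] continuous_on_id)
  have m: "\<theta> \<in> borel_measurable (lebesgue_on {0<..<T})" "\<phi> \<in> borel_measurable (lebesgue_on {0<..<T})" "v \<in> borel_measurable (lebesgue_on {0<..<T})"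
    "\<theta>d \<in> borel_measurable (lebesgue_on {0<..<T})" "\<phi>d \<in> borel_measurable (lebesgue_on {0<..<T})" "vd \<in> borel_measurable (lebesgue_on {0<..<T})"
    using c bl[THEN md] by (auto intro!: borel_measurable_lebesgue_onI borel_measurable_continuous_onI simp: defs[abs_def] comp_def)
  define R1 where "R1 = norm (U 0) + M * T"
  have UR: "norm (U t) \<le> R1" if t: "t \<in> {0..T}" for t
  proof -
    have "norm (U t - U 0) \<le> M * \<bar>t - 0\<bar>" using lipschitz_onD[OF U(2), of t 0] by (simp add: dist_norm)
    also have "\<dots> \<le> M * T" using t lipschitz_on_nonneg[OF U(2)] by (intro mult_left_mono) auto
    finally show ?thesis unfolding R1_def using norm_triangle_sub[of "U t" "U 0"] by linarith
  qed
  have bd: "norm (\<theta> t) \<le> R1" "norm (v t) \<le> R1" "norm (\<phi> t) \<le> R" if "t \<in> {0..T}" for t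
    using norm_components(1,3)[of "U t"] UR[OF that] \<phi>R[OF that] by (auto simp: defs)
  have bdd: "norm (\<theta>d t) \<le> R" "norm (\<phi>d t) \<le> R" "norm (vd t) \<le> R" for t
    using norm_components[of "dU t"] dU(2)[of t] by (auto simp: defs)
  note spaces = bounded_measurable_spaces
  have L\<theta>: "\<theta> \<in> Linf_space T" "\<theta> \<in> L2_space T" using spaces[OF m(1), of R1] bd by auto
  have L\<phi>: "\<phi> \<in> Linf_space T" using spaces[OF m(2), of R] bd by auto
  have Lv: "v \<in> Linf_space T" "v \<in> L2_space T" using spaces[OF m(3), of R1] bd by auto
  have L\<theta>d: "\<theta>d \<in> L2_space T" using spaces(2)[OF m(4)] bdd by blast
  have L\<phi>d: "\<phi>d \<in> Linf_space T" using spaces(1)[OF m(5)] bdd by blast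
  have Lvd: "vd \<in> Linf_space T" using spaces(1)[OF m(6)] bdd by blast
  have ii: "(\<lambda>t. \<iota> (u t)) \<in> Linf_space T \<and> (\<lambda>t. \<iota> (u t)) \<in> L2_space T"
    if "u \<in> borel_measurable (lebesgue_on {0<..<T})" "\<And>t. t \<in> {0..T} \<Longrightarrow> norm (u t) \<le> r" for u :: "real \<Rightarrow> 'v" and r
  proof -
    have "(\<lambda>t. \<iota> (u t)) \<in> borel_measurable (lebesgue_on {0<..<T})"
      by (rule borel_measurable_continuous_on[OF _ that(1)]) (intro continuous_intros)
    moreover have "norm (\<iota> (u t)) \<le> norm \<iota> * r" if "t \<in> {0<..<T}" for t
      using norm_blinfun[of \<iota> "u t"] \<open>\<And>t. t \<in> {0..T} \<Longrightarrow> norm (u t) \<le> r\<close>[of t] that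
      by (meson greaterThanLessThan_subseteq_atLeastAtMost_iff mult_left_mono norm_ge_zero order_trans order_refl subsetD)
    ultimately show ?thesis using spaces by blast
  qed
  have state_rel: "state_rel (U t) (generator (U t))" for t using state_dom by (rule generator_rel)
  have g: "fst (generator (U t)) = - \<theta>d t" "fst (snd (generator (U t))) = - \<phi>d t"
    "snd (snd (generator (U t))) = - Li (\<Phi> (\<iota> (\<phi> t)) + \<L> (\<iota> (\<phi> t))) - vd t" if "t \<in> {0..T}" for t
    using eq[OF that] by (simp_all add: defs)
  have A1eq: "A1 (\<iota> (\<theta> t)) = - \<iota> (\<theta>d t) - \<eta> *\<^sub>R v t" if t: "t \<in> {0..T}" for t
  proof -
    have "- \<iota> (\<theta>d t) = A1 (\<iota> (\<theta> t)) + \<eta> *\<^sub>R v t"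
      using state_rel[of t] g(1)[OF t] by (simp add: state_rel_def \<theta>_def v_def blinfun.minus_right)
    then show ?thesis by simp
  qed
  have eq1: "\<iota> (\<theta> t) \<in> DA1" "\<iota> (\<theta>d t) + \<eta> *\<^sub>R v t + A1 (\<iota> (\<theta> t)) = 0" "\<iota> (\<phi>d t) = v t" if t: "t \<in> {0..T}" for t
    using state_rel[of t] g(2)[OF t] A1eq[OF t] by (simp_all add: state_rel_def \<theta>_def v_def blinfun.minus_right)
  have A1L: "(\<lambda>t. A1 (\<iota> (\<theta> t))) \<in> Linf_space T"
  proof (rule spaces(1))
    have "(\<lambda>t. - \<iota> (\<theta>d t) - \<eta> *\<^sub>R v t) \<in> borel_measurable (lebesgue_on {0<..<T})"
      using ii[OF m(4) bdd(1)] m(3) by (auto simp: Linf_space_def)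
    then show "(\<lambda>t. A1 (\<iota> (\<theta> t))) \<in> borel_measurable (lebesgue_on {0<..<T})"
      using A1eq by (rule measurable_lebesgue_on_cong) auto
    show "norm (A1 (\<iota> (\<theta> t))) \<le> norm \<iota> * R + \<eta> * R1" if t: "t \<in> {0<..<T}" for t
    proof -
      have t': "t \<in> {0..T}" using t by auto
      have "norm (A1 (\<iota> (\<theta> t))) \<le> norm (\<iota> (\<theta>d t)) + \<eta> * norm (v t)"
        unfolding A1eq[OF t'] using norm_triangle_ineq4[of "- \<iota> (\<theta>d t)" "\<eta> *\<^sub>R v t"] \<eta> by simp
      also have "\<dots> \<le> norm \<iota> * R + \<eta> * R1"
        using norm_blinfun[of \<iota> "\<theta>d t"] mult_left_mono[OF bdd(1)[of t] norm_ge_zero[of \<iota>]] bd(2)[OF t'] \<eta>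
        by (intro add_mono mult_left_mono) auto
      finally show ?thesis .
    qed
  qed
  have \<Phi>L: "(\<lambda>t. \<Phi> (\<iota> (\<phi> t))) \<in> Linf_space T"
  proof (rule spaces(1))
    \<comment> \<open>The retraction fixes the values of \<phi> on [0,T], so measurability can be
      taken from the continuous truncation of \<Phi>.\<close>
    have "(\<lambda>t. \<Phi> (\<iota> (retraction_ball R (\<phi> t)))) \<in> borel_measurable (lebesgue_on {0<..<T})"
      by (intro borel_measurable_lebesgue_onI borel_measurable_continuous_onI
          continuous_on_compose2[OF \<Phi>_retraction_continuous[OF R] c(2)]) auto
    then show "(\<lambda>t. \<Phi> (\<iota> (\<phi> t))) \<in> borel_measurable (lebesgue_on {0<..<T})"
      by (rule measurable_lebesgue_on_cong) (use bd(3) R in \<open>simp add: retraction_ball_id\<close>)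
    show "norm (\<Phi> (\<iota> (\<phi> t))) \<le> norm (\<Phi> (\<iota> 0)) + \<Lambda> R * R" if "t \<in> {0<..<T}" for t
      using bounded_on_balls(1)[OF bd(3)] that by auto
  qed
  obtain Cr where Cr: "Cr \<ge> 0" "\<And>x y. state_rel x y \<Longrightarrow> norm (L (snd (snd y)) + B2 (\<iota> (fst x))) \<le> Cr * (norm x + norm y)"
    using state_rel_bound by blast
  define b where "b = Cr * (R1 + (((norm (\<Phi> (\<iota> 0)) + \<Lambda> R * R) + (norm (\<L> 0) + C\<^sub>\<L> * (norm \<iota> * R))) / c\<^sub>L + R))"
  have bnd: "norm (L (snd (snd (generator (U t)))) + B2 (\<iota> (fst (U t)))) \<le> b" if t: "t \<in> {0..T}" for t
  proof -
    let ?s = "\<Phi> (\<iota> (\<phi> t)) + \<L> (\<iota> (\<phi> t))"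
    have "norm (generator (U t)) \<le> norm (Li ?s) + norm (dU t)"
      using norm_triangle_ineq4[of "(0 :: 'v, 0 :: 'v, - Li ?s)" "dU t"] eq[OF t] by (simp add: norm_Pair \<phi>_def)
    moreover have "norm (Li ?s) \<le> ((norm (\<Phi> (\<iota> 0)) + \<Lambda> R * R) + (norm (\<L> 0) + C\<^sub>\<L> * (norm \<iota> * R))) / c\<^sub>L"
      using c\<^sub>L by (intro order_trans[OF Li_bound] divide_right_mono norm_triangle_mono bounded_on_balls bd t) auto
    ultimately have "norm (U t) + norm (generator (U t))
        \<le> R1 + (((norm (\<Phi> (\<iota> 0)) + \<Lambda> R * R) + (norm (\<L> 0) + C\<^sub>\<L> * (norm \<iota> * R))) / c\<^sub>L + R)"
      using UR[OF t] dU(2)[of t] by linarith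
    then show ?thesis
      unfolding b_def using Cr(1) by (intro order_trans[OF Cr(2)[OF state_rel]] mult_left_mono)
  qed
  have ae2: "AE t in lebesgue_on {0<..<T}. norm (A2 (\<iota> (\<phi> t)) + B1 (v t)) \<le> b \<and> \<iota> (\<phi> t) \<in> DA2 \<and>
      A2 (\<iota> (\<phi> t)) + B1 (v t) = - (\<Phi> (\<iota> (\<phi> t)) + \<L> (\<iota> (\<phi> t))) - L (vd t) + B2 (\<iota> (\<theta> t))"
  proof -
    have "AE t in lebesgue_on {0<..<T}. t \<in> {0..T}" by (rule AE_I2) auto
    with B1v(1) show ?thesis
    proof eventually_elim
      case (elim t)
      note sf = strong_form[OF state_rel[of t] elim(1)]
      have "L (snd (snd (generator (U t)))) = - (\<Phi> (\<iota> (\<phi> t)) + \<L> (\<iota> (\<phi> t))) - L (vd t)"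
        unfolding g(3)[OF elim(2)] by (simp add: blinfun.diff_right blinfun.minus_right L_Li)
      then show ?case using sf bnd[OF elim(2)] by (simp add: defs)
    qed
  qed
  \<comment> \<open>A2 \<phi> is a bounded function minus B1 v, which is square integrable.\<close>
  have A2L: "(\<lambda>t. A2 (\<iota> (\<phi> t))) \<in> L2_space T"
  proof -
    have meas: "(\<lambda>t. A2 (\<iota> (\<phi> t))) \<in> borel_measurable (lebesgue_on {0<..<T})"
    proof (rule OA2.measurable_operator)
      show "continuous_on UNIV (\<lambda>t. \<iota> (\<phi> t))" by (intro continuous_intros c)
      show "AE t in lebesgue_on {0<..<T}. \<iota> (\<phi> t) \<in> DA2" using ae2 by eventually_elim blast
    qed simp
    interpret finite_measure "lebesgue_on {0<..<T}" by (rule finite_measure_lebesgue_on) simp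
    have "integrable (lebesgue_on {0<..<T}) (\<lambda>t. (norm (A2 (\<iota> (\<phi> t))))\<^sup>2)"
    proof (rule Bochner_Integration.integrable_bound)
      show "integrable (lebesgue_on {0<..<T}) (\<lambda>t. 2 * b\<^sup>2 + 2 * (norm (B1 (v t)))\<^sup>2)"
        using B1v(2) by (auto simp: L2_space_def defs)
      show "(\<lambda>t. (norm (A2 (\<iota> (\<phi> t))))\<^sup>2) \<in> borel_measurable (lebesgue_on {0<..<T})" using meas by measurable
      show "AE t in lebesgue_on {0<..<T}. norm ((norm (A2 (\<iota> (\<phi> t))))\<^sup>2) \<le> norm (2 * b\<^sup>2 + 2 * (norm (B1 (v t)))\<^sup>2)"
        using ae2
      proof eventually_elim
        case (elim t)
        have "norm (A2 (\<iota> (\<phi> t))) \<le> norm (A2 (\<iota> (\<phi> t)) + B1 (v t)) + norm (B1 (v t))"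
          using norm_triangle_ineq4[of "A2 (\<iota> (\<phi> t)) + B1 (v t)" "B1 (v t)"] by simp
        also have "\<dots> \<le> b + norm (B1 (v t))" using elim by (intro add_right_mono) blast
        finally have "(norm (A2 (\<iota> (\<phi> t))))\<^sup>2 \<le> (b + norm (B1 (v t)))\<^sup>2" by (intro power_mono) auto
        also have "\<dots> \<le> 2 * b\<^sup>2 + 2 * (norm (B1 (v t)))\<^sup>2"
          using sum_squares_bound[of b "norm (B1 (v t))"] by (simp add: power2_sum)
        finally show ?case by simp
      qed
    qed
    then show ?thesis using meas by (simp add: L2_space_def)
  qed
  have td\<phi>: "has_time_derivative T (\<lambda>t. \<iota> (\<phi> t)) v"
    by (rule has_time_derivative_cong[OF has_time_derivative_linear[OF blinfun.bounded_linear_right td(2)]]) (use eq1(3) in auto)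
  have "solution \<theta> \<phi>"
    unfolding is_solution_def
  proof (intro conjI exI)
    show "\<theta> \<in> H1_space T" using L\<theta> L\<theta>d td(1) by (auto simp: H1_space_def)
    show "\<theta> \<in> Linf_space T" by fact
    show "(\<lambda>t. \<iota> (\<theta> t)) \<in> domain_valued T (Linf_space T) DA1 A1"
      using ii[OF m(1) bd(1)] A1L eq1(1) by (auto simp: domain_valued_def)
    show "(\<lambda>t. \<iota> (\<phi> t)) \<in> W2inf_space T"
      using ii[OF m(2) bd(3)] td\<phi> Lv(1) td(3) Lvd by (auto simp: W2inf_space_def W1inf_space_def)
    show "\<phi> \<in> W1inf_space T" using L\<phi> L\<phi>d td(2) by (auto simp: W1inf_space_def)
    show "(\<lambda>t. \<iota> (\<phi> t)) \<in> domain_valued T (L2_space T) DA2 A2"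
      using ii[OF m(2) bd(3)] A2L ae2 by (auto simp: domain_valued_def elim: eventually_mono)
    show "(\<lambda>t. \<Phi> (\<iota> (\<phi> t))) \<in> Linf_space T" by fact
    show "has_time_derivative T \<theta> \<theta>d" "has_time_derivative T (\<lambda>t. \<iota> (\<phi> t)) v" "has_time_derivative T v vd" by fact+
    show "v \<in> domain_valued T (L2_space T) DB1 B1" using Lv B1v by (auto simp: domain_valued_def defs)
    show "AE t in lebesgue_on {0<..<T}. \<iota> (\<theta>d t) + \<eta> *\<^sub>R v t + A1 (\<iota> (\<theta> t)) = 0"
      using eq1(2) by (intro AE_I2) auto
    show "AE t in lebesgue_on {0<..<T}. L (vd t) + B1 (v t) + A2 (\<iota> (\<phi> t)) + \<Phi> (\<iota> (\<phi> t)) + \<L> (\<iota> (\<phi> t)) = B2 (\<iota> (\<theta> t))"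
      using ae2 by eventually_elim (auto simp: algebra_simps)
    show "\<iota> (\<theta> 0) = \<theta>0" "\<iota> (\<phi> 0) = \<phi>0" "v 0 = v0" using U(3-5) by (simp_all add: defs)
  qed
  then show ?thesis by blast
qed

text \<open>Up to the perturbation \<delta>, a difference of two solutions satisfies the linear
  system, so \<open>state_rel_energy\<close> applies. The term with \<delta> is harmless because
  \<open>Q\<close> controls the V norm of \<phi>.\<close>

lemma difference_dissipation:
  assumes state_rel: "\<iota> \<theta> \<in> DA1" "\<iota> \<theta>d + \<eta> *\<^sub>R v + A1 (\<iota> \<theta>) = 0" "\<iota> \<phi>d = v" "v \<in> DB1" "\<iota> \<phi> \<in> DA2"
    and eq: "L vd + B1 v + A2 (\<iota> \<phi>) + \<delta> = B2 (\<iota> \<theta>)"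
    and \<delta>: "norm \<delta> \<le> K * norm \<phi>" and K: "K \<ge> 0"
  shows "Q (\<theta>, \<phi>, v) (\<theta>d, \<phi>d, vd) \<le> (2 * \<omega> + K / c\<^sub>Q) * (Q (\<theta>, \<phi>, v) (\<theta>, \<phi>, v) / 2)"
proof -
  let ?x = "(\<theta>, \<phi>, v)"
  define r where "r = B1 v + A2 (\<iota> \<phi>)"
  define y where "y = (- \<theta>d, - \<phi>d, Li (r - B2 (\<iota> \<theta>)))"
  have "state_rel ?x y"
    unfolding state_rel_def y_def
  proof (simp add: state_rel L_Li blinfun.minus_right, intro conjI)
    show "- \<iota> \<theta>d = A1 (\<iota> \<theta>) + \<eta> *\<^sub>R v" using state_rel(2) by (simp add: algebra_simps eq_neg_iff_add_eq_0 neg_eq_iff_add_eq_0)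
    show "A2s \<phi> + B1s \<phi>d = to_dual \<iota> r"
      using A2s_eq[OF state_rel(5)] B1s_eq[of \<phi>d] state_rel by (simp add: r_def to_dual_add)
  qed
  from state_rel_energy[OF this] have 1: "- Q ?x y \<le> \<omega> * Q ?x ?x" using Q_sym[of y] by simp
  have "vd = - Li (r - B2 (\<iota> \<theta>)) - Li \<delta>"
  proof (rule L_inj)
    show "L vd = L (- Li (r - B2 (\<iota> \<theta>)) - Li \<delta>)"
      using eq by (simp add: blinfun.diff_right blinfun.minus_right L_Li r_def algebra_simps)
  qed
  then have "(\<theta>d, \<phi>d, vd) = - y - (0, 0, Li \<delta>)" by (simp add: y_def)
  then have "Q ?x (\<theta>d, \<phi>d, vd) = - Q ?x y - Q ?x (0, 0, Li \<delta>)"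
    by (simp only: X.Q.diff_right X.Q.minus_right)
  also have "Q ?x (0, 0, Li \<delta>) = v \<bullet> \<delta>" by (simp add: Q_def blinfun.zero_right L_sym L_Li)
  finally have 2: "Q ?x (\<theta>d, \<phi>d, vd) \<le> \<omega> * Q ?x ?x + \<bar>v \<bullet> \<delta>\<bar>" using 1 by linarith
  have "\<bar>v \<bullet> \<delta>\<bar> \<le> norm v * (K * norm \<phi>)"
    using Cauchy_Schwarz_ineq2[of v \<delta>] mult_left_mono[OF \<delta> norm_ge_zero[of v]] by linarith
  also have "\<dots> \<le> K / 2 * ((norm v)\<^sup>2 + (norm \<phi>)\<^sup>2)"
    using mult_left_mono[OF sum_squares_bound[of "norm v" "norm \<phi>"] K] by (simp add: algebra_simps)
  also have "\<dots> \<le> K / 2 * (Q ?x ?x / c\<^sub>Q)"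
  proof (rule mult_left_mono)
    have "(norm v)\<^sup>2 + (norm \<phi>)\<^sup>2 \<le> (norm ?x)\<^sup>2" by (simp add: norm_Pair)
    also have "\<dots> \<le> Q ?x ?x / c\<^sub>Q" using Q_coercive[of ?x] c\<^sub>Q by (simp add: field_simps)
    finally show "(norm v)\<^sup>2 + (norm \<phi>)\<^sup>2 \<le> Q ?x ?x / c\<^sub>Q" .
  qed (use K in simp)
  finally show ?thesis using 2 by (simp add: algebra_simps)
qed

theorem uniqueness:
  assumes s1: "solution \<theta>1 \<phi>1" and s2: "solution \<theta>2 \<phi>2" and t: "t \<in> {0..T}"
  shows "\<theta>1 t = \<theta>2 t \<and> \<phi>1 t = \<phi>2 t"
proof -
  let ?M = "lebesgue_on {0<..<T}"
  have ex: "\<exists>\<theta>' k v v'. has_time_derivative T \<theta> \<theta>' \<and> has_time_derivative T \<phi> k \<and> has_time_derivative T v v' \<and>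
      \<iota> (\<theta> 0) = \<theta>0 \<and> \<iota> (\<phi> 0) = \<phi>0 \<and> v 0 = v0 \<and>
      (AE t in ?M. \<iota> (\<theta> t) \<in> DA1 \<and> v t \<in> DB1 \<and> \<iota> (\<phi> t) \<in> DA2 \<and> \<iota> (k t) = v t \<and>
         \<iota> (\<theta>' t) + \<eta> *\<^sub>R v t + A1 (\<iota> (\<theta> t)) = 0 \<and>
         L (v' t) + B1 (v t) + A2 (\<iota> (\<phi> t)) + \<Phi> (\<iota> (\<phi> t)) + \<L> (\<iota> (\<phi> t)) = B2 (\<iota> (\<theta> t)))"
    if s: "solution \<theta> \<phi>" for \<theta> \<phi>
  proof -
    from s obtain \<theta>' v v' k where *: "has_time_derivative T \<theta> \<theta>'" "has_time_derivative T (\<lambda>t. \<iota> (\<phi> t)) v"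
      "has_time_derivative T v v'" "has_time_derivative T \<phi> k"
      "AE t in ?M. \<iota> (\<theta> t) \<in> DA1" "AE t in ?M. v t \<in> DB1" "AE t in ?M. \<iota> (\<phi> t) \<in> DA2"
      "AE t in ?M. \<iota> (\<theta>' t) + \<eta> *\<^sub>R v t + A1 (\<iota> (\<theta> t)) = 0"
      "AE t in ?M. L (v' t) + B1 (v t) + A2 (\<iota> (\<phi> t)) + \<Phi> (\<iota> (\<phi> t)) + \<L> (\<iota> (\<phi> t)) = B2 (\<iota> (\<theta> t))"
      "\<iota> (\<theta> 0) = \<theta>0" "\<iota> (\<phi> 0) = \<phi>0" "v 0 = v0"
      unfolding is_solution_def domain_valued_def W1inf_space_def by blast
    \<comment> \<open>A solution carries a derivative of \<phi> in V and one in H. Their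
      identification makes the velocity the image of a V-valued derivative, which
      \<open>state_rel\<close> asks for.\<close>
    have "AE t in ?M. \<iota> (k t) = v t"
      using time_derivative_unique[OF has_time_derivative_linear[OF blinfun.bounded_linear_right *(4)] *(2)] T by simp
    with *(5-9) have "AE t in ?M. \<iota> (\<theta> t) \<in> DA1 \<and> v t \<in> DB1 \<and> \<iota> (\<phi> t) \<in> DA2 \<and> \<iota> (k t) = v t \<and>
         \<iota> (\<theta>' t) + \<eta> *\<^sub>R v t + A1 (\<iota> (\<theta> t)) = 0 \<and>
         L (v' t) + B1 (v t) + A2 (\<iota> (\<phi> t)) + \<Phi> (\<iota> (\<phi> t)) + \<L> (\<iota> (\<phi> t)) = B2 (\<iota> (\<theta> t))"
      by eventually_elim blast
    with * show ?thesis by blast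
  qed
  from ex[OF s1] obtain \<theta>1' k1 v1 v1' where 1: "has_time_derivative T \<theta>1 \<theta>1'" "has_time_derivative T \<phi>1 k1"
      "has_time_derivative T v1 v1'" "\<iota> (\<theta>1 0) = \<theta>0" "\<iota> (\<phi>1 0) = \<phi>0" "v1 0 = v0"
      "AE t in ?M. \<iota> (\<theta>1 t) \<in> DA1 \<and> v1 t \<in> DB1 \<and> \<iota> (\<phi>1 t) \<in> DA2 \<and> \<iota> (k1 t) = v1 t \<and>
         \<iota> (\<theta>1' t) + \<eta> *\<^sub>R v1 t + A1 (\<iota> (\<theta>1 t)) = 0 \<and>
         L (v1' t) + B1 (v1 t) + A2 (\<iota> (\<phi>1 t)) + \<Phi> (\<iota> (\<phi>1 t)) + \<L> (\<iota> (\<phi>1 t)) = B2 (\<iota> (\<theta>1 t))" by blast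
  from ex[OF s2] obtain \<theta>2' k2 v2 v2' where 2: "has_time_derivative T \<theta>2 \<theta>2'" "has_time_derivative T \<phi>2 k2"
      "has_time_derivative T v2 v2'" "\<iota> (\<theta>2 0) = \<theta>0" "\<iota> (\<phi>2 0) = \<phi>0" "v2 0 = v0"
      "AE t in ?M. \<iota> (\<theta>2 t) \<in> DA1 \<and> v2 t \<in> DB1 \<and> \<iota> (\<phi>2 t) \<in> DA2 \<and> \<iota> (k2 t) = v2 t \<and>
         \<iota> (\<theta>2' t) + \<eta> *\<^sub>R v2 t + A1 (\<iota> (\<theta>2 t)) = 0 \<and>
         L (v2' t) + B1 (v2 t) + A2 (\<iota> (\<phi>2 t)) + \<Phi> (\<iota> (\<phi>2 t)) + \<L> (\<iota> (\<phi>2 t)) = B2 (\<iota> (\<theta>2 t))" by blast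
  define u where "u t = (\<theta>1 t - \<theta>2 t, \<phi>1 t - \<phi>2 t, v1 t - v2 t)" for t
  define g where "g t = (\<theta>1' t - \<theta>2' t, k1 t - k2 t, v1' t - v2' t)" for t
  have u: "has_time_derivative T u g"
    unfolding u_def[abs_def] g_def[abs_def]
    by (intro has_time_derivative_Pair has_time_derivative_diff 1 2)
  have cu: "continuous_on {0..t} u"
    using time_derivative_continuous[OF u] by (rule continuous_on_subset) (use t in auto)
  \<comment> \<open>Both displacements are continuous in V on a compact interval, so one ball
    contains them and \<Phi> is Lipschitz on it.\<close>
  have "bounded (\<phi>1 ` {0..T})" "bounded (\<phi>2 ` {0..T})"
    using time_derivative_continuous[OF 1(2)] time_derivative_continuous[OF 2(2)]
    by (auto intro: compact_imp_bounded compact_continuous_image)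
  then obtain R where R: "\<And>t. t \<in> {0..T} \<Longrightarrow> norm (\<phi>1 t) \<le> R" "\<And>t. t \<in> {0..T} \<Longrightarrow> norm (\<phi>2 t) \<le> R"
    unfolding bounded_iff by (metis imageI max.coboundedI1 max.coboundedI2)
  define K where "K = \<Lambda> R + C\<^sub>\<L> * norm \<iota>"
  have K: "K \<ge> 0" using \<Lambda>_nonneg C\<^sub>\<L> by (simp add: K_def)
  have ae: "AE r in ?M. r < t \<longrightarrow> Q (u r) (g r) \<le> (2 * \<omega> + K / c\<^sub>Q) * (Q (u r) (u r) / 2)"
  proof -
    have "AE r in ?M. r \<in> {0..T}" by (rule AE_I2) auto
    with 1(7) 2(7) show ?thesis
    proof eventually_elim
      case (elim r)
      let ?\<delta> = "(\<Phi> (\<iota> (\<phi>1 r)) - \<Phi> (\<iota> (\<phi>2 r))) + (\<L> (\<iota> (\<phi>1 r)) - \<L> (\<iota> (\<phi>2 r)))"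
      have d: "A1 (\<iota> (\<theta>1 r) - \<iota> (\<theta>2 r)) = A1 (\<iota> (\<theta>1 r)) - A1 (\<iota> (\<theta>2 r))"
        "B1 (v1 r - v2 r) = B1 (v1 r) - B1 (v2 r)"
        "A2 (\<iota> (\<phi>1 r) - \<iota> (\<phi>2 r)) = A2 (\<iota> (\<phi>1 r)) - A2 (\<iota> (\<phi>2 r))"
        "B2 (\<iota> (\<theta>1 r) - \<iota> (\<theta>2 r)) = B2 (\<iota> (\<theta>1 r)) - B2 (\<iota> (\<theta>2 r))"
        using elim DA1_DB2 by (auto intro!: OA1.A_diff OA2.A_diff OB1.A_diff OB2.A_diff)
      have "Q (u r) (g r) \<le> (2 * \<omega> + K / c\<^sub>Q) * (Q (u r) (u r) / 2)"
        unfolding u_def g_def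
      proof (rule difference_dissipation[where \<delta> = ?\<delta>])
        show "\<iota> (\<theta>1 r - \<theta>2 r) \<in> DA1" "v1 r - v2 r \<in> DB1" "\<iota> (\<phi>1 r - \<phi>2 r) \<in> DA2"
          using elim by (auto simp: blinfun.diff_right intro: OA1.D_diff OB1.D_diff OA2.D_diff)
        show "\<iota> (k1 r - k2 r) = v1 r - v2 r" using elim by (simp add: blinfun.diff_right)
        have "(\<iota> (\<theta>1' r) + \<eta> *\<^sub>R v1 r + A1 (\<iota> (\<theta>1 r))) - (\<iota> (\<theta>2' r) + \<eta> *\<^sub>R v2 r + A1 (\<iota> (\<theta>2 r))) = 0"
          using elim by simp
        then show "\<iota> (\<theta>1' r - \<theta>2' r) + \<eta> *\<^sub>R (v1 r - v2 r) + A1 (\<iota> (\<theta>1 r - \<theta>2 r)) = 0"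
          by (simp add: blinfun.diff_right d algebra_simps)
        have "(L (v1' r) + B1 (v1 r) + A2 (\<iota> (\<phi>1 r)) + \<Phi> (\<iota> (\<phi>1 r)) + \<L> (\<iota> (\<phi>1 r)))
            - (L (v2' r) + B1 (v2 r) + A2 (\<iota> (\<phi>2 r)) + \<Phi> (\<iota> (\<phi>2 r)) + \<L> (\<iota> (\<phi>2 r)))
            = B2 (\<iota> (\<theta>1 r)) - B2 (\<iota> (\<theta>2 r))" using elim by simp
        then show "L (v1' r - v2' r) + B1 (v1 r - v2 r) + A2 (\<iota> (\<phi>1 r - \<phi>2 r)) + ?\<delta> = B2 (\<iota> (\<theta>1 r - \<theta>2 r))"
          unfolding blinfun.diff_right d by (simp add: algebra_simps)
        have "norm (\<L> (\<iota> (\<phi>1 r)) - \<L> (\<iota> (\<phi>2 r))) \<le> C\<^sub>\<L> * (norm \<iota> * norm (\<phi>1 r - \<phi>2 r))"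
          using norm_blinfun[of \<iota> "\<phi>1 r - \<phi>2 r"] C\<^sub>\<L>
          by (intro order_trans[OF \<L>_lip] mult_left_mono) (auto simp: blinfun.diff_right)
        then show "norm ?\<delta> \<le> K * norm (\<phi>1 r - \<phi>2 r)"
          using \<Phi>_ball[OF R(1) R(2), of r r] elim
            norm_triangle_ineq[of "\<Phi> (\<iota> (\<phi>1 r)) - \<Phi> (\<iota> (\<phi>2 r))" "\<L> (\<iota> (\<phi>1 r)) - \<L> (\<iota> (\<phi>2 r))"]
          by (simp add: K_def distrib_right)
      qed (rule K)
      then show ?case by blast
    qed
  qed
  have "Q (u t) (u t) / 2 \<le> exp (2 * (2 * \<omega> + K / c\<^sub>Q) * t) * (Q (u 0) (u 0) / 2)"
  proof (rule energy_gronwall[OF u _ _ _ Q_bilinear cu _ _ _ ae])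
    show "0 \<le> t" "t \<le> T" using t by auto
    show "0 \<le> 2 * \<omega> + K / c\<^sub>Q" using \<omega> K c\<^sub>Q by simp
    show "continuous_on {0..t} (\<lambda>a. Q (u a) (u a) / 2)" by (intro continuous_intros X.Q.continuous_on cu) simp
    show "0 \<le> Q (u s) (u s) / 2" for s using X.Q_pos[of "u s"] by simp
    show "Q (u r) (u r) / 2 - Q (u s) (u s) / 2 \<le> Q (u r) (u r - u s)" for r s
      using X.Q_pos[of "u r - u s"] by (simp add: X.Q.diff_left X.Q.diff_right Q_sym[of "u s" "u r"])
  qed
  moreover have "u 0 = 0"
    using \<iota>_inj[of "\<theta>1 0" "\<theta>2 0"] \<iota>_inj[of "\<phi>1 0" "\<phi>2 0"] 1(4-6) 2(4-6) by (simp add: u_def zero_prod_def)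
  ultimately have "Q (u t) (u t) \<le> 0" by (simp add: X.Q.zero_left)
  then have "u t = 0" by (rule X.Q_zero_imp)
  then show ?thesis by (simp add: u_def zero_prod_def)
qed

end

theorem theorem1p2:
  fixes T \<eta> :: real
    and \<iota> :: "'v::{real_inner, banach, second_countable_topology}
                \<Rightarrow>\<^sub>L 'h::{real_inner, banach, second_countable_topology}"
    and L :: "'h \<Rightarrow>\<^sub>L 'h"
    and DA1 DA2 DB1 DB2 D\<Phi> :: "'h set"
    and A1 A2 B1 B2 \<Phi> \<L> :: "'h \<Rightarrow> 'h"
    and A1s A2s B1s B2s :: "'v \<Rightarrow>\<^sub>L ('v \<Rightarrow>\<^sub>L real)"
    and i :: "'v \<Rightarrow> real"
    and p q C\<^sub>\<Phi> c\<^sub>L C\<^sub>A\<^sub>B C\<^sub>\<L> :: real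
    and \<theta>0 \<phi>0 v0 :: 'h
  assumes T: "T > 0" and \<eta>: "\<eta> > 0"
    \<comment> \<open>(A1)\<close>
    and "dense_compact_embedding \<iota>"
    \<comment> \<open>(A2)\<close>
    and "\<forall>w z. L w \<bullet> z = w \<bullet> L z"
    and "c\<^sub>L > 0" and "\<forall>w. L w \<bullet> w \<ge> c\<^sub>L * (norm w)\<^sup>2"
    \<comment> \<open>(A3)\<close>
    and "linear_operator DA1 A1" and "maximal_monotone DA1 A1" and "selfadjoint_operator DA1 A1"
    and "linear_operator DA2 A2" and "maximal_monotone DA2 A2" and "selfadjoint_operator DA2 A2"
    and "DA1 \<subseteq> range \<iota>" and "DA2 \<subseteq> range \<iota>"
    and "dual_extension \<iota> DA1 A1 A1s" and "dual_extension \<iota> DA2 A2 A2s"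
    and "\<forall>\<alpha>>0. \<exists>\<omega>>0. \<forall>w. A1s w w + \<alpha> * (norm (\<iota> w))\<^sup>2 \<ge> \<omega> * (norm w)\<^sup>2"
    and "\<forall>\<alpha>>0. \<exists>\<omega>>0. \<forall>w. A2s w w + \<alpha> * (norm (\<iota> w))\<^sup>2 \<ge> \<omega> * (norm w)\<^sup>2"
    \<comment> \<open>(A4)\<close>
    and "linear_operator DB1 B1" and "maximal_monotone DB1 B1" and "selfadjoint_operator DB1 B1"
    and "linear_operator DB2 B2" and "maximal_monotone DB2 B2" and "selfadjoint_operator DB2 B2"
    and "DA1 \<subseteq> DB2" and "DB1 \<inter> DA2 \<noteq> {}"
    and "\<forall>w \<in> DB1 \<inter> DA2. B1 w \<bullet> A2 w \<ge> 0"
    and "\<forall>w \<in> DA1. B2 w \<bullet> A1 w \<ge> 0"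
    and "\<forall>w \<in> DB1 \<inter> DA2. \<forall>z \<in> DB1 \<inter> DA2. B1 w \<bullet> A2 z = B1 z \<bullet> A2 w"
    \<comment> \<open>(A5)\<close>
    and "C\<^sub>A\<^sub>B > 0" and "\<forall>\<theta> \<in> DA1. norm (B2 \<theta>) \<le> C\<^sub>A\<^sub>B * (norm (A1 \<theta>) + norm \<theta>)"
    \<comment> \<open>(A6)\<close>
    and "maximal_monotone D\<Phi> \<Phi>" and "\<Phi> 0 = 0" and "range \<iota> \<subseteq> D\<Phi>"
    and "p > 0" and "q > 0" and "C\<^sub>\<Phi> > 0"
    and "\<forall>w z. norm (\<Phi> (\<iota> w) - \<Phi> (\<iota> z))
                 \<le> C\<^sub>\<Phi> * (1 + norm w powr p + norm z powr q) * norm (w - z)"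
    \<comment> \<open>(A7)\<close>
    and "\<forall>w. i w \<ge> 0" and "lower_semicontinuous i" and "convex_on UNIV i"
    and "\<forall>w z. \<Phi> (\<iota> w) \<bullet> (\<iota> w - \<iota> z) \<ge> i w - i z"
    \<comment> \<open>(A8)\<close>
    and "\<forall>\<mu>>0. yosida D\<Phi> \<Phi> \<mu> 0 = 0
              \<and> (\<forall>w \<in> DB1. yosida D\<Phi> \<Phi> \<mu> w \<bullet> B1 w \<ge> 0)
              \<and> (\<forall>w \<in> DA2. yosida D\<Phi> \<Phi> \<mu> w \<bullet> A2 w \<ge> 0)"
    \<comment> \<open>(A9)\<close>
    and "dual_extension \<iota> DB1 B1 B1s" and "dual_extension \<iota> DB2 B2 B2s"
    \<comment> \<open>(A10)\<close>
    and "\<forall>g a b c d d' \<mu> h w.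
           a > 0 \<and> b > 0 \<and> c > 0 \<and> d > 0 \<and> d' > 0 \<and> \<mu> > 0 \<and> h > 0 \<and>
           to_dual \<iota> (L (\<iota> w)) + a *\<^sub>R B1s w + b *\<^sub>R A2s w
             + c *\<^sub>R to_dual \<iota> (yosida D\<Phi> \<Phi> \<mu> (\<iota> w))
             + d *\<^sub>R to_dual \<iota> (\<L> (\<iota> w))
             + d' *\<^sub>R to_dual \<iota> (B2 (resolvent DA1 A1 h (\<iota> w))) = to_dual \<iota> g
           \<longrightarrow> \<iota> w \<in> DB1 \<inter> DA2 \<and>
               L (\<iota> w) + a *\<^sub>R B1 (\<iota> w) + b *\<^sub>R A2 (\<iota> w)
                 + c *\<^sub>R yosida D\<Phi> \<Phi> \<mu> (\<iota> w) + d *\<^sub>R \<L> (\<iota> w)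
                 + d' *\<^sub>R B2 (resolvent DA1 A1 h (\<iota> w)) = g"
    \<comment> \<open>(A11)\<close>
    and "C\<^sub>\<L> > 0" and "C\<^sub>\<L>-lipschitz_on UNIV \<L>"
    \<comment> \<open>(A12)\<close>
    and "\<theta>0 \<in> DA1" and "A1 \<theta>0 \<in> range \<iota>"
    and "\<phi>0 \<in> DB1 \<inter> DA2" and "v0 \<in> DB1 \<inter> range \<iota>"
  shows "(\<exists>\<theta> \<phi>. is_solution T \<eta> \<iota> L DA1 A1 DA2 A2 DB1 B1 B2 \<Phi> \<L> \<theta>0 \<phi>0 v0 \<theta> \<phi>)
       \<and> (\<forall>\<theta> \<phi> \<theta>' \<phi>'.
            is_solution T \<eta> \<iota> L DA1 A1 DA2 A2 DB1 B1 B2 \<Phi> \<L> \<theta>0 \<phi>0 v0 \<theta> \<phi> \<and>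
            is_solution T \<eta> \<iota> L DA1 A1 DA2 A2 DB1 B1 B2 \<Phi> \<L> \<theta>0 \<phi>0 v0 \<theta>' \<phi>'
            \<longrightarrow> (\<forall>t\<in>{0..T}. \<theta> t = \<theta>' t \<and> \<phi> t = \<phi>' t))"
proof -
  \<comment> \<open>With every remaining parameter of (A10) equal to 1, the terms with values in H
    are added to \<open>g\<close>, which (A10) allows to be any element of H.\<close>
  have regularity: "\<iota> w \<in> DB1 \<inter> DA2"
    if ab: "0 < a" "0 < b" and eq: "a *\<^sub>R B1s w + b *\<^sub>R A2s w = to_dual \<iota> g" for a b w g
  proof -
    let ?r = "L (\<iota> w)" and ?s = "1 *\<^sub>R yosida D\<Phi> \<Phi> 1 (\<iota> w)" and ?t = "1 *\<^sub>R \<L> (\<iota> w)"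
      and ?u = "1 *\<^sub>R B2 (resolvent DA1 A1 1 (\<iota> w))"
    have "to_dual \<iota> ?r + a *\<^sub>R B1s w + b *\<^sub>R A2s w + 1 *\<^sub>R to_dual \<iota> (yosida D\<Phi> \<Phi> 1 (\<iota> w))
        + 1 *\<^sub>R to_dual \<iota> (\<L> (\<iota> w)) + 1 *\<^sub>R to_dual \<iota> (B2 (resolvent DA1 A1 1 (\<iota> w)))
        = to_dual \<iota> ?r + (a *\<^sub>R B1s w + b *\<^sub>R A2s w) + to_dual \<iota> ?s + to_dual \<iota> ?t + to_dual \<iota> ?u"
      by (simp add: add.assoc)
    also have "\<dots> = to_dual \<iota> (?r + g + ?s + ?t + ?u)"
      unfolding eq by (simp only: to_dual_add)
    finally show ?thesis
      using assms(46)[rule_format, of a b 1 1 1 1 1 w "?r + g + ?s + ?t + ?u"] ab by simp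
  qed
  have facts: "L w \<bullet> z = w \<bullet> L z" "c\<^sub>L * (norm w)\<^sup>2 \<le> L w \<bullet> w"
    "w \<in> DB1 \<inter> DA2 \<Longrightarrow> 0 \<le> B1 w \<bullet> A2 w" "w \<in> DA1 \<Longrightarrow> 0 \<le> B2 w \<bullet> A1 w"
    "\<lbrakk>w \<in> DB1 \<inter> DA2; z \<in> DB1 \<inter> DA2\<rbrakk> \<Longrightarrow> B1 w \<bullet> A2 z = B1 z \<bullet> A2 w"
    "w \<in> DA1 \<Longrightarrow> norm (B2 w) \<le> C\<^sub>A\<^sub>B * (norm (A1 w) + norm w)" for w z
    using assms(4,6,27,28,29,31) by blast+
  have coercive: "\<alpha> > 0 \<Longrightarrow> \<exists>\<omega>>0. \<forall>w. \<omega> * (norm w)\<^sup>2 \<le> A1s w w + \<alpha> * (norm (\<iota> w))\<^sup>2"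
    "\<alpha> > 0 \<Longrightarrow> \<exists>\<omega>>0. \<forall>w. \<omega> * (norm w)\<^sup>2 \<le> A2s w w + \<alpha> * (norm (\<iota> w))\<^sup>2" for \<alpha>
    using assms(17,18) by blast+
  have nonlinear: "norm (\<Phi> (\<iota> w) - \<Phi> (\<iota> z)) \<le> C\<^sub>\<Phi> * (1 + norm w powr p + norm z powr q) * norm (w - z)"
    "0 \<le> i w" "i w - i z \<le> \<Phi> (\<iota> w) \<bullet> (\<iota> w - \<iota> z)" for w z
    using assms(38,39,42) by blast+
  have lipschitz: "norm (\<L> x - \<L> y) \<le> C\<^sub>\<L> * norm (x - y)" for x y
    using lipschitz_onD[OF assms(48), of x y] by (simp add: dist_norm)
  interpret coupled_problem \<eta> \<iota> L DA1 DA2 DB1 DB2 A1 A2 B1 B2 A1s A2s B1s c\<^sub>L C\<^sub>A\<^sub>B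
    T \<Phi> \<L> i p q C\<^sub>\<Phi> C\<^sub>\<L> \<theta>0 \<phi>0 v0
    by (unfold_locales; fact assms facts coercive nonlinear lipschitz regularity)
  show ?thesis using existence uniqueness by blast
qed

end
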